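(* Let $a,b\in R$ be an ordinary pair (equivalently, $E_{ab}$ is an ordinary elliptic curve). Then there exists a Frobenius lift $\phi$ on $\widehat{E_{ab}}$ which is Lie invariant mod $p$ with eigenvalue $\lambda=H(a,b)^{-1}$, i.e. $\frac{1}{p}\phi^*\omega\equiv H(a,b)^{-1}\,\omega \pmod p$ in $\Omega_{\widehat{E_{ab}}/R}$, where $\omega=dx/y$.
   Context: Throughout, $p$ is a prime with $p\neq 2,3$. $R$ is a complete discrete valuation ring whose maximal ideal is generated by $p$ and whose residue field $\overline{R}=R/pR$ is algebraically closed; $\phi$ also denotes the unique ring endomorphism of $R$ lifting the $p$-power Frobenius of $R/pR$. For $a,b\in R$ put $f(x)=x^3+ax+b$ and $E_{ab}=\mathrm{Spec}\, R[x,y]/(y^2-f(x))$; $\widehat{E_{ab}}$ denotes its $p$-adic completion. Let $\Delta(z_4,z_6)=4z_4^3+27z_6^2$ and let the Hasse polynomial $H(z_4,z_6)\in\mathbb{Z}_{(p)}[z_4,z_6]$ be the coefficient of $x^{p-1}$ in $(x^3+z_4x+z_6)^{(p-1)/2}$. The pair $a,b$ is non-singular if $\Delta(a,b)\in R^\times$, and ordinary if moreover $H(a,b)\in R^\times$. A Frobenius lift on $\widehat{E_{ab}}$ is an endomorphism of the ring $\widehat{\mathcal{O}(E_{ab})}$ compatible with $\phi$ on $R$ whose reduction mod $p$ is the $p$-power Frobenius. Set $\Omega_{\widehat{E_{ab}}/R}:=\varprojlim_n \Omega_{(E_{ab}\otimes R/p^nR)/(R/p^nR)}$ and $\omega=dx/y$.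 A Frobenius lift $\phi$ is Lie invariant mod $p^m$ with eigenvalue $\lambda\in R$ if $\frac{1}{p}\phi^*\omega\equiv\lambda\omega \pmod{p^m}$ in $\Omega_{\widehat{E_{ab}}/R}$ (note $\phi^*\omega$ is divisible by $p$). *)

theory Defs
  imports "HOL-Algebra.Algebraic_Closure_Type"
begin

section \<open>Discrete valuation rings and p-adic completion\<close>

definition discrete_valuation_ring :: "('a, 'm) ring_scheme \<Rightarrow> bool" where
  "discrete_valuation_ring R \<longleftrightarrow>
     principal_domain R \<and> \<not> field R \<and> (\<exists>!M. maximalideal M R)"

definition padic_ideal :: "('a, 'm) ring_scheme \<Rightarrow> nat \<Rightarrow> nat \<Rightarrow> 'a set" where
  "padic_ideal R p n = PIdl\<^bsub>R\<^esub> (add_pow R (p ^ n) \<one>\<^bsub>R\<^esub>)"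

definition padic_quot :: "('a, 'm) ring_scheme \<Rightarrow> nat \<Rightarrow> nat \<Rightarrow> 'a set ring" where
  "padic_quot R p n = R Quot padic_ideal R p n"

definition padic_class :: "('a, 'm) ring_scheme \<Rightarrow> nat \<Rightarrow> nat \<Rightarrow> 'a \<Rightarrow> 'a set" where
  "padic_class R p n r = padic_ideal R p n +>\<^bsub>R\<^esub> r"

text \<open>The map on cosets induced by a map \<open>g\<close> that is constant on each coset.\<close>

definition induced :: "('a \<Rightarrow> 'b) \<Rightarrow> 'a set \<Rightarrow> 'b" where
  "induced g C = the_elem (g ` C)"

text \<open>The inverse limit of the rings \<open>R/p^n R\<close>.\<close>

definition padic_completion :: "('a, 'm) ring_scheme \<Rightarrow> nat \<Rightarrow> (nat \<Rightarrow> 'a set) ring" where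
  "padic_completion R p =
     \<lparr>carrier = {s. \<forall>n. s n \<in> carrier (padic_quot R p n) \<and>
                        induced (padic_class R p n) (s (Suc n)) = s n},
      monoid.mult = (\<lambda>s t n. s n \<otimes>\<^bsub>padic_quot R p n\<^esub> t n),
      one = (\<lambda>n. \<one>\<^bsub>padic_quot R p n\<^esub>),
      ring.zero = (\<lambda>n. \<zero>\<^bsub>padic_quot R p n\<^esub>),
      add = (\<lambda>s t n. s n \<oplus>\<^bsub>padic_quot R p n\<^esub> t n)\<rparr>"

definition to_completion :: "('a, 'm) ring_scheme \<Rightarrow> nat \<Rightarrow> 'a \<Rightarrow> nat \<Rightarrow> 'a set" where
  "to_completion R p r = (\<lambda>n. padic_class R p n r)"

definition padically_complete :: "('a, 'm) ring_scheme \<Rightarrow> nat \<Rightarrow> bool" where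
  "padically_complete R p \<longleftrightarrow>
     bij_betw (to_completion R p) (carrier R) (carrier (padic_completion R p))"

definition lifts_frobenius :: "('a, 'm) ring_scheme \<Rightarrow> nat \<Rightarrow> ('a \<Rightarrow> 'a) \<Rightarrow> bool" where
  "lifts_frobenius S p \<phi> \<longleftrightarrow>
     \<phi> \<in> ring_hom S S \<and> (\<forall>s\<in>carrier S. \<phi> s \<ominus>\<^bsub>S\<^esub> s [^]\<^bsub>S\<^esub> p \<in> padic_ideal S p 1)"

section \<open>Kaehler differentials\<close>

text \<open>
  For a ring homomorphism \<open>i : A \<rightarrow> B\<close>, the module of differentials of \<open>B\<close> over \<open>A\<close> is the free
  \<open>B\<close>-module on symbols \<open>db\<close>, \<open>b \<in> B\<close>, modulo additivity, the Leibniz rule and \<open>d(i a) = 0\<close>.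
  An element of the free module is its coefficient function \<open>B \<Rightarrow> B\<close>, of finite support and
  zero outside the carrier. The \<open>mult\<close> and \<open>one\<close> fields of a module record carry no meaning.
\<close>

definition free_module :: "('b, 'm) ring_scheme \<Rightarrow> ('b, 'b \<Rightarrow> 'b) module" where
  "free_module B =
     \<lparr>carrier = {f. f ` carrier B \<subseteq> carrier B \<and> (\<forall>b. b \<notin> carrier B \<longrightarrow> f b = \<zero>\<^bsub>B\<^esub>) \<and>
                    finite {b. f b \<noteq> \<zero>\<^bsub>B\<^esub>}},
      monoid.mult = undefined, one = undefined,
      ring.zero = (\<lambda>b. \<zero>\<^bsub>B\<^esub>),
      add = (\<lambda>f g b. f b \<oplus>\<^bsub>B\<^esub> g b),
      module.smult = (\<lambda>c f b. c \<otimes>\<^bsub>B\<^esub> f b)\<rparr>"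

definition free_basis :: "('b, 'm) ring_scheme \<Rightarrow> 'b \<Rightarrow> 'b \<Rightarrow> 'b" where
  "free_basis B b = (\<lambda>c. if c = b then \<one>\<^bsub>B\<^esub> else \<zero>\<^bsub>B\<^esub>)"

definition kaehler_relations ::
  "('a, 'k) ring_scheme \<Rightarrow> ('b, 'm) ring_scheme \<Rightarrow> ('a \<Rightarrow> 'b) \<Rightarrow> ('b \<Rightarrow> 'b) set" where
  "kaehler_relations A B i =
     (let F = free_module B; e = free_basis B in
       {e (b \<oplus>\<^bsub>B\<^esub> c) \<ominus>\<^bsub>F\<^esub> (e b \<oplus>\<^bsub>F\<^esub> e c) | b c. b \<in> carrier B \<and> c \<in> carrier B} \<union>
       {e (b \<otimes>\<^bsub>B\<^esub> c) \<ominus>\<^bsub>F\<^esub> (b \<odot>\<^bsub>F\<^esub> e c \<oplus>\<^bsub>F\<^esub> c \<odot>\<^bsub>F\<^esub> e b) | b c. b \<in> carrier B \<and> c \<in> carrier B} \<union>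
       {e (i a) | a. a \<in> carrier A})"

definition kaehler_submodule ::
  "('a, 'k) ring_scheme \<Rightarrow> ('b, 'm) ring_scheme \<Rightarrow> ('a \<Rightarrow> 'b) \<Rightarrow> ('b \<Rightarrow> 'b) set" where
  "kaehler_submodule A B i =
     \<Inter>{N. submodule N B (free_module B) \<and> kaehler_relations A B i \<subseteq> N}"

definition quot_module ::
  "('b, 'c) module \<Rightarrow> 'c set \<Rightarrow> ('b, 'c set) module" where
  "quot_module M N =
     \<lparr>carrier = a_rcosets\<^bsub>M\<^esub> N,
      monoid.mult = undefined, one = undefined,
      ring.zero = N,
      add = set_add M,
      module.smult = (\<lambda>c C. \<Union>x\<in>C. N +>\<^bsub>M\<^esub> (c \<odot>\<^bsub>M\<^esub> x))\<rparr>"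

definition kaehler ::
  "('a, 'k) ring_scheme \<Rightarrow> ('b, 'm) ring_scheme \<Rightarrow> ('a \<Rightarrow> 'b) \<Rightarrow> ('b, ('b \<Rightarrow> 'b) set) module" where
  "kaehler A B i = quot_module (free_module B) (kaehler_submodule A B i)"

definition kaehler_class ::
  "('a, 'k) ring_scheme \<Rightarrow> ('b, 'm) ring_scheme \<Rightarrow> ('a \<Rightarrow> 'b) \<Rightarrow> ('b \<Rightarrow> 'b) \<Rightarrow> ('b \<Rightarrow> 'b) set" where
  "kaehler_class A B i f = kaehler_submodule A B i +>\<^bsub>free_module B\<^esub> f"

definition kaehler_d ::
  "('a, 'k) ring_scheme \<Rightarrow> ('b, 'm) ring_scheme \<Rightarrow> ('a \<Rightarrow> 'b) \<Rightarrow> 'b \<Rightarrow> ('b \<Rightarrow> 'b) set" where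
  "kaehler_d A B i b = kaehler_class A B i (free_basis B b)"

text \<open>
  A ring homomorphism \<open>g : B \<rightarrow> B'\<close> mapping the image of \<open>A\<close> into that of \<open>A'\<close> induces
  \<open>\<Sum> c db \<mapsto> \<Sum> g(c) d(g b)\<close> on differentials; \<open>free_push\<close> is this map on the free modules.
\<close>

definition free_push ::
  "('b, 'm) ring_scheme \<Rightarrow> ('c, 'n) ring_scheme \<Rightarrow> ('b \<Rightarrow> 'c) \<Rightarrow> ('b \<Rightarrow> 'b) \<Rightarrow> 'c \<Rightarrow> 'c" where
  "free_push B B' g f =
     (\<lambda>c. \<Oplus>\<^bsub>B'\<^esub>b\<in>{b \<in> carrier B. f b \<noteq> \<zero>\<^bsub>B\<^esub> \<and> g b = c}. g (f b))"

definition kaehler_map ::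
  "('b, 'm) ring_scheme \<Rightarrow> ('a, 'k) ring_scheme \<Rightarrow> ('c, 'n) ring_scheme \<Rightarrow> ('a \<Rightarrow> 'c) \<Rightarrow>
   ('b \<Rightarrow> 'c) \<Rightarrow> ('b \<Rightarrow> 'b) set \<Rightarrow> ('c \<Rightarrow> 'c) set" where
  "kaehler_map B A' B' i' g = induced (\<lambda>f. kaehler_class A' B' i' (free_push B B' g f))"

section \<open>Completed differentials\<close>

text \<open>
  In this section \<open>h : A \<rightarrow> B\<close> is a ring homomorphism; \<open>padic_structure\<close> is its reduction
  \<open>A/p^n \<rightarrow> B/p^n\<close>.
\<close>

definition padic_structure ::
  "('b, 'm) ring_scheme \<Rightarrow> ('a \<Rightarrow> 'b) \<Rightarrow> nat \<Rightarrow> nat \<Rightarrow> 'a set \<Rightarrow> 'b set" where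
  "padic_structure B h p n = induced (\<lambda>r. padic_class B p n (h r))"

definition padic_kaehler ::
  "('a, 'k) ring_scheme \<Rightarrow> ('b, 'm) ring_scheme \<Rightarrow> ('a \<Rightarrow> 'b) \<Rightarrow> nat \<Rightarrow> nat \<Rightarrow>
   ('b set, ('b set \<Rightarrow> 'b set) set) module" where
  "padic_kaehler A B h p n =
     kaehler (padic_quot A p n) (padic_quot B p n) (padic_structure B h p n)"

definition padic_kaehler_map ::
  "('a, 'k) ring_scheme \<Rightarrow> ('b, 'm) ring_scheme \<Rightarrow> ('a \<Rightarrow> 'b) \<Rightarrow> nat \<Rightarrow> nat \<Rightarrow> nat \<Rightarrow>
   ('b set \<Rightarrow> 'b set) \<Rightarrow> ('b set \<Rightarrow> 'b set) set \<Rightarrow> ('b set \<Rightarrow> 'b set) set" where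
  "padic_kaehler_map A B h p m n g =
     kaehler_map (padic_quot B p m)
       (padic_quot A p n) (padic_quot B p n) (padic_structure B h p n) g"

text \<open>The inverse limit over \<open>n\<close> of the differentials of \<open>B/p^n\<close> over \<open>A/p^n\<close>, as a module over
  the completion of \<open>B\<close>.\<close>

definition complete_kaehler ::
  "('a, 'k) ring_scheme \<Rightarrow> ('b, 'm) ring_scheme \<Rightarrow> ('a \<Rightarrow> 'b) \<Rightarrow> nat \<Rightarrow>
   (nat \<Rightarrow> 'b set, nat \<Rightarrow> ('b set \<Rightarrow> 'b set) set) module" where
  "complete_kaehler A B h p =
     \<lparr>carrier = {w. \<forall>n. w n \<in> carrier (padic_kaehler A B h p n) \<and>
                  padic_kaehler_map A B h p (Suc n) n (induced (padic_class B p n)) (w (Suc n)) = w n},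
      monoid.mult = undefined, one = undefined,
      ring.zero = (\<lambda>n. \<zero>\<^bsub>padic_kaehler A B h p n\<^esub>),
      add = (\<lambda>v w n. v n \<oplus>\<^bsub>padic_kaehler A B h p n\<^esub> w n),
      module.smult = (\<lambda>s w n. s n \<odot>\<^bsub>padic_kaehler A B h p n\<^esub> w n)\<rparr>"

definition complete_d ::
  "('a, 'k) ring_scheme \<Rightarrow> ('b, 'm) ring_scheme \<Rightarrow> ('a \<Rightarrow> 'b) \<Rightarrow> nat \<Rightarrow>
   (nat \<Rightarrow> 'b set) \<Rightarrow> nat \<Rightarrow> ('b set \<Rightarrow> 'b set) set" where
  "complete_d A B h p s =
     (\<lambda>n. kaehler_d (padic_quot A p n) (padic_quot B p n) (padic_structure B h p n) (s n))"

text \<open>The reduction \<open>B/p^n \<rightarrow> B/p^n\<close> of an endomorphism of the completion of \<open>B\<close>, and the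
  pullback of completed differentials along such an endomorphism.\<close>

definition reduce_endo ::
  "('b, 'm) ring_scheme \<Rightarrow> nat \<Rightarrow> ((nat \<Rightarrow> 'b set) \<Rightarrow> (nat \<Rightarrow> 'b set)) \<Rightarrow> nat \<Rightarrow> 'b set \<Rightarrow> 'b set" where
  "reduce_endo B p \<Phi> n = induced (\<lambda>u. \<Phi> (to_completion B p u) n)"

definition complete_pullback ::
  "('a, 'k) ring_scheme \<Rightarrow> ('b, 'm) ring_scheme \<Rightarrow> ('a \<Rightarrow> 'b) \<Rightarrow> nat \<Rightarrow>
   ((nat \<Rightarrow> 'b set) \<Rightarrow> (nat \<Rightarrow> 'b set)) \<Rightarrow>
   (nat \<Rightarrow> ('b set \<Rightarrow> 'b set) set) \<Rightarrow> (nat \<Rightarrow> ('b set \<Rightarrow> 'b set) set)" where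
  "complete_pullback A B h p \<Phi> w =
     (\<lambda>n. padic_kaehler_map A B h p n n (reduce_endo B p \<Phi> n) (w n))"

section \<open>The curve\<close>

text \<open>\<open>R[x,y]\<close> is the type \<open>'r poly poly\<close>: the inner variable is \<open>x\<close>, the outer one \<open>y\<close>.\<close>

definition curve_ideal :: "'r::idom \<Rightarrow> 'r \<Rightarrow> 'r poly poly set" where
  "curve_ideal a b = PIdl\<^bsub>ring_of_type_algebra\<^esub> ([:0, 1:]\<^sup>2 - [:[:b, a, 0, 1:]:])"

definition curve_ring :: "'r::idom \<Rightarrow> 'r \<Rightarrow> 'r poly poly set ring" where
  "curve_ring a b = ring_of_type_algebra Quot curve_ideal a b"

definition curve_class :: "'r::idom \<Rightarrow> 'r \<Rightarrow> 'r poly poly \<Rightarrow> 'r poly poly set" where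
  "curve_class a b g = curve_ideal a b +>\<^bsub>ring_of_type_algebra\<^esub> g"

definition curve_const :: "'r::idom \<Rightarrow> 'r \<Rightarrow> 'r \<Rightarrow> 'r poly poly set" where
  "curve_const a b r = curve_class a b [:[:r:]:]"

definition curve_hat :: "nat \<Rightarrow> 'r::idom \<Rightarrow> 'r \<Rightarrow> (nat \<Rightarrow> 'r poly poly set set) ring" where
  "curve_hat p a b = padic_completion (curve_ring a b) p"

definition curve_hat_class ::
  "nat \<Rightarrow> 'r::idom \<Rightarrow> 'r \<Rightarrow> 'r poly poly \<Rightarrow> nat \<Rightarrow> 'r poly poly set set" where
  "curve_hat_class p a b g = to_completion (curve_ring a b) p (curve_class a b g)"

definition curve_hat_const ::
  "nat \<Rightarrow> 'r::idom \<Rightarrow> 'r \<Rightarrow> 'r \<Rightarrow> nat \<Rightarrow> 'r poly poly set set" where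
  "curve_hat_const p a b r = to_completion (curve_ring a b) p (curve_const a b r)"

definition curve_hat_differentials ::
  "nat \<Rightarrow> 'r::idom \<Rightarrow> 'r \<Rightarrow>
   (nat \<Rightarrow> 'r poly poly set set,
    nat \<Rightarrow> ('r poly poly set set \<Rightarrow> 'r poly poly set set) set) module" where
  "curve_hat_differentials p a b =
     complete_kaehler ring_of_type_algebra (curve_ring a b) (curve_const a b) p"

text \<open>
  The function \<open>y\<close> is not invertible on the affine curve, but for a non-singular pair there is
  exactly one differential \<open>w\<close> with \<open>y w = dx\<close>; this is \<open>dx/y\<close>.
\<close>

definition curve_omega ::
  "nat \<Rightarrow> 'r::idom \<Rightarrow> 'r \<Rightarrow> nat \<Rightarrow> ('r poly poly set set \<Rightarrow> 'r poly poly set set) set" where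
  "curve_omega p a b =
     (THE w. w \<in> carrier (curve_hat_differentials p a b) \<and>
        curve_hat_class p a b [:0, 1:] \<odot>\<^bsub>curve_hat_differentials p a b\<^esub> w =
        complete_d ring_of_type_algebra (curve_ring a b) (curve_const a b) p
          (curve_hat_class p a b [:[:0, 1:]:]))"

definition discriminant :: "'r::comm_ring_1 \<Rightarrow> 'r \<Rightarrow> 'r" where
  "discriminant a b = 4 * a ^ 3 + 27 * b ^ 2"

text \<open>The value of the Hasse polynomial: forming the coefficient commutes with specialising
  \<open>z\<^sub>4, z\<^sub>6\<close> to \<open>a, b\<close>.\<close>

definition hasse :: "nat \<Rightarrow> 'r::comm_ring_1 \<Rightarrow> 'r \<Rightarrow> 'r" where
  "hasse p a b = Polynomial.coeff ([:b, a, 0, 1:] ^ ((p - 1) div 2)) (p - 1)"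

definition nonsingular_pair :: "'r::comm_ring_1 \<Rightarrow> 'r \<Rightarrow> bool" where
  "nonsingular_pair a b \<longleftrightarrow> discriminant a b dvd 1"

definition ordinary_pair :: "nat \<Rightarrow> 'r::comm_ring_1 \<Rightarrow> 'r \<Rightarrow> bool" where
  "ordinary_pair p a b \<longleftrightarrow> nonsingular_pair a b \<and> hasse p a b dvd 1"

definition curve_frobenius_lift ::
  "nat \<Rightarrow> ('r \<Rightarrow> 'r) \<Rightarrow> 'r::idom \<Rightarrow> 'r \<Rightarrow>
   ((nat \<Rightarrow> 'r poly poly set set) \<Rightarrow> (nat \<Rightarrow> 'r poly poly set set)) \<Rightarrow> bool" where
  "curve_frobenius_lift p \<phi> a b \<Phi> \<longleftrightarrow>
     lifts_frobenius (curve_hat p a b) p \<Phi> \<and>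
     (\<forall>r. \<Phi> (curve_hat_const p a b r) = curve_hat_const p a b (\<phi> r))"

text \<open>The witness \<open>\<eta>\<close> below is \<open>(1/p) \<Phi>\<^sup>*\<omega>\<close>; it is unique because for a non-singular pair the
  completed differentials have no \<open>p\<close>-torsion.\<close>

definition lie_invariant_mod ::
  "nat \<Rightarrow> 'r::idom \<Rightarrow> 'r \<Rightarrow>
   ((nat \<Rightarrow> 'r poly poly set set) \<Rightarrow> (nat \<Rightarrow> 'r poly poly set set)) \<Rightarrow> nat \<Rightarrow> 'r \<Rightarrow> bool" where
  "lie_invariant_mod p a b \<Phi> m l \<longleftrightarrow>
     (let M = curve_hat_differentials p a b; \<omega> = curve_omega p a b in
      \<exists>\<eta>\<in>carrier M.
        add_pow M p \<eta> =
          complete_pullback ring_of_type_algebra (curve_ring a b) (curve_const a b) p \<Phi> \<omega> \<and>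
        (\<exists>\<theta>\<in>carrier M. \<eta> \<ominus>\<^bsub>M\<^esub> (curve_hat_const p a b l \<odot>\<^bsub>M\<^esub> \<omega>) = add_pow M (p ^ m) \<theta>))"

end

theory Submission
  imports Defs
begin

text \<open>
  Write \<open>f = x\<^sup>3 + a x + b\<close>, \<open>m = (p - 1)/2\<close>, \<open>H\<close> for the Hasse invariant and \<open>l = H\<^sup>-\<^sup>1\<close>. The lift is sought in
  the form \<open>x \<mapsto> U(x) = x\<^sup>p + p u(x)\<close>, \<open>y \<mapsto> y W(x)\<close> with \<open>W = f\<^sup>m + p q(x)\<close>, so that the only constraint is
  \<open>f W\<^sup>2 = f\<^sup>\<phi>(U)\<close> over the completion of \<open>R[x]\<close>. Lie invariance mod \<open>p\<close> amounts to
  \<open>x\<^sup>p\<^sup>-\<^sup>1 + u' = l f\<^sup>m\<close> mod \<open>p\<close>. As \<open>H\<close> is the coefficient of \<open>x\<^sup>p\<^sup>-\<^sup>1\<close> in \<open>f\<^sup>m\<close> and \<open>deg f\<^sup>m < 2p - 1\<close>, this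
  is solved by \<open>u = l G + w\<^sup>p\<close> with \<open>G' = f\<^sup>m - H x\<^sup>p\<^sup>-\<^sup>1\<close> and an arbitrary \<open>w\<close>. Mod \<open>p\<^sup>2\<close> the constraint
  asks that \<open>f\<^sup>m\<^sup>+\<^sup>1\<close> divide a certain \<open>Z + w\<^sup>p\<close> mod \<open>p\<close>. Since \<open>Z'\<close> is divisible by \<open>f\<^sup>m\<close> and \<open>f\<close> is separable,
  divisibility by \<open>f\<close> suffices, and that is achieved by choosing \<open>p\<close>-th roots of the values of \<open>-Z\<close>
  at the three roots of \<open>f\<close>. The gradient of the constraint is unimodular by the Bezout identity of
  \<open>f\<close> and \<open>f'\<close>, so Newton iteration lifts the solution to all powers of \<open>p\<close>.

  Modulo \<open>p\<^sup>n\<close> the differentials are free on \<open>\<omega>\<close>, the coordinate being the derivation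
  \<open>y \<partial>/\<partial>x + (f'/2) \<partial>/\<partial>y\<close>; in this coordinate \<open>\<Phi>\<^sup>*\<omega> = p c \<omega>\<close> with an explicit polynomial \<open>c(x)\<close>
  that is congruent to \<open>l\<close> mod \<open>p\<close>.
\<close>

section \<open>Polynomial congruences and the lift on the line\<close>

lemma freshmans_dream_dvd:
  fixes x y :: "'a::comm_ring_1"
  assumes "Factorial_Ring.prime p"
  shows "of_nat p dvd (x + y) ^ p - (x ^ p + y ^ p)"
proof -
  have p: "p > 0" using assms prime_gt_0_nat by blast
  let ?t = "\<lambda>k. of_nat (p choose k) * x ^ k * y ^ (p - k)"
  have split: "{..p} = insert 0 (insert p {0<..<p})" using p by auto
  have "(x + y) ^ p = (\<Sum>k\<le>p. ?t k)" by (rule binomial_ring)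
  also have "\<dots> = ?t 0 + (?t p + (\<Sum>k\<in>{0<..<p}. ?t k))"
    unfolding split using p by (subst sum.insert; simp)+
  finally have "(x + y) ^ p - (x ^ p + y ^ p) = (\<Sum>k\<in>{0<..<p}. ?t k)"
    using p by simp
  moreover have "of_nat p dvd ?t k" if "k \<in> {0<..<p}" for k
  proof -
    have "p dvd p choose k" using that assms by (intro dvd_choose_prime) auto
    then have "(of_nat p :: 'a) dvd of_nat (p choose k)" by (metis dvd_def of_nat_mult)
    then show ?thesis by (simp add: dvd_mult2)
  qed
  ultimately show ?thesis by (auto intro: dvd_sum)
qed

lemma dvd_diff_power:
  fixes x y :: "'a::comm_ring_1"
  assumes "c dvd x - y" shows "c dvd x ^ n - y ^ n"
proof (induction n)
  case (Suc n)
  have "x ^ Suc n - y ^ Suc n = (x - y) * x ^ n + y * (x ^ n - y ^ n)"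
    by (simp add: algebra_simps)
  with Suc assms show ?case by (simp add: dvd_add)
qed simp

lemma dvd_pderiv_of_nat:
  assumes "of_nat n dvd (g :: 'a::idom poly)" shows "of_nat n dvd pderiv g"
proof -
  from assms obtain h where "g = of_nat n * h" by blast
  then have "pderiv g = of_nat n * pderiv h" by (simp add: pderiv_mult)
  then show ?thesis by simp
qed

lemma pderiv_sum': "pderiv (sum g I) = (\<Sum>i\<in>I. pderiv (g i))"
  by (induction I rule: infinite_finite_induct) (simp_all add: pderiv_add)

text \<open>Termwise integration. Invertibility of \<open>i + 1\<close> is asked only where a
  coefficient occurs, which admits polynomials of degree \<open>p\<close> and more.\<close>

lemma ex_antiderivative:
  fixes h :: "'a::idom poly"
  assumes "\<And>i. Polynomial.coeff h i \<noteq> 0 \<Longrightarrow> (of_nat (Suc i) :: 'a) dvd 1"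
  shows "\<exists>g. pderiv g = h"
proof -
  have "\<exists>e. \<forall>i. Polynomial.coeff h i \<noteq> 0 \<longrightarrow> of_nat (Suc i) * e i = (1::'a)"
    using assms unfolding dvd_def by (intro choice) metis
  then obtain e where e: "\<And>i. Polynomial.coeff h i \<noteq> 0 \<Longrightarrow> of_nat (Suc i) * e i = (1::'a)"
    by blast
  define g where "g = (\<Sum>i\<le>Polynomial.degree h. Polynomial.monom (Polynomial.coeff h i * e i) (Suc i))"
  have "pderiv g = (\<Sum>i\<le>Polynomial.degree h. Polynomial.monom (Polynomial.coeff h i) i)"
    unfolding g_def pderiv_sum'
  proof (rule sum.cong)
    fix i
    show "pderiv (Polynomial.monom (Polynomial.coeff h i * e i) (Suc i)) = Polynomial.monom (Polynomial.coeff h i) i"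
      using e[of i] by (cases "Polynomial.coeff h i = 0") (simp_all add: pderiv_monom mult.left_commute del: of_nat_Suc)
  qed simp
  then show ?thesis using poly_as_sum_of_monoms by metis
qed

text \<open>The hypotheses on \<open>R\<close> and \<open>\<phi>\<close> in elementwise form;
  algebraic closedness of \<open>R/p\<close> enters as \<open>ex_root\<close>, with roots lifted to
  \<open>R\<close>.\<close>

locale frobenius_dvr =
  fixes p :: nat and \<phi> :: "'r::idom \<Rightarrow> 'r"
  assumes prime_p: "Factorial_Ring.prime p" and p_neq_2: "p \<noteq> 2" and p_neq_3: "p \<noteq> 3"
    and prime_elem_p: "prime_elem (of_nat p :: 'r)"
    and unit_if_not_dvd: "\<And>r :: 'r. \<not> of_nat p dvd r \<Longrightarrow> r dvd 1"
    and \<phi>_add: "\<And>r s. \<phi> (r + s) = \<phi> r + \<phi> s"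
    and \<phi>_mult: "\<And>r s. \<phi> (r * s) = \<phi> r * \<phi> s"
    and \<phi>_1: "\<phi> 1 = 1"
    and \<phi>_frob: "\<And>r. of_nat p dvd \<phi> r - r ^ p"
    and ex_root: "\<And>g :: 'r poly. lead_coeff g = 1 \<Longrightarrow> Polynomial.degree g > 0 \<Longrightarrow>
                    \<exists>r. of_nat p dvd poly g r"
begin

section \<open>Congruences modulo \<open>p\<close> in \<open>R\<close> and
  \<open>R[x]\<close>\<close>

lemma p_ge_5: "p \<ge> 5"
proof -
  have "p \<noteq> 4" using prime_p by (auto dest: prime_product[of 2 2])
  then show ?thesis using prime_ge_2_nat[OF prime_p] p_neq_2 p_neq_3 by linarith
qed

lemma p_eq: "p = 2 * ((p - 1) div 2) + 1"
proof -
  have "odd p" using prime_p p_neq_2 prime_odd_nat prime_ge_2_nat by (metis le_neq_implies_less)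
  then show ?thesis by (metis add_diff_cancel_right' oddE odd_two_times_div_two_nat dvd_triv_left even_add nonzero_mult_div_cancel_left zero_neq_numeral)
qed

lemma \<phi>_0 [simp]: "\<phi> 0 = 0"
  using \<phi>_add[of 0 0] by (metis add.right_neutral add_left_cancel)

lemma \<phi>_of_nat: "\<phi> (of_nat n) = of_nat n"
  by (induction n) (simp_all add: \<phi>_add \<phi>_1)

lemma \<phi>_numeral: "\<phi> (numeral n) = numeral n"
  using \<phi>_of_nat[of "numeral n"] by simp

lemma \<phi>_power: "\<phi> (r ^ n) = \<phi> r ^ n"
  by (induction n) (simp_all add: \<phi>_mult \<phi>_1)

text \<open>An integer Bezout relation between \<open>p\<close> and \<open>k\<close> persists in
  \<open>R\<close>. As \<open>p\<close> is not a unit there, it cannot divide the image of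
  \<open>k\<close>.\<close>

lemma of_nat_unit:
  assumes "\<not> p dvd k" shows "(of_nat k :: 'r) dvd 1"
proof (rule unit_if_not_dvd)
  show "\<not> (of_nat p :: 'r) dvd of_nat k"
  proof
    assume d: "(of_nat p :: 'r) dvd of_nat k"
    have "coprime p k" using assms prime_p by (simp add: prime_imp_coprime)
    then have "\<exists>u v. u * int p + v * int k = 1"
      using bezout_int[of "int p" "int k"] by (auto simp: coprime_iff_gcd_eq_1)
    then obtain u v where "u * int p + v * int k = 1" by blast
    then have "of_int (u * int p + v * int k) = (1::'r)" by simp
    then have "of_int u * of_nat p + of_int v * of_nat k = (1::'r)" by simp
    then have "(of_nat p :: 'r) dvd 1" using d by (metis dvd_add dvd_mult dvd_refl dvd_mult2)
    then show False using prime_elem_p by (simp add: prime_elem_def)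
  qed
qed

lemma prime_elem_p_poly: "prime_elem (of_nat p :: 'r poly)"
  using prime_elem_p by (simp add: of_nat_poly prime_elem_const_poly_iff)

lemma prime_elem_p_poly2: "prime_elem (of_nat p :: 'r poly poly)"
  using prime_elem_p_poly by (simp add: of_nat_poly[of p] prime_elem_const_poly_iff)

lemma p_poly_not_dvd_monic:
  assumes "lead_coeff (g :: 'r poly) = 1" shows "\<not> of_nat p dvd g"
proof
  assume "of_nat p dvd g"
  then have "of_nat p dvd lead_coeff g" by (simp add: of_nat_poly const_poly_dvd_iff)
  then show False using assms prime_elem_p by (simp add: prime_elem_def)
qed

lemma p_poly_neq_0: "(of_nat p :: 'r poly) \<noteq> 0"
  using prime_elem_p_poly by (simp add: prime_elem_def)

text \<open>\<open>p\<close> stays prime in \<open>R[x]\<close> and divides no monic polynomial.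
  This is what allows powers of \<open>f\<close> to be cancelled modulo \<open>p\<close>.\<close>

lemma cancel_mod_p:
  fixes g h :: "'r poly"
  assumes "lead_coeff g = 1" "of_nat p dvd g * h" shows "of_nat p dvd h"
  using assms prime_elem_p_poly p_poly_not_dvd_monic prime_elem_dvd_mult_iff by blast

text \<open>Modulo \<open>p\<close>, raising to the power \<open>p\<close> is additive and acts on
  constants as \<open>\<phi>\<close>; induction on the coefficients does the rest.\<close>

lemma frobenius_poly:
  fixes g :: "'r poly"
  shows "of_nat p dvd map_poly \<phi> g \<circ>\<^sub>p Polynomial.monom 1 p - g ^ p"
proof (induction g)
  case 0
  then show ?case using p_ge_5 by (simp add: power_0_left)
next
  case (pCons c g)
  let ?x = "Polynomial.monom 1 p :: 'r poly"
  have e: "pCons c g = [:c:] + [:0, 1:] * g" by simp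
  have 1: "of_nat p dvd (pCons c g) ^ p - ([:c:] ^ p + ([:0, 1:] * g) ^ p)"
    unfolding e by (rule freshmans_dream_dvd[OF prime_p])
  have 2: "of_nat p dvd [:\<phi> c:] - [:c:] ^ p"
    using \<phi>_frob[of c] by (simp add: of_nat_poly poly_const_pow)
  have 3: "([:0, 1:] * g) ^ p = ?x * g ^ p" by (simp only: power_mult_distrib monom_altdef smult_1_left)
  have "map_poly \<phi> (pCons c g) \<circ>\<^sub>p ?x - pCons c g ^ p =
      ([:\<phi> c:] - [:c:] ^ p) + ?x * (map_poly \<phi> g \<circ>\<^sub>p ?x - g ^ p)
      - ((pCons c g) ^ p - ([:c:] ^ p + ([:0, 1:] * g) ^ p))"
    unfolding 3 by (simp add: map_poly_pCons pcompose_pCons algebra_simps)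
  then show ?case using 1 2 pCons by (metis dvd_add dvd_diff dvd_mult)
qed

end

section \<open>The cubic and its discriminant identity\<close>

definition cubic :: "'a::comm_ring_1 \<Rightarrow> 'a \<Rightarrow> 'a \<Rightarrow> 'a" where
  "cubic A B x = x ^ 3 + A * x + B"

definition dcubic :: "'a::comm_ring_1 \<Rightarrow> 'a \<Rightarrow> 'a" where
  "dcubic A x = 3 * x ^ 2 + A"

text \<open>\<open>bez0\<close> and \<open>bez1\<close> are \<open>D\<close> times the cofactors
  that express the discriminant as a combination of the cubic and its derivative; \<open>D\<close>
  will be the inverse of the discriminant.\<close>

definition bez0 :: "'a::comm_ring_1 \<Rightarrow> 'a \<Rightarrow> 'a \<Rightarrow> 'a \<Rightarrow> 'a" where
  "bez0 D A B x = - D * (18 * A * x - 27 * B)"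

definition bez1 :: "'a::comm_ring_1 \<Rightarrow> 'a \<Rightarrow> 'a \<Rightarrow> 'a \<Rightarrow> 'a" where
  "bez1 D A B x = - D * (- 6 * A * x ^ 2 + 9 * B * x - 4 * A ^ 2)"

text \<open>Kept over an arbitrary commutative ring because \<open>A\<close>, \<open>B\<close> and
  \<open>x\<close> are later polynomials: the identity is applied to \<open>f^\<phi>\<close> with a
  polynomial substituted for the variable.\<close>

lemma cubic_bezout:
  assumes "discriminant A B * D = 1"
  shows "bez0 D A B x * cubic A B x + bez1 D A B x * dcubic A x = 1"
proof -
  have "bez0 D A B x * cubic A B x + bez1 D A B x * dcubic A x = discriminant A B * D"
    unfolding bez0_def bez1_def cubic_def dcubic_def discriminant_def
    by (simp add: algebra_simps power2_eq_square power3_eq_cube)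
  then show ?thesis using assms by simp
qed

locale ordinary_curve = frobenius_dvr p \<phi> for p and \<phi> :: "'r::idom \<Rightarrow> 'r" +
  fixes a b l \<delta> half :: 'r
  assumes hasse_unit: "hasse p a b * l = 1"
    and disc_unit: "discriminant a b * \<delta> = 1"
    and half: "2 * half = 1"
begin

definition m where "m = (p - 1) div 2"

definition f :: "'r poly" where "f = [:b, a, 0, 1:]"

lemma p_eq_m: "p = 2 * m + 1"
  unfolding m_def by (rule p_eq)

lemma f_eq_cubic: "f = cubic [:a:] [:b:] [:0, 1:]"
  by (simp add: f_def cubic_def power3_eq_cube)

lemma pderiv_f: "pderiv f = dcubic [:a:] [:0, 1:]"
  by (simp add: f_def dcubic_def pderiv_pCons power2_eq_square)
    (simp flip: numeral_poly)

lemma lead_coeff_f_power: "lead_coeff (f ^ n) = 1"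
  by (simp add: lead_coeff_power f_def)

section \<open>The polynomial \<open>f\<close> modulo \<open>p\<close>: roots, interpolation and the
  Hasse invariant\<close>

lemma f_bezout: "\<exists>s t. s * f + t * pderiv f = 1"
proof -
  have "discriminant [:a:] [:b:] * [:\<delta>:] = 1"
    using disc_unit by (simp add: discriminant_def numeral_poly poly_const_pow one_pCons mult.commute)
  from cubic_bezout[OF this, of "[:0, 1:]"] show ?thesis
    by (metis f_eq_cubic pderiv_f)
qed

text \<open>The roots are split off one at a time. Modulo \<open>p\<close> the three products are
  the values of \<open>f'\<close> at the roots, and these are units because \<open>f\<close> and
  \<open>f'\<close> generate the unit ideal.\<close>

lemma ex_roots_mod_p:
  obtains e1 e2 e3 where
    "of_nat p dvd f - [:- e1, 1:] * [:- e2, 1:] * [:- e3, 1:]"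
    "(e1 - e2) * (e1 - e3) dvd 1" "(e2 - e1) * (e2 - e3) dvd 1" "(e3 - e1) * (e3 - e2) dvd 1"
proof -
  let ?P = "of_nat p :: 'r"
  obtain e1 where e1: "?P dvd poly f e1"
    using ex_root[of f] by (auto simp: f_def)
  \<comment> \<open>The quotient of \<open>f\<close> by \<open>x - e1\<close>; the remainder is
    \<open>f(e1)\<close>.\<close>
  define g where "g = [:a + e1 ^ 2, e1, 1:]"
  obtain e2 where e2: "?P dvd poly g e2"
    using ex_root[of g] by (auto simp: g_def)
  \<comment> \<open>\<open>f\<close> has no \<open>x^2\<close> term, so its roots sum to
    zero.\<close>
  define e3 where "e3 = - e1 - e2"
  have fg: "f = [:- e1, 1:] * [:- e2, 1:] * [:- e3, 1:] + [:poly g e2:] * [:- e1, 1:] + [:poly f e1:]"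
    by (simp add: f_def g_def e3_def algebra_simps power2_eq_square)
  have "of_nat p dvd [:poly g e2:]" "of_nat p dvd [:poly f e1:]"
    using e1 e2 by (simp_all add: of_nat_poly)
  then have 1: "of_nat p dvd f - [:- e1, 1:] * [:- e2, 1:] * [:- e3, 1:]"
    by (subst (1) fg) (simp only: add.assoc add_diff_cancel_left' dvd_add dvd_mult2)
  have f_root: "?P dvd poly f e \<and> ?P dvd poly (pderiv f) e - c \<Longrightarrow> c dvd 1" for e c
  proof (rule unit_if_not_dvd, rule notI)
    assume *: "?P dvd poly f e \<and> ?P dvd poly (pderiv f) e - c" and "?P dvd c"
    then have "?P dvd poly (pderiv f) e" using dvd_add[of ?P _ c] by fastforce
    moreover obtain s t where "s * f + t * pderiv f = 1" using f_bezout by blast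
    then have "poly s e * poly f e + poly t e * poly (pderiv f) e = 1"
      by (metis poly_add poly_mult poly_1)
    ultimately have "?P dvd 1" using * by (metis dvd_add dvd_mult)
    then show False using prime_elem_p by (simp add: prime_elem_def)
  qed
  have root2: "poly f e2 = poly g e2 * (e2 - e1) + poly f e1"
    by (subst fg) (simp add: algebra_simps)
  have root3: "poly f e3 = poly g e2 * (e3 - e1) + poly f e1"
    by (subst fg) (simp add: algebra_simps)
  have d1: "poly (pderiv f) e1 - (e1 - e2) * (e1 - e3) = poly g e2"
    and d2: "poly (pderiv f) e2 - (e2 - e1) * (e2 - e3) = poly g e2"
    and d3: "poly (pderiv f) e3 - (e3 - e1) * (e3 - e2) = poly g e2"
    by (simp_all add: f_def g_def e3_def pderiv_pCons algebra_simps power2_eq_square)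
  show thesis
  proof (rule that[OF 1])
    show "(e1 - e2) * (e1 - e3) dvd 1"
      by (rule f_root[of e1]) (use e1 e2 d1 in simp)
    show "(e2 - e1) * (e2 - e3) dvd 1"
      by (rule f_root[of e2]) (use e1 e2 d2 root2 in simp)
    show "(e3 - e1) * (e3 - e2) dvd 1"
      by (rule f_root[of e3]) (use e1 e2 d3 root3 in simp)
  qed
qed

lemma divide_root_mod_p:
  fixes g :: "'r poly"
  assumes "of_nat p dvd poly g e"
  obtains k where "of_nat p dvd g - [:- e, 1:] * k"
proof -
  have "poly (g - [:poly g e:]) e = 0" by simp
  then obtain k where k: "g - [:poly g e:] = [:- e, 1:] * k"
    unfolding poly_eq_0_iff_dvd by blast
  then have "g - [:- e, 1:] * k = [:poly g e:]" by (simp add: algebra_simps)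
  then have "of_nat p dvd g - [:- e, 1:] * k" using assms by (simp add: of_nat_poly)
  then show thesis by (rule that)
qed

lemma poly_dvd_of_nat:
  assumes "of_nat n dvd (g :: 'r poly)" shows "of_nat n dvd poly g e"
  using assms by (auto simp: dvd_def)

text \<open>The roots of \<open>f\<close> are distinct modulo \<open>p\<close>, so divisibility by
  \<open>f\<close> modulo \<open>p\<close> is vanishing at the three roots. Hence only three values
  of \<open>w\<close> have to be prescribed.\<close>

lemma pth_root_mod_f:
  obtains w k where "of_nat p dvd Z + w ^ p - f * k"
proof -
  let ?P = "of_nat p :: 'r"
  obtain e1 e2 e3 where e: "of_nat p dvd f - [:- e1, 1:] * [:- e2, 1:] * [:- e3, 1:]"
    and u: "(e1 - e2) * (e1 - e3) dvd 1" "(e2 - e1) * (e2 - e3) dvd 1" "(e3 - e1) * (e3 - e2) dvd 1"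
    by (rule ex_roots_mod_p)
  \<comment> \<open>A root modulo \<open>p\<close> of the monic polynomial
    \<open>x^p + c\<close>.\<close>
  have "\<exists>r. ?P dvd c + r ^ p" for c
  proof -
    have d: "Polynomial.degree ([:c:] + Polynomial.monom 1 p) = p"
      using p_ge_5 by (subst degree_add_eq_right) (auto simp: degree_monom_eq)
    have "lead_coeff ([:c:] + Polynomial.monom 1 p) = 1"
      unfolding d using p_ge_5 by (simp add: coeff_pCons split: nat.split)
    then show ?thesis using ex_root[of "[:c:] + Polynomial.monom 1 p"] p_ge_5 d
      by (auto simp: poly_monom)
  qed
  then obtain r where r: "\<And>c. ?P dvd c + r c ^ p" by metis
  obtain k1 k2 k3 where k: "(e1 - e2) * (e1 - e3) * k1 = 1" "(e2 - e1) * (e2 - e3) * k2 = 1"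
    "(e3 - e1) * (e3 - e2) * k3 = 1"
    using u unfolding dvd_def by metis
  \<comment> \<open>Lagrange interpolation of p-th roots modulo \<open>p\<close> of
    \<open>-Z(e1)\<close>, \<open>-Z(e2)\<close>, \<open>-Z(e3)\<close>; \<open>k1\<close>,
    \<open>k2\<close>, \<open>k3\<close> invert the denominators.\<close>
  define w where "w = smult (k1 * r (poly Z e1)) ([:- e2, 1:] * [:- e3, 1:])
    + smult (k2 * r (poly Z e2)) ([:- e1, 1:] * [:- e3, 1:])
    + smult (k3 * r (poly Z e3)) ([:- e1, 1:] * [:- e2, 1:])"
  have "poly w e1 = r (poly Z e1) * ((e1 - e2) * (e1 - e3) * k1)"
    by (simp add: w_def algebra_simps)
  moreover have "poly w e2 = r (poly Z e2) * ((e2 - e1) * (e2 - e3) * k2)"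
    by (simp add: w_def algebra_simps)
  moreover have "poly w e3 = r (poly Z e3) * ((e3 - e1) * (e3 - e2) * k3)"
    by (simp add: w_def algebra_simps)
  ultimately have w: "poly w e1 = r (poly Z e1)" "poly w e2 = r (poly Z e2)" "poly w e3 = r (poly Z e3)"
    by (simp_all add: k)
  define h where "h = Z + w ^ p"
  have h: "?P dvd poly h e1" "?P dvd poly h e2" "?P dvd poly h e3"
    using r by (simp_all add: h_def w)
  \<comment> \<open>Distinctness of the roots passes the vanishing of \<open>h\<close> at
    \<open>e2\<close> and \<open>e3\<close> on to its successive quotients.\<close>
  have nd: "\<not> ?P dvd e2 - e1" "\<not> ?P dvd (e3 - e1) * (e3 - e2)"
    using u prime_elem_p by (metis dvd_trans dvd_mult2 prime_elem_def)+
  obtain h1 where h1: "of_nat p dvd h - [:- e1, 1:] * h1" using divide_root_mod_p[OF h(1)] .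
  have "?P dvd poly h e2 - (e2 - e1) * poly h1 e2"
    using poly_dvd_of_nat[OF h1, of e2] by (simp add: algebra_simps)
  then have "?P dvd (e2 - e1) * poly h1 e2" using h(2) by (metis dvd_diff_right_iff)
  then have "?P dvd poly h1 e2" using nd prime_elem_p by (metis prime_elem_dvd_mult_iff)
  then obtain h2 where h2: "of_nat p dvd h1 - [:- e2, 1:] * h2" using divide_root_mod_p by blast
  have "h - [:- e1, 1:] * [:- e2, 1:] * h2 = (h - [:- e1, 1:] * h1) + [:- e1, 1:] * (h1 - [:- e2, 1:] * h2)"
    by (simp only: algebra_simps)
  then have h12: "of_nat p dvd h - [:- e1, 1:] * [:- e2, 1:] * h2"
    using h1 h2 by (metis dvd_add dvd_mult)
  have "?P dvd poly h e3 - (e3 - e1) * (e3 - e2) * poly h2 e3"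
    using poly_dvd_of_nat[OF h12, of e3] by (simp add: algebra_simps)
  then have "?P dvd (e3 - e1) * (e3 - e2) * poly h2 e3" using h(3) by (metis dvd_diff_right_iff)
  then have "?P dvd poly h2 e3" using nd prime_elem_p by (metis prime_elem_dvd_mult_iff)
  then obtain h3 where h3: "of_nat p dvd h2 - [:- e3, 1:] * h3" using divide_root_mod_p by blast
  have "h - f * h3 = (h - [:- e1, 1:] * [:- e2, 1:] * h2)
      + [:- e1, 1:] * [:- e2, 1:] * (h2 - [:- e3, 1:] * h3)
      - (f - [:- e1, 1:] * [:- e2, 1:] * [:- e3, 1:]) * h3"
    by (simp only: algebra_simps)
  then have "of_nat p dvd h - f * h3"
    using h12 h3 e by (metis dvd_add dvd_mult dvd_mult2 dvd_diff)
  then show thesis unfolding h_def by (rule that)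
qed

text \<open>Differentiating \<open>h = f\<^sup>j k\<close> with \<open>0 < j < p\<close> shows that \<open>f\<close> divides \<open>j f' k\<close>, hence \<open>k\<close>.\<close>

lemma f_power_dvd_mod_p:
  assumes "of_nat p dvd h - f * k0" and "of_nat p dvd pderiv h - f ^ m * k1"
  shows "j \<le> m \<Longrightarrow> \<exists>k. of_nat p dvd h - f ^ Suc j * k"
proof (induction j)
  case 0
  then show ?case using assms(1) by auto
next
  case (Suc j)
  let ?P = "of_nat p :: 'r poly"
  let ?J = "Suc j"
  from Suc obtain k where "?P dvd h - f ^ ?J * k" by auto
  then obtain r where "h - f ^ ?J * k = ?P * r" by blast
  then have h: "h = f ^ ?J * k + ?P * r" by (simp add: algebra_simps)
  obtain r1 where "pderiv h - f ^ m * k1 = ?P * r1" using assms(2) by blast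
  then have h': "pderiv h = f ^ m * k1 + ?P * r1" by (simp add: algebra_simps)
  \<comment> \<open>\<open>Suc j \<le> m\<close> allows \<open>f^j\<close> to be cancelled and still
    leaves a factor \<open>f\<close> on the term with \<open>k1\<close>.\<close>
  have fm: "f ^ m = f ^ j * f ^ (m - j)" using Suc.prems by (simp flip: power_add)
  have "pderiv h = f ^ j * (of_nat ?J * pderiv f * k + f * pderiv k) + ?P * pderiv r"
    unfolding h pderiv_add pderiv_mult pderiv_power_Suc pderiv_of_nat
    by (simp add: of_nat_poly algebra_simps del: of_nat_Suc)
  then have "f ^ j * (of_nat ?J * pderiv f * k + f * pderiv k - f ^ (m - j) * k1) = ?P * (r1 - pderiv r)"
    unfolding h' fm by (simp add: algebra_simps)
  then have "?P dvd of_nat ?J * pderiv f * k + f * pderiv k - f ^ (m - j) * k1"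
    using cancel_mod_p[OF lead_coeff_f_power] by (metis dvd_triv_left)
  then obtain r2 where r2: "of_nat ?J * pderiv f * k + f * pderiv k - f ^ (m - j) * k1 = ?P * r2"
    by blast
  have mj: "f ^ (m - j) = f * f ^ (m - ?J)"
    using Suc.prems by (metis Suc_diff_le diff_Suc_Suc power_Suc)
  have "\<not> p dvd ?J" using Suc.prems p_eq_m by (auto dest!: dvd_imp_le)
  then obtain i0 where "of_nat ?J * i0 = (1::'r)" using of_nat_unit by (metis dvdE)
  then have "of_nat ?J * [:i0:] = 1" by (simp add: of_nat_poly one_pCons mult.commute del: of_nat_Suc)
  then obtain i :: "'r poly" where i: "of_nat ?J * i = 1" by blast
  obtain s t where st: "s * f + t * pderiv f = 1" using f_bezout by blast
  have Nk: "of_nat ?J * pderiv f * k = ?P * r2 - f * pderiv k + f * f ^ (m - ?J) * k1"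
    using r2 unfolding mj by (simp add: algebra_simps del: of_nat_Suc)
  \<comment> \<open>The Bezout identity times \<open>k\<close>. The inserted factor
    \<open>1 = (j + 1) i\<close> produces \<open>(j + 1) f' k\<close>, which by \<open>Nk\<close> is
    a multiple of \<open>f\<close> modulo \<open>p\<close>.\<close>
  have "k = (s * f + t * (of_nat ?J * i) * pderiv f) * k" unfolding i using st by simp
  also have "\<dots> = f * (s * k) + t * i * (of_nat ?J * pderiv f * k)"
    by (simp add: algebra_simps del: of_nat_Suc)
  also have "\<dots> = f * (s * k + t * i * (f ^ (m - ?J) * k1 - pderiv k)) + ?P * (t * i * r2)"
    unfolding Nk by (simp add: algebra_simps)
  finally have "k = f * (s * k + t * i * (f ^ (m - ?J) * k1 - pderiv k)) + ?P * (t * i * r2)" .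
  then obtain c d where "k = f * c + ?P * d" by blast
  then have "h - f ^ Suc ?J * c = ?P * (f ^ ?J * d + r)"
    using h by (simp add: algebra_simps)
  then show ?case by (metis dvd_triv_left)
qed

text \<open>Integration is obstructed only at exponents \<open>i\<close> with \<open>p\<close>
  dividing \<open>i + 1\<close>. Up to the degree \<open>3 m < 2 p - 1\<close> of \<open>f^m\<close>
  this is \<open>i = p - 1\<close> alone, where subtracting the Hasse invariant clears the
  coefficient.\<close>

lemma hasse_antiderivative:
  obtains G where "pderiv G = f ^ m - smult (hasse p a b) (Polynomial.monom 1 (p - 1))"
proof -
  let ?h = "f ^ m - smult (hasse p a b) (Polynomial.monom 1 (p - 1))"
  have "\<exists>G. pderiv G = ?h"
  proof (rule ex_antiderivative, rule of_nat_unit, rule notI)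
    fix i assume nz: "Polynomial.coeff ?h i \<noteq> 0" and "p dvd Suc i"
    then obtain c where c: "Suc i = p * c" by blast
    have "i \<noteq> p - 1" using nz by (auto simp: hasse_def f_def m_def)
    then have "Polynomial.coeff (f ^ m) i \<noteq> 0" using nz by auto
    then have "i \<le> Polynomial.degree (f ^ m)" by (rule le_degree)
    also have "\<dots> \<le> 3 * m" by (rule order_trans[OF degree_power_le]) (simp add: f_def)
    finally have "p * c < p * 2" using c p_eq_m p_ge_5 by linarith
    then have "c < 2" by simp
    then have "c = 1" using c by (cases c) auto
    then show False using c \<open>i \<noteq> p - 1\<close> by simp
  qed
  then show thesis using that by blast
qed

abbreviation A :: "'r poly" where "A \<equiv> [:\<phi> a:]"
abbreviation B :: "'r poly" where "B \<equiv> [:\<phi> b:]"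
abbreviation D :: "'r poly" where "D \<equiv> [:\<phi> \<delta>:]"
abbreviation xp :: "'r poly" where "xp \<equiv> Polynomial.monom 1 p"

text \<open>Obtained by applying \<open>\<phi>\<close> to \<open>disc_unit\<close>. It yields the
  Bezout identity \<open>bezout\<close> for \<open>f^\<phi>\<close> and its derivative at every
  polynomial argument.\<close>

lemma phi_disc_unit: "discriminant A B * D = 1"
proof -
  have "discriminant (\<phi> a) (\<phi> b) * \<phi> \<delta> = \<phi> (discriminant a b * \<delta>)"
    by (simp add: discriminant_def \<phi>_add \<phi>_mult \<phi>_power \<phi>_numeral)
  then have "discriminant (\<phi> a) (\<phi> b) * \<phi> \<delta> = 1" using disc_unit \<phi>_1 by simp
  then show ?thesis by (simp add: discriminant_def numeral_poly poly_const_pow one_pCons mult.commute)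
qed

lemmas bezout = cubic_bezout[OF phi_disc_unit]

lemma phi_f_pcompose: "map_poly \<phi> f \<circ>\<^sub>p u = cubic A B u"
  by (simp add: f_def map_poly_pCons \<phi>_1 pcompose_pCons cubic_def power3_eq_cube algebra_simps)

lemma phi_df_pcompose: "map_poly \<phi> (pderiv f) \<circ>\<^sub>p u = dcubic A u"
  by (simp add: f_def pderiv_pCons map_poly_pCons \<phi>_add \<phi>_1 pcompose_pCons dcubic_def
      power2_eq_square algebra_simps numeral_poly \<phi>_numeral)

lemma pderiv_cubic: "pderiv (cubic A B u) = dcubic A u * pderiv u"
  by (simp add: cubic_def dcubic_def pderiv_add pderiv_mult pderiv_smult pderiv_pCons power2_eq_square
      power3_eq_cube algebra_simps)

section \<open>Solving \<open>f W^2 = f^\<phi>(U)\<close> modulo powers of \<open>p\<close>\<close>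

lemma ex_half_poly: "\<exists>h :: 'r poly. 2 * h = 1"
  using half by (intro exI[of _ "[:half:]"]) (simp add: numeral_poly one_pCons mult.commute)

text \<open>With \<open>f^\<phi>(x^p) = f^p + p g\<close> the constraint modulo \<open>p^2\<close>
  reads \<open>2 f^(m+1) q = f^\<phi>'(x^p) u + g\<close> modulo \<open>p\<close>. Since
  \<open>T\<close> inverts \<open>f^\<phi>'(x^p)\<close> modulo \<open>p\<close> and
  \<open>f^(m+1)\<close>, a solution \<open>q\<close> exists once \<open>f^(m+1)\<close> divides
  \<open>u + T g\<close> modulo \<open>p\<close>.\<close>

lemma ex_first_order_lift:
  obtains u q where
    "of_nat p ^ 2 dvd f * (f ^ m + of_nat p * q) ^ 2 - cubic A B (xp + of_nat p * u)"
    "of_nat p dvd Polynomial.monom 1 (p - 1) + pderiv u - smult l (f ^ m)"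
proof -
  let ?P = "of_nat p :: 'r poly"
  let ?y = "Polynomial.monom 1 (p - 1) :: 'r poly"
  have fp: "f ^ p = f * (f ^ m) ^ 2"
    by (subst p_eq_m) (simp add: power_mult mult.commute)
  obtain g where "cubic A B xp - f ^ p = ?P * g"
    using frobenius_poly[of f] by (auto simp: phi_f_pcompose)
  then have g: "cubic A B xp = f ^ p + ?P * g" by (simp add: algebra_simps)
  have dxp: "pderiv xp = ?P * ?y" by (simp add: pderiv_monom of_nat_poly smult_monom)
  have p1: "p = Suc (p - 1)" using p_ge_5 by simp
  have dfp: "pderiv (f ^ p) = ?P * (f ^ (p - 1) * pderiv f)"
    by (subst p1, subst pderiv_power_Suc) (use p_ge_5 in \<open>simp add: of_nat_poly\<close>)
  \<comment> \<open>Differentiating \<open>g\<close> leaves a factor \<open>p\<close> everywhere,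
    which cancels; so \<open>g'\<close> is known exactly.\<close>
  have "?P * (f ^ (p - 1) * pderiv f + pderiv g) = ?P * (dcubic A xp * ?y)"
    using arg_cong[OF g, of pderiv] unfolding pderiv_cubic dxp
    by (simp add: pderiv_add pderiv_mult dfp algebra_simps)
  then have dg: "pderiv g = dcubic A xp * ?y - f ^ (p - 1) * pderiv f"
    using p_poly_neq_0 by (simp only: mult_cancel_left) (simp add: algebra_simps)
  obtain G where G: "pderiv G = f ^ m - smult (hasse p a b) ?y"
    by (rule hasse_antiderivative)
  define S where "S = bez0 D A B xp"
  define T where "T = bez1 D A B xp"
  have ST: "S * cubic A B xp + T * dcubic A xp = 1" unfolding S_def T_def by (rule bezout)
  \<comment> \<open>\<open>T\<close> is a polynomial in \<open>x^p\<close>.\<close>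
  have "?P dvd pderiv T"
    unfolding T_def bez1_def
    by (simp add: pderiv_add pderiv_diff pderiv_mult pderiv_smult pderiv_minus dxp power2_eq_square
        dvd_smult)
  then obtain T' where T': "pderiv T = ?P * T'" by blast
  \<comment> \<open>This is \<open>u + T g\<close> before the p-th power \<open>w^p\<close> is added
    to \<open>u\<close>.\<close>
  define Z where "Z = smult l G + T * g"
  have fp1: "f ^ (p - 1) = f ^ m * f ^ m" using p_eq_m by (metis add_diff_cancel_right' mult_2 power_add)
  have lG: "pderiv (smult l G) = smult l (f ^ m) - ?y"
    using hasse_unit by (simp add: pderiv_smult G smult_diff_right mult.commute)
  \<comment> \<open>The term \<open>-x^(p-1)\<close> from \<open>l G\<close> meets
    \<open>T f^\<phi>'(x^p) x^(p-1)\<close> from \<open>T g'\<close>. They cancel modulo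
    \<open>p\<close> and \<open>f^m\<close>, because \<open>T f^\<phi>'(x^p)\<close> is 1 modulo
    \<open>p\<close> and \<open>f^p\<close>.\<close>
  have dZ: "pderiv Z - f ^ m * ([:l:] - S * f ^ (m + 1) * ?y - T * f ^ m * pderiv f) =
      ?P * (T' * g - S * g * ?y)"
  proof -
    have "pderiv Z = [:l:] * f ^ m - ?y + ?P * T' * g + T * dcubic A xp * ?y - T * f ^ m * f ^ m * pderiv f"
      unfolding Z_def pderiv_add pderiv_mult lG T' dg fp1 by (simp add: algebra_simps)
    moreover have "T * dcubic A xp = 1 - S * (f * f ^ m * f ^ m + ?P * g)"
      using ST g fp by (simp add: algebra_simps power2_eq_square)
    ultimately show ?thesis by (simp add: algebra_simps)
  qed
  obtain w k where wk: "?P dvd Z + w ^ p - f * k" by (rule pth_root_mod_f)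
  \<comment> \<open>The derivative of a p-th power vanishes modulo \<open>p\<close>, so adding
    \<open>w^p\<close> disturbs neither \<open>dZ\<close> nor the condition on
    \<open>u'\<close>.\<close>
  have "pderiv (w ^ p) = ?P * (w ^ (p - 1) * pderiv w)"
    by (subst p1, subst pderiv_power_Suc) (use p_ge_5 in \<open>simp add: of_nat_poly\<close>)
  then have dw: "?P dvd pderiv (Z + w ^ p) - f ^ m * ([:l:] - S * f ^ (m + 1) * ?y - T * f ^ m * pderiv f)"
    using dZ unfolding pderiv_add
    by (metis (no_types) add.commute add_diff_eq dvd_add dvd_triv_left)
  obtain k where "?P dvd Z + w ^ p - f ^ Suc m * k"
    using f_power_dvd_mod_p[OF wk dw, of m] by auto
  then obtain r where "Z + w ^ p - f ^ Suc m * k = ?P * r" by blast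
  then have r: "Z + w ^ p = f * f ^ m * k + ?P * r" by (simp add: algebra_simps)
  obtain h :: "'r poly" where h: "2 * h = 1" using ex_half_poly by blast
  define u where "u = smult l G + w ^ p"
  \<comment> \<open>As \<open>u = f^(m+1) k - T g\<close> modulo \<open>p\<close>, the Bezout
    identity turns \<open>f^\<phi>'(x^p) u + g\<close> into \<open>f^(m+1)\<close> times the bracket
    modulo \<open>p\<close>; \<open>h\<close> is one half.\<close>
  define q where "q = h * (dcubic A xp * k + g * S * f ^ m)"
  have u_eq: "u = f * f ^ m * k + ?P * r - T * g" using r by (simp add: u_def Z_def algebra_simps)
  show thesis
  proof (rule that)
    have "f * (f ^ m + ?P * q) ^ 2 - cubic A B (xp + ?P * u) =
        f * (f ^ m) ^ 2 - cubic A B xp + ?P * (2 * f * f ^ m * q - dcubic A xp * u)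
        + ?P ^ 2 * (f * q ^ 2 - 3 * xp * u ^ 2 - ?P * u ^ 3)"
      by (simp add: cubic_def dcubic_def algebra_simps power2_eq_square power3_eq_cube)
    also have "f * (f ^ m) ^ 2 - cubic A B xp = - (?P * g)"
      using g fp by simp
    also have "2 * f * f ^ m * q = (2 * h) * (f * f ^ m * (dcubic A xp * k + g * S * f ^ m))"
      unfolding q_def by (simp only: ac_simps)
    also have "\<dots> = f * f ^ m * (dcubic A xp * k + g * S * f ^ m)" unfolding h by simp
    also have "f * f ^ m * (dcubic A xp * k + g * S * f ^ m) - dcubic A xp * u =
        g * (S * (f * (f ^ m) ^ 2) + T * dcubic A xp) - ?P * dcubic A xp * r"
      unfolding u_eq by (simp add: algebra_simps power2_eq_square)
    also have "S * (f * (f ^ m) ^ 2) + T * dcubic A xp = 1 - ?P * S * g"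
      using ST g fp by (simp add: algebra_simps)
    also have "- (?P * g) + ?P * (g * (1 - ?P * S * g) - ?P * dcubic A xp * r)
        + ?P ^ 2 * (f * q ^ 2 - 3 * xp * u ^ 2 - ?P * u ^ 3) =
        ?P ^ 2 * (f * q ^ 2 - 3 * xp * u ^ 2 - ?P * u ^ 3 - g * S * g - dcubic A xp * r)"
      by (simp add: algebra_simps power2_eq_square)
    finally show "?P ^ 2 dvd f * (f ^ m + ?P * q) ^ 2 - cubic A B (xp + ?P * u)" by simp
    have "?y + pderiv u - smult l (f ^ m) = ?P * (w ^ (p - 1) * pderiv w)"
      using \<open>pderiv (w ^ p) = _\<close> by (simp add: u_def pderiv_add lG)
    then show "?P dvd ?y + pderiv u - smult l (f ^ m)" by simp
  qed
qed

text \<open>A Newton step with error \<open>P * E\<close>. The linearised equation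
  \<open>2 f w x - f^\<phi>'(u) v = - E\<close> is solved modulo \<open>P\<close> by the Bezout
  identity, because \<open>f w^2\<close> may be read as \<open>f^\<phi>(u)\<close> there. The
  quadratic remainder is divisible by \<open>P * P\<close>, hence by
  \<open>P * of_nat p\<close>.\<close>

lemma lift_step:
  fixes P u w :: "'r poly"
  assumes "of_nat p dvd P" "P dvd f * w ^ 2 - cubic A B u"
  obtains v x where "P * of_nat p dvd f * (w + P * x) ^ 2 - cubic A B (u + P * v)"
proof -
  obtain E where E: "f * w ^ 2 = cubic A B u + P * E" using assms(2) by (metis dvdE diff_add_cancel add.commute)
  obtain c where c: "P = of_nat p * c" using assms(1) by blast
  define S where "S = bez0 D A B u"
  define T where "T = bez1 D A B u"
  have ST: "S * cubic A B u + T * dcubic A u = 1" unfolding S_def T_def by (rule bezout)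
  obtain h :: "'r poly" where h: "2 * h = 1" using ex_half_poly by blast
  define x where "x = - E * h * S * w"
  define v where "v = E * T"
  have "f * (w + P * x) ^ 2 - cubic A B (u + P * v) =
      f * w ^ 2 - cubic A B u + P * (2 * f * w * x - dcubic A u * v)
      + P * P * (f * x ^ 2 - 3 * u * v ^ 2 - P * v ^ 3)"
    by (simp add: cubic_def dcubic_def algebra_simps power2_eq_square power3_eq_cube)
  also have "f * w ^ 2 - cubic A B u = P * E" using E by simp
  also have "2 * f * w * x = (2 * h) * (- E * S * (f * w ^ 2))"
    unfolding x_def power2_eq_square by (simp only: mult_minus_left mult_minus_right ac_simps)
  also have "\<dots> = - E * S * (f * w ^ 2)" unfolding h by simp
  also have "- E * S * (f * w ^ 2) - dcubic A u * v = - E * (S * cubic A B u + T * dcubic A u) - P * E * E * S"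
    unfolding v_def E by (simp add: algebra_simps)
  also have "P * E + P * (- E * (S * cubic A B u + T * dcubic A u) - P * E * E * S)
      + P * P * (f * x ^ 2 - 3 * u * v ^ 2 - P * v ^ 3) =
      P * P * (f * x ^ 2 - 3 * u * v ^ 2 - P * v ^ 3 - E * E * S)"
    unfolding ST by (simp add: algebra_simps)
  also have "\<dots> = P * of_nat p * (c * (f * x ^ 2 - 3 * u * v ^ 2 - P * v ^ 3 - E * E * S))"
    by (subst (2) c) (simp add: mult.assoc)
  finally show thesis by (intro that[of x v]) simp
qed

text \<open>The constraint is solved two powers of \<open>p\<close> ahead: one is lost because \<open>u\<close> and \<open>q\<close> enter with a
  factor \<open>p\<close>, the other makes division of \<open>\<Phi>\<^sup>*\<omega>\<close> by \<open>p\<close> harmless.\<close>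

lemma ex_lift_sequence:
  obtains u q where
    "\<And>n. of_nat p ^ Suc n dvd u (Suc n) - u n" "\<And>n. of_nat p ^ Suc n dvd q (Suc n) - q n"
    "\<And>n. of_nat p ^ (n + 2) dvd f * (f ^ m + of_nat p * q n) ^ 2 - cubic A B (xp + of_nat p * u n)"
    "of_nat p dvd Polynomial.monom 1 (p - 1) + pderiv (u 0) - smult l (f ^ m)"
proof -
  let ?P = "of_nat p :: 'r poly"
  obtain u0 q0 where 0: "?P ^ 2 dvd f * (f ^ m + ?P * q0) ^ 2 - cubic A B (xp + ?P * u0)"
    "?P dvd Polynomial.monom 1 (p - 1) + pderiv u0 - smult l (f ^ m)"
    by (rule ex_first_order_lift)
  \<comment> \<open>The clause for \<open>n = 0\<close> pins the start of the sequence and so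
    preserves the derivative congruence of the first-order lift.\<close>
  let ?Q = "\<lambda>n (u, q). ?P ^ (n + 2) dvd f * (f ^ m + ?P * q) ^ 2 - cubic A B (xp + ?P * u)
    \<and> (n = 0 \<longrightarrow> (u, q) = (u0, q0))"
  have "\<exists>F. \<forall>n. ?Q n (F n) \<and> (\<lambda>(u, q) (u', q'). ?P ^ Suc n dvd u' - u \<and> ?P ^ Suc n dvd q' - q) (F n) (F (Suc n))"
  proof (rule dependent_nat_choice)
    show "\<exists>x. ?Q 0 x" using 0 by (intro exI[of _ "(u0, q0)"]) (simp del: power_Suc flip: numeral_2_eq_2)
  next
    fix x n assume "?Q n x"
    then obtain u q where x: "x = (u, q)"
      and d: "?P ^ (n + 2) dvd f * (f ^ m + ?P * q) ^ 2 - cubic A B (xp + ?P * u)"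
      by auto
    obtain v z where vz: "?P ^ (n + 2) * ?P dvd
        f * (f ^ m + ?P * q + ?P ^ (n + 2) * z) ^ 2 - cubic A B (xp + ?P * u + ?P ^ (n + 2) * v)"
      by (rule lift_step[OF _ d]) simp
    \<comment> \<open>Because \<open>u\<close> and \<open>q\<close> enter with a factor
      \<open>p\<close>, a correction by a multiple of \<open>p^(n+2)\<close> changes them only by a
      multiple of \<open>p^(n+1)\<close>.\<close>
    have "f ^ m + ?P * q + ?P ^ (n + 2) * z = f ^ m + ?P * (q + ?P ^ Suc n * z)"
      "xp + ?P * u + ?P ^ (n + 2) * v = xp + ?P * (u + ?P ^ Suc n * v)"
      by (simp_all add: algebra_simps)
    then show "\<exists>y. ?Q (Suc n) y \<and>
        (\<lambda>(u, q) (u', q'). ?P ^ Suc n dvd u' - u \<and> ?P ^ Suc n dvd q' - q) x y"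
      using vz unfolding x
      by (intro exI[of _ "(u + ?P ^ Suc n * v, q + ?P ^ Suc n * z)"]) (simp add: algebra_simps)
  qed
  then obtain F where F0: "\<forall>n. ?Q n (F n) \<and>
      (\<lambda>(u, q) (u', q'). ?P ^ Suc n dvd u' - u \<and> ?P ^ Suc n dvd q' - q) (F n) (F (Suc n))"
    by (elim exE)
  note F = F0[rule_format, THEN conjunct1] F0[rule_format, THEN conjunct2]
  show thesis
  proof (rule that[of "\<lambda>n. fst (F n)" "\<lambda>n. snd (F n)"])
    show "?P dvd Polynomial.monom 1 (p - 1) + pderiv (fst (F 0)) - smult l (f ^ m)"
      using F(1)[of 0] 0(2) by (cases "F 0") simp
  qed (use F in \<open>auto simp: split_beta simp del: power_Suc\<close>)
qed

text \<open>With \<open>\<xi> = U'/p\<close> and \<open>\<zeta> = (W f' + 2 f W')/p\<close>, the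
  pullbacks of \<open>dx\<close> and \<open>dy\<close> demand \<open>c W = \<xi>\<close> and
  \<open>c f^\<phi>'(U) = \<zeta>\<close>. A Bezout combination of the two determines
  \<open>c\<close>. The differentiated constraint, \<open>W \<zeta> = f^\<phi>'(U) \<xi>\<close> up
  to a power of \<open>p\<close>, shows that this \<open>c\<close> satisfies both
  congruences.\<close>

lemma ex_frobenius_data:
  obtains U W c :: "nat \<Rightarrow> 'r poly" where
    "\<And>n. of_nat p ^ n dvd U (Suc n) - U n" "\<And>n. of_nat p ^ n dvd W (Suc n) - W n"
    "\<And>n. of_nat p ^ n dvd c (Suc n) - c n"
    "\<And>n. of_nat p dvd U n - xp" "\<And>n. of_nat p dvd W n - f ^ m" "\<And>n. of_nat p dvd c n - [:l:]"
    "\<And>n. of_nat p ^ n dvd f * W n ^ 2 - cubic A B (U n)"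
    "\<And>n. of_nat p ^ n dvd of_nat p * c n * W n - pderiv (U n)"
    "\<And>n. of_nat p ^ n dvd of_nat p * c n * dcubic A (U n) - (W n * pderiv f + 2 * f * pderiv (W n))"
proof -
  let ?P = "of_nat p :: 'r poly"
  let ?y = "Polynomial.monom 1 (p - 1) :: 'r poly"
  obtain u q where
    u: "\<And>n. ?P ^ Suc n dvd u (Suc n) - u n" and q: "\<And>n. ?P ^ Suc n dvd q (Suc n) - q n" and
    eq: "\<And>n. ?P ^ (n + 2) dvd f * (f ^ m + ?P * q n) ^ 2 - cubic A B (xp + ?P * u n)" and
    u0: "?P dvd ?y + pderiv (u 0) - smult l (f ^ m)"
    using ex_lift_sequence by blast
  define U where "U n = xp + ?P * u n" for n
  define W where "W n = f ^ m + ?P * q n" for n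
  define S where "S n = bez0 D A B (U n)" for n
  define T where "T n = bez1 D A B (U n)" for n
  define \<xi> where "\<xi> n = ?y + pderiv (u n)" for n
  define \<zeta> where "\<zeta> n = f ^ m * pderiv f + q n * pderiv f + 2 * f * pderiv (q n)" for n
  define c where "c n = S n * f * W n * \<xi> n + T n * \<zeta> n" for n
  have ST: "S n * cubic A B (U n) + T n * dcubic A (U n) = 1" for n
    unfolding S_def T_def by (rule bezout)
  have dU: "pderiv (U n) = ?P * \<xi> n" for n
    by (simp add: U_def \<xi>_def pderiv_add pderiv_mult pderiv_monom of_nat_poly smult_monom smult_add_right pderiv_smult)
  \<comment> \<open>The part \<open>f^m\<close> of \<open>W\<close> contributes
    \<open>(2 m + 1) f^m f'\<close>, and \<open>2 m + 1 = p\<close>.\<close>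
  have dW: "W n * pderiv f + 2 * f * pderiv (W n) = ?P * \<zeta> n" for n
  proof -
    obtain m' where m': "m = Suc m'" using p_ge_5 p_eq_m by (cases m) auto
    have "2 * f * pderiv (f ^ m) = of_nat (2 * m) * f ^ m * pderiv f"
      unfolding m' pderiv_power_Suc by (simp add: of_nat_poly numeral_poly algebra_simps)
    moreover have "of_nat (2 * m) = ?P - 1" by (subst p_eq_m) simp
    ultimately have "2 * f * pderiv (f ^ m) = (?P - 1) * f ^ m * pderiv f" by (simp only:)
    then show ?thesis
      unfolding W_def \<zeta>_def pderiv_add pderiv_mult distrib_left pderiv_of_nat
      by (simp add: algebra_simps)
  qed
  obtain r where r: "\<And>n. f * W n ^ 2 = cubic A B (U n) + ?P ^ (n + 2) * r n"
  proof -
    have "\<exists>r. f * W n ^ 2 = cubic A B (U n) + ?P ^ (n + 2) * r" for n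
      using eq[of n] unfolding U_def W_def by (metis add.commute diff_add_cancel dvdE)
    then show thesis using that by metis
  qed
  have WV: "W n * (?P * \<zeta> n) = dcubic A (U n) * (?P * \<xi> n) + ?P ^ (n + 2) * pderiv (r n)" for n
  proof -
    have "pderiv (?P ^ (n + 2) * r n) = ?P ^ (n + 2) * pderiv (r n)"
      by (metis (no_types) add_0_right mult_zero_right of_nat_power pderiv_mult pderiv_of_nat)
    then have "pderiv (f * W n ^ 2) = dcubic A (U n) * (?P * \<xi> n) + ?P ^ (n + 2) * pderiv (r n)"
      unfolding r pderiv_add pderiv_cubic dU by simp
    then show ?thesis unfolding dW[symmetric]
      by (simp add: pderiv_mult power2_eq_square algebra_simps)
  qed
  \<comment> \<open>Congruence rules: \<open>c n\<close> is a polynomial expression in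
    \<open>u n\<close>, \<open>q n\<close>, their derivatives and fixed polynomials, so it converges
    with them.\<close>
  have dvd_mult_diff: "d dvd x * y - x' * y'" if "d dvd x - x'" "d dvd y - y'" for d x x' y y' :: "'r poly"
  proof -
    have "x * y - x' * y' = (x - x') * y + x' * (y - y')" by (simp add: algebra_simps)
    then show ?thesis using that by (simp add: dvd_add)
  qed
  have dvd_add_diff: "d dvd x + y - (x' + y')" if "d dvd x - x'" "d dvd y - y'" for d x x' y y' :: "'r poly"
    using dvd_add[OF that] by (simp add: algebra_simps)
  have dvd_diff_diff: "d dvd x - y - (x' - y')" if "d dvd x - x'" "d dvd y - y'" for d x x' y y' :: "'r poly"
    using dvd_diff[OF that] by (simp add: algebra_simps)
  note cong = dvd_mult_diff dvd_add_diff dvd_diff_diff dvd_diff_power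
  have stepU: "?P ^ Suc n dvd U (Suc n) - U n" for n
  proof -
    have "U (Suc n) - U n = ?P * (u (Suc n) - u n)" by (simp add: U_def algebra_simps)
    then show ?thesis using u[of n] by (simp only: dvd_mult)
  qed
  have stepW: "?P ^ Suc n dvd W (Suc n) - W n" for n
  proof -
    have "W (Suc n) - W n = ?P * (q (Suc n) - q n)" by (simp add: W_def algebra_simps)
    then show ?thesis using q[of n] by (simp only: dvd_mult)
  qed
  have dvd_pderiv: "?P ^ n dvd pderiv x - pderiv y" if "?P ^ n dvd x - y" for n x y
    using dvd_pderiv_of_nat[of "p ^ n" "x - y"] that by (simp add: pderiv_diff)
  have stepc: "?P ^ Suc n dvd c (Suc n) - c n" for n
    unfolding c_def S_def T_def bez0_def bez1_def \<xi>_def \<zeta>_def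
    by (intro cong stepU stepW u q dvd_pderiv) simp_all
  \<comment> \<open>Modulo \<open>p\<close>, \<open>\<xi> 0\<close> is \<open>l f^m\<close>;
    cancelling \<open>f^m\<close> in the differentiated constraint gives
    \<open>\<zeta> 0 = l f^\<phi>'(U 0)\<close>, and the Bezout combination returns
    \<open>l\<close>.\<close>
  have c0: "?P dvd c 0 - [:l:]"
  proof -
    \<comment> \<open>The exponent \<open>n + 2\<close> leaves a factor \<open>p\<close> in the
      error even at \<open>n = 0\<close> after one \<open>p\<close> has been cancelled.\<close>
    have "?P * (W 0 * \<zeta> 0 - dcubic A (U 0) * \<xi> 0) = ?P * (?P * pderiv (r 0))"
      using WV[of 0] by (simp add: algebra_simps power2_eq_square)
    then have WZ: "W 0 * \<zeta> 0 = dcubic A (U 0) * \<xi> 0 + ?P * pderiv (r 0)"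
      using p_poly_neq_0 by (simp only: mult_cancel_left) (simp add: algebra_simps)
    obtain e where "\<xi> 0 - [:l:] * f ^ m = ?P * e" using u0 by (auto simp: \<xi>_def)
    then have \<xi>: "\<xi> 0 = [:l:] * f ^ m + ?P * e" by (simp only: algebra_simps)
    have "f ^ m * (\<zeta> 0 - [:l:] * dcubic A (U 0)) = ?P * (dcubic A (U 0) * e + pderiv (r 0) - q 0 * \<zeta> 0)"
      using WZ unfolding W_def \<xi> by (simp only: algebra_simps)
    then have "?P dvd f ^ m * (\<zeta> 0 - [:l:] * dcubic A (U 0))" by (metis dvd_triv_left)
    then have "?P dvd \<zeta> 0 - [:l:] * dcubic A (U 0)" by (rule cancel_mod_p[OF lead_coeff_f_power])
    then obtain e' where "\<zeta> 0 - [:l:] * dcubic A (U 0) = ?P * e'" by blast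
    then have \<zeta>: "\<zeta> 0 = [:l:] * dcubic A (U 0) + ?P * e'" by (simp only: algebra_simps)
    have \<xi>': "\<xi> 0 = [:l:] * W 0 + ?P * (e - [:l:] * q 0)" unfolding \<xi> W_def by (simp only: algebra_simps)
    have "c 0 = [:l:] * (S 0 * (f * W 0 ^ 2) + T 0 * dcubic A (U 0))
        + ?P * (S 0 * f * W 0 * (e - [:l:] * q 0) + T 0 * e')"
      unfolding c_def \<xi>' \<zeta> power2_eq_square by (simp only: algebra_simps)
    also have "S 0 * (f * W 0 ^ 2) + T 0 * dcubic A (U 0) = 1 + ?P * (?P * S 0 * r 0)"
      unfolding r ST[of 0, symmetric] by (simp add: algebra_simps power2_eq_square)
    finally have "c 0 - [:l:] = ?P * ([:l:] * (?P * S 0 * r 0) + S 0 * f * W 0 * (e - [:l:] * q 0) + T 0 * e')"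
      by (simp only: algebra_simps) simp
    then show ?thesis by (metis dvd_triv_left)
  qed
  show thesis
  proof (rule that[of U W c])
    fix n
    show "?P ^ n dvd U (Suc n) - U n" "?P ^ n dvd W (Suc n) - W n" "?P ^ n dvd c (Suc n) - c n"
      using stepU[of n] stepW[of n] stepc[of n] by (metis dvd_mult_right power_Suc)+
    show "?P dvd U n - xp" "?P dvd W n - f ^ m" by (simp_all add: U_def W_def)
    show "?P dvd c n - [:l:]"
    proof (induction n)
      case (Suc n)
      have "?P dvd c (Suc n) - c n" using stepc[of n] by (metis dvd_mult_left power_Suc)
      then have "?P dvd (c (Suc n) - c n) + (c n - [:l:])" using Suc by (rule dvd_add)
      then show ?case by (simp only: add_diff_eq diff_add_cancel)
    qed (rule c0)
    have dn: "?P ^ n dvd ?P ^ (n + 2) * z" for z by (simp add: power_add mult.assoc)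
    show "?P ^ n dvd f * W n ^ 2 - cubic A B (U n)" unfolding r using dn by simp
    have "?P * c n * W n - pderiv (U n) =
        S n * (f * W n ^ 2) * pderiv (U n) + T n * (W n * (?P * \<zeta> n)) - pderiv (U n)"
      unfolding dU c_def by (simp add: algebra_simps power2_eq_square)
    also have "\<dots> = (S n * cubic A B (U n) + T n * dcubic A (U n)) * pderiv (U n) - pderiv (U n)
        + ?P ^ (n + 2) * (S n * r n * pderiv (U n) + T n * pderiv (r n))"
      unfolding WV r dU by (simp only: algebra_simps)
    finally show "?P ^ n dvd ?P * c n * W n - pderiv (U n)" unfolding ST using dn by simp
    have "?P * c n * dcubic A (U n) - ?P * \<zeta> n =
        S n * f * W n * (dcubic A (U n) * (?P * \<xi> n)) + T n * dcubic A (U n) * (?P * \<zeta> n) - ?P * \<zeta> n"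
      unfolding c_def by (simp only: algebra_simps)
    also have "dcubic A (U n) * (?P * \<xi> n) = W n * (?P * \<zeta> n) - ?P ^ (n + 2) * pderiv (r n)"
      unfolding WV by simp
    also have "S n * f * W n * (W n * (?P * \<zeta> n) - ?P ^ (n + 2) * pderiv (r n))
        + T n * dcubic A (U n) * (?P * \<zeta> n) - ?P * \<zeta> n =
        (S n * (f * W n ^ 2) + T n * dcubic A (U n)) * (?P * \<zeta> n) - ?P * \<zeta> n
        - ?P ^ (n + 2) * (S n * f * W n * pderiv (r n))"
      unfolding power2_eq_square by (simp only: algebra_simps)
    also have "S n * (f * W n ^ 2) + T n * dcubic A (U n) = 1 + ?P ^ (n + 2) * (S n * r n)"
      unfolding r ST[of n, symmetric] by (simp only: algebra_simps)
    also have "(1 + ?P ^ (n + 2) * (S n * r n)) * (?P * \<zeta> n) - ?P * \<zeta> n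
        - ?P ^ (n + 2) * (S n * f * W n * pderiv (r n)) =
        ?P ^ (n + 2) * (S n * r n * (?P * \<zeta> n) - S n * f * W n * pderiv (r n))"
      by (simp add: algebra_simps)
    finally show "?P ^ n dvd ?P * c n * dcubic A (U n) - (W n * pderiv f + 2 * f * pderiv (W n))"
      unfolding dW using dn by simp
  qed
qed

end

section \<open>Differentials that are free of rank one\<close>

lemma induced_eqI:
  assumes "C \<noteq> {}" "\<And>u. u \<in> C \<Longrightarrow> g u = v"
  shows "induced g C = v"
proof -
  have "g ` C = {v}" using assms by auto
  then show ?thesis by (simp add: induced_def)
qed

section \<open>The free module on the elements of a ring and its linear forms\<close>

context cring
begin

lemma free_module_closed: "h \<in> carrier (free_module R) \<Longrightarrow> h b \<in> carrier R"
  by (cases "b \<in> carrier R") (auto simp: free_module_def)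

lemma free_module_support:
  "h \<in> carrier (free_module R) \<Longrightarrow> finite {b. h b \<noteq> \<zero>} \<and> {b. h b \<noteq> \<zero>} \<subseteq> carrier R"
  by (auto simp: free_module_def)

lemma free_moduleI:
  assumes "\<And>b. b \<in> carrier R \<Longrightarrow> h b \<in> carrier R" "finite S" "{b. h b \<noteq> \<zero>} \<subseteq> S" "S \<subseteq> carrier R"
  shows "h \<in> carrier (free_module R)"
  using assms finite_subset by (fastforce simp: free_module_def)

lemma free_module_add: "h \<oplus>\<^bsub>free_module R\<^esub> k = (\<lambda>b. h b \<oplus> k b)"
  and free_module_smult: "c \<odot>\<^bsub>free_module R\<^esub> h = (\<lambda>b. c \<otimes> h b)"
  and free_module_zero: "\<zero>\<^bsub>free_module R\<^esub> = (\<lambda>b. \<zero>)"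
  by (simp_all add: free_module_def)

lemmas free_module_simps = free_module_add free_module_smult free_module_zero

lemma free_module_add_closed:
  assumes "h \<in> carrier (free_module R)" "k \<in> carrier (free_module R)"
  shows "h \<oplus>\<^bsub>free_module R\<^esub> k \<in> carrier (free_module R)"
  using assms free_module_support[OF assms(1)] free_module_support[OF assms(2)]
  by (intro free_moduleI[where S="{b. h b \<noteq> \<zero>} \<union> {b. k b \<noteq> \<zero>}"])
    (auto simp: free_module_simps free_module_closed)

lemma free_module_smult_closed:
  assumes "c \<in> carrier R" "h \<in> carrier (free_module R)"
  shows "c \<odot>\<^bsub>free_module R\<^esub> h \<in> carrier (free_module R)"
  using assms free_module_support[OF assms(2)]
  by (intro free_moduleI[where S="{b. h b \<noteq> \<zero>}"]) (auto simp: free_module_simps free_module_closed)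

lemma free_basis_closed: "b \<in> carrier R \<Longrightarrow> free_basis R b \<in> carrier (free_module R)"
  by (intro free_moduleI[where S="{b}"]) (auto simp: free_basis_def)

lemma free_module_module: "module R (free_module R)"
proof (rule moduleI)
  show "cring R" by (rule is_cring)
  show "abelian_group (free_module R)"
  proof (rule abelian_groupI)
    fix h assume h: "h \<in> carrier (free_module R)"
    have "(\<lambda>b. \<ominus> h b) \<in> carrier (free_module R)"
      using h free_module_support[OF h]
      by (intro free_moduleI[where S="{b. h b \<noteq> \<zero>}"]) (auto simp: free_module_closed)
    moreover have "(\<lambda>b. \<ominus> h b) \<oplus>\<^bsub>free_module R\<^esub> h = \<zero>\<^bsub>free_module R\<^esub>"
      using h by (auto simp: free_module_simps free_module_closed l_neg)
    ultimately show "\<exists>k\<in>carrier (free_module R). k \<oplus>\<^bsub>free_module R\<^esub> h = \<zero>\<^bsub>free_module R\<^esub>"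
      by blast
  next
    show "\<zero>\<^bsub>free_module R\<^esub> \<in> carrier (free_module R)"
      by (auto simp: free_module_def)
  qed (rule free_module_add_closed; assumption | simp add: free_module_add free_module_zero free_module_closed a_ac)+
qed (rule free_module_smult_closed; assumption |
    simp add: free_module_add free_module_smult free_module_closed l_distr r_distr m_assoc)+

text \<open>The linear form with value \<open>\<delta> b\<close> on the basis element of
  \<open>b\<close>. For a derivation \<open>\<delta>\<close> it factors through the differentials
  and serves as a coordinate.\<close>

definition lin_ext :: "('a \<Rightarrow> 'a) \<Rightarrow> ('a \<Rightarrow> 'a) \<Rightarrow> 'a" where
  "lin_ext \<delta> h = (\<Oplus>b\<in>{b. h b \<noteq> \<zero>}. h b \<otimes> \<delta> b)"

context
  fixes \<delta> :: "'a \<Rightarrow> 'a"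
  assumes \<delta>: "\<And>b. b \<in> carrier R \<Longrightarrow> \<delta> b \<in> carrier R"
begin

text \<open>Supports vary with the argument; linearity is proved by summing over a common finite
  index set.\<close>

lemma lin_ext_superset:
  assumes "h \<in> carrier (free_module R)" "finite S" "{b. h b \<noteq> \<zero>} \<subseteq> S" "S \<subseteq> carrier R"
  shows "lin_ext \<delta> h = (\<Oplus>b\<in>S. h b \<otimes> \<delta> b)"
  unfolding lin_ext_def
  by (rule add.finprod_mono_neutral_cong_left) (use assms \<delta> in \<open>auto simp: free_module_closed\<close>)

lemma lin_ext_closed: "h \<in> carrier (free_module R) \<Longrightarrow> lin_ext \<delta> h \<in> carrier R"
  unfolding lin_ext_def using free_module_support[of h]
  by (intro finsum_closed Pi_I m_closed \<delta> free_module_closed[of h]) auto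

lemma lin_ext_add:
  assumes "h \<in> carrier (free_module R)" "k \<in> carrier (free_module R)"
  shows "lin_ext \<delta> (h \<oplus>\<^bsub>free_module R\<^esub> k) = lin_ext \<delta> h \<oplus> lin_ext \<delta> k"
proof -
  define S where "S = {b. h b \<noteq> \<zero>} \<union> {b. k b \<noteq> \<zero>}"
  have S: "finite S" "S \<subseteq> carrier R" "{b. h b \<noteq> \<zero>} \<subseteq> S" "{b. k b \<noteq> \<zero>} \<subseteq> S"
    using free_module_support[OF assms(1)] free_module_support[OF assms(2)] by (auto simp: S_def)
  moreover have "{b. (h \<oplus>\<^bsub>free_module R\<^esub> k) b \<noteq> \<zero>} \<subseteq> S"
    by (auto simp: S_def free_module_simps)
  moreover have "(\<Oplus>b\<in>S. (h b \<oplus> k b) \<otimes> \<delta> b) = (\<Oplus>b\<in>S. h b \<otimes> \<delta> b \<oplus> k b \<otimes> \<delta> b)"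
    by (rule finsum_cong') (use assms S \<delta> in \<open>auto simp: free_module_closed l_distr Pi_iff subset_iff\<close>)
  moreover have "\<dots> = (\<Oplus>b\<in>S. h b \<otimes> \<delta> b) \<oplus> (\<Oplus>b\<in>S. k b \<otimes> \<delta> b)"
    by (rule finsum_addf) (use assms S \<delta> in \<open>auto simp: free_module_closed\<close>)
  ultimately show ?thesis using assms free_module_add_closed[OF assms]
    by (simp add: lin_ext_superset[where S=S] free_module_add)
qed

lemma lin_ext_smult:
  assumes "c \<in> carrier R" "h \<in> carrier (free_module R)"
  shows "lin_ext \<delta> (c \<odot>\<^bsub>free_module R\<^esub> h) = c \<otimes> lin_ext \<delta> h"
proof -
  define S where "S = {b. h b \<noteq> \<zero>}"
  have S: "finite S" "S \<subseteq> carrier R" "{b. h b \<noteq> \<zero>} \<subseteq> S"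
    using free_module_support[OF assms(2)] by (auto simp: S_def)
  moreover have "{b. (c \<odot>\<^bsub>free_module R\<^esub> h) b \<noteq> \<zero>} \<subseteq> S"
    using assms by (auto simp: S_def free_module_simps)
  moreover have "(\<Oplus>b\<in>S. c \<otimes> h b \<otimes> \<delta> b) = (\<Oplus>b\<in>S. c \<otimes> (h b \<otimes> \<delta> b))"
    by (rule finsum_cong') (use assms S \<delta> in \<open>auto simp: free_module_closed m_assoc Pi_iff subset_iff\<close>)
  moreover have "\<dots> = c \<otimes> (\<Oplus>b\<in>S. h b \<otimes> \<delta> b)"
    by (rule finsum_rdistr[symmetric]) (use assms S \<delta> in \<open>auto simp: free_module_closed\<close>)
  ultimately show ?thesis using assms free_module_smult_closed[OF assms]
    by (simp add: lin_ext_superset[where S=S] free_module_smult)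
qed

lemma lin_ext_basis:
  assumes "b \<in> carrier R"
  shows "lin_ext \<delta> (free_basis R b) = \<delta> b"
proof -
  have "lin_ext \<delta> (free_basis R b) = (\<Oplus>c\<in>{b}. free_basis R b c \<otimes> \<delta> c)"
    by (rule lin_ext_superset) (use assms free_basis_closed in \<open>auto simp: free_basis_def\<close>)
  also have "\<dots> = \<delta> b" using assms \<delta> by (auto simp: free_basis_def finsum_insert)
  finally show ?thesis .
qed

lemma lin_ext_minus:
  assumes "h \<in> carrier (free_module R)" "k \<in> carrier (free_module R)"
  shows "lin_ext \<delta> (h \<ominus>\<^bsub>free_module R\<^esub> k) = lin_ext \<delta> h \<ominus> lin_ext \<delta> k"
proof -
  interpret F: module R "free_module R" by (rule free_module_module)
  have "lin_ext \<delta> (h \<ominus>\<^bsub>free_module R\<^esub> k) \<oplus> lin_ext \<delta> k = lin_ext \<delta> h"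
    using assms by (simp flip: lin_ext_add add: F.minus_eq F.a_assoc F.l_neg)
  then show ?thesis
    using assms by (metis F.minus_closed add.inv_solve_right lin_ext_closed minus_eq)
qed

text \<open>As a submodule, this kernel contains the Kaehler submodule as soon as it contains the
  defining relations.\<close>

lemma lin_ext_kernel_submodule:
  "submodule {h \<in> carrier (free_module R). lin_ext \<delta> h = \<zero>} R (free_module R)"
proof -
  interpret F: module R "free_module R" by (rule free_module_module)
  have z: "lin_ext \<delta> \<zero>\<^bsub>free_module R\<^esub> = \<zero>" by (simp add: lin_ext_def free_module_zero)
  show ?thesis
  proof (rule F.submoduleI)
    fix h assume h: "h \<in> {h \<in> carrier (free_module R). lin_ext \<delta> h = \<zero>}"
    have "lin_ext \<delta> (\<zero>\<^bsub>free_module R\<^esub> \<ominus>\<^bsub>free_module R\<^esub> h) = \<zero>"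
      using h z by (subst lin_ext_minus) (auto simp: minus_eq)
    moreover have "\<zero>\<^bsub>free_module R\<^esub> \<ominus>\<^bsub>free_module R\<^esub> h = \<ominus>\<^bsub>free_module R\<^esub> h"
      using h by (simp add: F.minus_eq)
    ultimately show "\<ominus>\<^bsub>free_module R\<^esub> h \<in> {h \<in> carrier (free_module R). lin_ext \<delta> h = \<zero>}"
      using h by simp
  qed (auto simp: z lin_ext_add lin_ext_smult)
qed

end

end

section \<open>Kaehler differentials and a criterion for rank one\<close>

locale differentials = cring R for R (structure) +
  fixes A :: "('c, 'k) ring_scheme" and i :: "'c \<Rightarrow> 'a"
  assumes i_closed: "\<And>a. a \<in> carrier A \<Longrightarrow> i a \<in> carrier R"
begin

abbreviation "F \<equiv> free_module R"
abbreviation "N \<equiv> kaehler_submodule A R i"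
abbreviation "e \<equiv> free_basis R"

sublocale F: module R F by (rule free_module_module)

lemma relations_closed: "kaehler_relations A R i \<subseteq> carrier F"
  using i_closed by (auto simp: kaehler_relations_def Let_def free_basis_closed)

lemma relations_subset: "kaehler_relations A R i \<subseteq> N"
  by (auto simp: kaehler_submodule_def)

text \<open>The whole free module contains the relations and so takes part in the intersection; this
  bounds \<open>N\<close> by the carrier. The closure properties are inherited from each
  member.\<close>

lemma submodule_N: "submodule N R F"
proof (rule F.submoduleI)
  show "N \<subseteq> carrier F"
    using F.carrier_is_submodule relations_closed by (auto simp: kaehler_submodule_def)
  show "\<zero>\<^bsub>F\<^esub> \<in> N"
    unfolding kaehler_submodule_def using subgroup.one_closed[OF submodule.axioms(1)]
    by (fastforce simp: submodule_def)
  show "\<ominus>\<^bsub>F\<^esub> h \<in> N" if "h \<in> N" for h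
    using that F.submoduleE(3) unfolding kaehler_submodule_def by blast
  show "h \<oplus>\<^bsub>F\<^esub> k \<in> N" if "h \<in> N" "k \<in> N" for h k
    using that F.submoduleE(5) unfolding kaehler_submodule_def by blast
  show "c \<odot>\<^bsub>F\<^esub> h \<in> N" if "c \<in> carrier R" "h \<in> N" for c h
    using that F.submoduleE(4) unfolding kaehler_submodule_def by blast
qed

sublocale N: submodule N R F by (rule submodule_N)

sublocale N: abelian_subgroup N F
  by (rule abelian_subgroupI3) (auto intro: additive_subgroupI N.is_subgroup F.abelian_group_axioms)

lemma d_add_mem: "b \<in> carrier R \<Longrightarrow> c \<in> carrier R \<Longrightarrow> e (b \<oplus> c) \<ominus>\<^bsub>F\<^esub> (e b \<oplus>\<^bsub>F\<^esub> e c) \<in> N"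
  and d_mult_mem: "b \<in> carrier R \<Longrightarrow> c \<in> carrier R \<Longrightarrow>
    e (b \<otimes> c) \<ominus>\<^bsub>F\<^esub> (b \<odot>\<^bsub>F\<^esub> e c \<oplus>\<^bsub>F\<^esub> c \<odot>\<^bsub>F\<^esub> e b) \<in> N"
  and d_const_mem: "a \<in> carrier A \<Longrightarrow> e (i a) \<in> N"
  by (rule subsetD[OF relations_subset], unfold kaehler_relations_def Let_def, blast)+

lemma class_eq_iff:
  assumes "h \<in> carrier F" "k \<in> carrier F"
  shows "kaehler_class A R i h = kaehler_class A R i k \<longleftrightarrow> h \<ominus>\<^bsub>F\<^esub> k \<in> N"
  unfolding kaehler_class_def
  using N.a_rcos_self[OF assms(1)] N.a_repr_independence'[OF _ assms(2)]
    N.a_rcos_module[OF assms(2,1)] unfolding F.minus_eq by blast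

lemma class_mem:
  assumes "h \<in> carrier F" "k \<in> kaehler_class A R i h"
  shows "k \<in> carrier F" "kaehler_class A R i k = kaehler_class A R i h"
  using assms unfolding kaehler_class_def
  by (blast intro: N.a_elemrcos_carrier, blast dest: N.a_repr_independence')

end

text \<open>A criterion for freeness: if \<open>db = \<delta>(b) w\<close> in the differentials for
  all \<open>b\<close>, then \<open>w\<close> generates; if the derivation \<open>\<delta>\<close>
  also takes the value 1 on \<open>w\<close>, it reads off the coordinate, so \<open>w\<close> is a
  basis.\<close>

locale rank_one_differentials = differentials R A i for R (structure) and A i +
  fixes \<delta> :: "'a \<Rightarrow> 'a" and w :: "'a \<Rightarrow> 'a"
  assumes \<delta>_closed: "\<And>b. b \<in> carrier R \<Longrightarrow> \<delta> b \<in> carrier R"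
    and \<delta>_add: "\<And>b c. b \<in> carrier R \<Longrightarrow> c \<in> carrier R \<Longrightarrow> \<delta> (b \<oplus> c) = \<delta> b \<oplus> \<delta> c"
    and \<delta>_mult: "\<And>b c. b \<in> carrier R \<Longrightarrow> c \<in> carrier R \<Longrightarrow> \<delta> (b \<otimes> c) = b \<otimes> \<delta> c \<oplus> c \<otimes> \<delta> b"
    and \<delta>_const: "\<And>a. a \<in> carrier A \<Longrightarrow> \<delta> (i a) = \<zero>"
    and w_closed: "w \<in> carrier (free_module R)"
    and \<delta>_w: "lin_ext \<delta> w = \<one>"
    and d_eq: "\<And>b. b \<in> carrier R \<Longrightarrow>
      free_basis R b \<ominus>\<^bsub>free_module R\<^esub> \<delta> b \<odot>\<^bsub>free_module R\<^esub> w \<in> kaehler_submodule A R i"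
begin

text \<open>Additivity, the Leibniz rule and vanishing on constants say that the linear form of
  \<open>\<delta>\<close> kills the three kinds of relations.\<close>

lemma N_subset_kernel: "h \<in> N \<Longrightarrow> lin_ext \<delta> h = \<zero>"
proof -
  have "kaehler_relations A R i \<subseteq> {h \<in> carrier F. lin_ext \<delta> h = \<zero>}"
  proof
    fix h assume h: "h \<in> kaehler_relations A R i"
    have "lin_ext \<delta> h = \<zero>"
      using h i_closed
      by (auto simp: kaehler_relations_def Let_def lin_ext_minus lin_ext_add lin_ext_smult lin_ext_basis
          free_basis_closed \<delta>_closed \<delta>_add \<delta>_mult \<delta>_const minus_eq r_neg
          intro!: F.a_closed F.smult_closed)
    then show "h \<in> {h \<in> carrier F. lin_ext \<delta> h = \<zero>}" using h relations_closed by blast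
  qed
  then show "h \<in> N \<Longrightarrow> lin_ext \<delta> h = \<zero>"
    using lin_ext_kernel_submodule[of \<delta>, OF \<delta>_closed] unfolding kaehler_submodule_def by blast
qed

text \<open>Induction over the support: one basis element is split off and \<open>d_eq\<close> is
  applied to it.\<close>

lemma decompose_mem:
  assumes "h \<in> carrier F"
  shows "h \<ominus>\<^bsub>F\<^esub> lin_ext \<delta> h \<odot>\<^bsub>F\<^esub> w \<in> N"
proof -
  have "h \<in> carrier F \<Longrightarrow> {b. h b \<noteq> \<zero>} \<subseteq> S \<Longrightarrow> h \<ominus>\<^bsub>F\<^esub> lin_ext \<delta> h \<odot>\<^bsub>F\<^esub> w \<in> N"
    if "finite S" "S \<subseteq> carrier R" for S
    using that
  proof (induction S arbitrary: h rule: finite_induct)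
    case empty
    then have "h = \<zero>\<^bsub>F\<^esub>" by (auto simp: free_module_zero)
    moreover have "lin_ext \<delta> \<zero>\<^bsub>F\<^esub> = \<zero>" by (simp add: lin_ext_def free_module_zero)
    ultimately show ?case using w_closed by (simp add: F.minus_eq)
  next
    case (insert b S)
    define k where "k = h(b := \<zero>)"
    have b: "b \<in> carrier R" using insert by auto
    have k: "k \<in> carrier F" "{b. k b \<noteq> \<zero>} \<subseteq> S"
      using insert.prems insert.hyps(1)
      by (auto simp: k_def free_module_closed intro!: free_moduleI[where S=S] split: if_splits)
    define c where "c = h b"
    have c: "c \<in> carrier R" using insert.prems by (simp add: c_def free_module_closed)
    have h: "h = k \<oplus>\<^bsub>F\<^esub> c \<odot>\<^bsub>F\<^esub> e b"
      using insert.prems b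
      by (auto simp: k_def c_def free_module_simps free_basis_def free_module_closed)
    have eb: "e b \<in> carrier F" using b by (rule free_basis_closed)
    have 1: "k \<ominus>\<^bsub>F\<^esub> lin_ext \<delta> k \<odot>\<^bsub>F\<^esub> w \<in> N" using insert k by auto
    have 2: "c \<odot>\<^bsub>F\<^esub> (e b \<ominus>\<^bsub>F\<^esub> \<delta> b \<odot>\<^bsub>F\<^esub> w) \<in> N" using d_eq[OF b] c by (rule N.smult_closed[rotated])
    have lk: "lin_ext \<delta> k \<in> carrier R" using k by (simp add: lin_ext_closed \<delta>_closed)
    have "h \<ominus>\<^bsub>F\<^esub> lin_ext \<delta> h \<odot>\<^bsub>F\<^esub> w =
        (k \<ominus>\<^bsub>F\<^esub> lin_ext \<delta> k \<odot>\<^bsub>F\<^esub> w) \<oplus>\<^bsub>F\<^esub> c \<odot>\<^bsub>F\<^esub> (e b \<ominus>\<^bsub>F\<^esub> \<delta> b \<odot>\<^bsub>F\<^esub> w)"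
      unfolding h using k c b eb w_closed \<delta>_closed[OF b] lk
      by (simp add: lin_ext_add lin_ext_smult lin_ext_basis \<delta>_closed F.smult_l_distr F.smult_r_distr
          F.smult_assoc1 F.minus_eq F.minus_add F.smult_r_minus F.a_ac)
    then show ?case using 1 2 by simp
  qed
  then show ?thesis using free_module_support[OF assms] assms by blast
qed

definition cl :: "'a \<Rightarrow> ('a \<Rightarrow> 'a) set" where
  "cl c = kaehler_class A R i (c \<odot>\<^bsub>F\<^esub> w)"

lemma class_eq_cl: "h \<in> carrier F \<Longrightarrow> kaehler_class A R i h = cl (lin_ext \<delta> h)"
  unfolding cl_def using decompose_mem w_closed
  by (subst class_eq_iff) (auto simp: lin_ext_closed \<delta>_closed)

lemma class_lin_ext:
  assumes "h \<in> carrier F" "k \<in> kaehler_class A R i h"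
  shows "lin_ext \<delta> k = lin_ext \<delta> h"
proof -
  have k: "k \<in> carrier F" "k \<ominus>\<^bsub>F\<^esub> h \<in> N"
    using class_mem[OF assms] class_eq_iff assms(1) by auto
  then have "lin_ext \<delta> k \<ominus> lin_ext \<delta> h = \<zero>"
    using N_subset_kernel[OF k(2)] assms(1) by (simp add: lin_ext_minus \<delta>_closed)
  then show ?thesis using k(1) assms(1) by (simp add: lin_ext_closed \<delta>_closed)
qed

lemma lin_ext_smult_w: "c \<in> carrier R \<Longrightarrow> lin_ext \<delta> (c \<odot>\<^bsub>F\<^esub> w) = c"
  using w_closed by (simp add: lin_ext_smult \<delta>_closed \<delta>_w)

lemma class_self: "h \<in> carrier F \<Longrightarrow> h \<in> kaehler_class A R i h"
  unfolding kaehler_class_def by (rule N.a_rcos_self)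

lemma cl_eq_iff:
  assumes "c \<in> carrier R" "d \<in> carrier R"
  shows "cl c = cl d \<longleftrightarrow> c = d"
proof
  assume "cl c = cl d"
  then have "c \<odot>\<^bsub>F\<^esub> w \<in> kaehler_class A R i (d \<odot>\<^bsub>F\<^esub> w)"
    using class_self[of "c \<odot>\<^bsub>F\<^esub> w"] assms w_closed by (simp add: cl_def)
  from class_lin_ext[OF _ this] show "c = d" using assms w_closed by (simp add: lin_ext_smult_w)
qed simp

lemma mem_cl:
  assumes "c \<in> carrier R" "h \<in> cl c"
  shows "h \<in> carrier F" "lin_ext \<delta> h = c" "kaehler_class A R i h = cl c"
  using assms class_mem[of "c \<odot>\<^bsub>F\<^esub> w" h] class_lin_ext[of "c \<odot>\<^bsub>F\<^esub> w" h] w_closed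
  by (simp_all add: cl_def lin_ext_smult_w)

lemma cl_nonempty: "c \<in> carrier R \<Longrightarrow> cl c \<noteq> {}"
  using class_self[of "c \<odot>\<^bsub>F\<^esub> w"] w_closed by (auto simp: cl_def)

lemma carrier_kaehler: "carrier (kaehler A R i) = cl ` carrier R"
proof -
  have "carrier (kaehler A R i) = kaehler_class A R i ` carrier F"
    by (auto simp: kaehler_def quot_module_def A_RCOSETS_def' kaehler_class_def)
  also have "\<dots> = cl ` carrier R"
  proof (intro equalityI subsetI)
    fix C assume "C \<in> kaehler_class A R i ` carrier F"
    then show "C \<in> cl ` carrier R" using class_eq_cl by (auto simp: lin_ext_closed \<delta>_closed)
  next
    fix C assume "C \<in> cl ` carrier R"
    then show "C \<in> kaehler_class A R i ` carrier F" using w_closed by (auto simp: cl_def)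
  qed
  finally show ?thesis .
qed

lemma zero_kaehler: "\<zero>\<^bsub>kaehler A R i\<^esub> = cl \<zero>"
  using w_closed N.a_rcos_const[of "\<zero>\<^bsub>F\<^esub>"] by (simp add: kaehler_def quot_module_def cl_def kaehler_class_def)

lemma add_kaehler:
  "c \<in> carrier R \<Longrightarrow> d \<in> carrier R \<Longrightarrow> cl c \<oplus>\<^bsub>kaehler A R i\<^esub> cl d = cl (c \<oplus> d)"
  using w_closed
  by (simp add: kaehler_def quot_module_def cl_def kaehler_class_def N.a_rcos_sum F.smult_l_distr)

lemma smult_kaehler:
  assumes "c \<in> carrier R" "d \<in> carrier R"
  shows "c \<odot>\<^bsub>kaehler A R i\<^esub> cl d = cl (c \<otimes> d)"
proof -
  \<comment> \<open>Scalar multiplication on the quotient is a union over representatives, all of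
    which give the same class.\<close>
  have "kaehler_class A R i (c \<odot>\<^bsub>F\<^esub> h) = cl (c \<otimes> d)" if "h \<in> cl d" for h
    using mem_cl[OF assms(2) that] assms by (simp add: class_eq_cl lin_ext_smult \<delta>_closed)
  then have "(\<Union>h\<in>cl d. kaehler_class A R i (c \<odot>\<^bsub>F\<^esub> h)) = cl (c \<otimes> d)"
    using cl_nonempty[OF assms(2)] by auto
  then show ?thesis by (simp add: kaehler_def quot_module_def kaehler_class_def)
qed

lemma kaehler_d_eq: "b \<in> carrier R \<Longrightarrow> kaehler_d A R i b = cl (\<delta> b)"
  by (simp add: kaehler_d_def class_eq_cl free_basis_closed lin_ext_basis \<delta>_closed)

end

text \<open>In coordinates the induced map is \<open>g\<close> followed by multiplication by
  \<open>\<kappa>\<close>: the image of \<open>h\<close> has coordinate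
  \<open>\<Sum> g(h b) \<delta>'(g b)\<close>, and \<open>\<delta>\<kappa>\<close> pulls out
  \<open>\<kappa>\<close>.\<close>

lemma kaehler_map_rank_one:
  fixes R (structure) and R' (structure)
  assumes "rank_one_differentials R A i \<delta> w" "rank_one_differentials R' A' i' \<delta>' w'"
    and g: "g \<in> ring_hom R R'" and \<kappa>: "\<kappa> \<in> carrier R'" and c: "c \<in> carrier R"
    and \<delta>\<kappa>: "\<And>b. b \<in> carrier R \<Longrightarrow> \<delta>' (g b) = \<kappa> \<otimes>\<^bsub>R'\<^esub> g (\<delta> b)"
  shows "kaehler_map R A' R' i' g (rank_one_differentials.cl R A i w c) =
    rank_one_differentials.cl R' A' i' w' (\<kappa> \<otimes>\<^bsub>R'\<^esub> g c)"
proof -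
  interpret S: rank_one_differentials R A i \<delta> w by fact
  interpret T: rank_one_differentials R' A' i' \<delta>' w' by fact
  interpret g: ring_hom_cring R R' g
    using g by (intro ring_hom_cring.intro ring_hom_cring_axioms.intro S.is_cring T.is_cring)
  show ?thesis unfolding kaehler_map_def
  proof (rule induced_eqI)
    show "S.cl c \<noteq> {}" using c by (rule S.cl_nonempty)
  next
    fix h assume "h \<in> S.cl c"
    then have h: "h \<in> carrier S.F" "S.lin_ext \<delta> h = c" using S.mem_cl c by auto
    define B where "B = {b. h b \<noteq> \<zero>}"
    have B: "finite B" "B \<subseteq> carrier R" using S.free_module_support[OF h(1)] by (auto simp: B_def)
    have hB: "h b \<in> carrier R" for b using h(1) by (rule S.free_module_closed)
    let ?k = "free_push R R' g h"
    have k: "?k x = (\<Oplus>\<^bsub>R'\<^esub>b\<in>{b \<in> B. g b = x}. g (h b))" for x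
      unfolding free_push_def B_def using S.free_module_support[OF h(1)]
      by (rule_tac arg_cong2[where f="finsum R'"]) auto
    have kx: "?k x \<in> carrier R'" for x
      unfolding k using hB by (intro T.finsum_closed) auto
    have k0: "{x. ?k x \<noteq> \<zero>\<^bsub>R'\<^esub>} \<subseteq> g ` B"
    proof (rule subsetI, rule ccontr)
      fix x assume "x \<in> {x. ?k x \<noteq> \<zero>\<^bsub>R'\<^esub>}" "x \<notin> g ` B"
      then have "{b \<in> B. g b = x} = {}" by auto
      then have "?k x = \<zero>\<^bsub>R'\<^esub>" unfolding k by (simp only: T.finsum_empty)
      then show False using \<open>x \<in> {x. ?k x \<noteq> \<zero>\<^bsub>R'\<^esub>}\<close> by simp
    qed
    have gB: "finite (g ` B)" "g ` B \<subseteq> carrier R'" using B by auto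
    have kF: "?k \<in> carrier T.F" using kx gB k0 by (intro T.free_moduleI[where S="g ` B"])
    have "T.lin_ext \<delta>' ?k = (\<Oplus>\<^bsub>R'\<^esub>x\<in>g ` B. ?k x \<otimes>\<^bsub>R'\<^esub> \<delta>' x)"
      using T.\<delta>_closed kF gB k0 by (intro T.lin_ext_superset)
    \<comment> \<open>\<open>free_push\<close> collects coefficients along the fibres of
      \<open>g\<close>; these sums are expanded and then regrouped into a sum over
      \<open>B\<close>.\<close>
    also have "\<dots> = (\<Oplus>\<^bsub>R'\<^esub>x\<in>g ` B. \<Oplus>\<^bsub>R'\<^esub>b\<in>{b \<in> B. g b = x}. g (h b) \<otimes>\<^bsub>R'\<^esub> \<delta>' (g b))"
    proof (rule T.finsum_cong')
      fix x assume x: "x \<in> g ` B"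
      have "?k x \<otimes>\<^bsub>R'\<^esub> \<delta>' x = (\<Oplus>\<^bsub>R'\<^esub>b\<in>{b \<in> B. g b = x}. g (h b) \<otimes>\<^bsub>R'\<^esub> \<delta>' x)"
        unfolding k using x B hB T.\<delta>_closed gB by (intro T.finsum_ldistr) auto
      also have "\<dots> = (\<Oplus>\<^bsub>R'\<^esub>b\<in>{b \<in> B. g b = x}. g (h b) \<otimes>\<^bsub>R'\<^esub> \<delta>' (g b))"
        using x B hB T.\<delta>_closed gB by (intro T.finsum_cong') auto
      finally show "?k x \<otimes>\<^bsub>R'\<^esub> \<delta>' x = (\<Oplus>\<^bsub>R'\<^esub>b\<in>{b \<in> B. g b = x}. g (h b) \<otimes>\<^bsub>R'\<^esub> \<delta>' (g b))" .
    next
      show "(\<lambda>x. \<Oplus>\<^bsub>R'\<^esub>b\<in>{b \<in> B. g b = x}. g (h b) \<otimes>\<^bsub>R'\<^esub> \<delta>' (g b)) \<in> g ` B \<rightarrow> carrier R'"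
        using B hB T.\<delta>_closed by (intro Pi_I T.finsum_closed T.m_closed) auto
    qed simp
    also have "\<dots> = (\<Oplus>\<^bsub>R'\<^esub>b\<in>(\<Union>x\<in>g ` B. {b \<in> B. g b = x}). g (h b) \<otimes>\<^bsub>R'\<^esub> \<delta>' (g b))"
      using B hB T.\<delta>_closed
      by (intro T.add.finprod_UN_disjoint[symmetric]) (auto simp: pairwise_def disjnt_def)
    also have "(\<Union>x\<in>g ` B. {b \<in> B. g b = x}) = B" by auto
    also have "(\<Oplus>\<^bsub>R'\<^esub>b\<in>B. g (h b) \<otimes>\<^bsub>R'\<^esub> \<delta>' (g b)) = (\<Oplus>\<^bsub>R'\<^esub>b\<in>B. \<kappa> \<otimes>\<^bsub>R'\<^esub> g (h b \<otimes> \<delta> b))"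
    proof (rule T.finsum_cong')
      fix b assume "b \<in> B"
      then have "b \<in> carrier R" "g (\<delta> b) \<in> carrier R'" "g (h b) \<in> carrier R'" "\<delta> b \<in> carrier R"
        using B hB S.\<delta>_closed by auto
      then show "g (h b) \<otimes>\<^bsub>R'\<^esub> \<delta>' (g b) = \<kappa> \<otimes>\<^bsub>R'\<^esub> g (h b \<otimes> \<delta> b)"
        using \<kappa> hB by (simp add: \<delta>\<kappa> T.m_lcomm)
    qed (use B hB S.\<delta>_closed \<kappa> in auto)
    also have "\<dots> = \<kappa> \<otimes>\<^bsub>R'\<^esub> (\<Oplus>\<^bsub>R'\<^esub>b\<in>B. g (h b \<otimes> \<delta> b))"
      using B hB S.\<delta>_closed \<kappa> by (intro T.finsum_rdistr[symmetric]) auto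
    also have "(\<Oplus>\<^bsub>R'\<^esub>b\<in>B. g (h b \<otimes> \<delta> b)) = g (\<Oplus>b\<in>B. h b \<otimes> \<delta> b)"
    proof -
      have "(\<lambda>b. h b \<otimes> \<delta> b) \<in> B \<rightarrow> carrier R" using B hB S.\<delta>_closed by auto
      from g.hom_finsum[OF this] show ?thesis by (simp only: o_def)
    qed
    also have "(\<Oplus>b\<in>B. h b \<otimes> \<delta> b) = c" using h(2) by (simp add: S.lin_ext_def B_def)
    finally show "kaehler_class A' R' i' ?k = T.cl (\<kappa> \<otimes>\<^bsub>R'\<^esub> g c)"
      using kF by (simp add: T.class_eq_cl)
  qed
qed

section \<open>The coordinate ring modulo powers of \<open>p\<close>\<close>

lemma type_ring_simps [simp]:
  "carrier ring_of_type_algebra = UNIV" "x \<otimes>\<^bsub>ring_of_type_algebra\<^esub> y = x * y"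
  "x \<oplus>\<^bsub>ring_of_type_algebra\<^esub> y = x + y" "\<one>\<^bsub>ring_of_type_algebra\<^esub> = 1" "\<zero>\<^bsub>ring_of_type_algebra\<^esub> = 0"
  by (simp_all add: ring_of_type_algebra_def)

lemma type_ring_a_inv [simp]: "\<ominus>\<^bsub>ring_of_type_algebra\<^esub> x = - (x :: 'a::comm_ring_1)"
proof -
  interpret cring "ring_of_type_algebra :: 'a ring" by (rule cring_from_type_algebra)
  show ?thesis by (rule minus_equality) simp_all
qed

lemma type_ring_minus [simp]: "x \<ominus>\<^bsub>ring_of_type_algebra\<^esub> y = x - (y :: 'a::comm_ring_1)"
  by (simp add: a_minus_def)

lemma type_ring_add_pow [simp]: "add_pow ring_of_type_algebra (n::nat) x = of_nat n * (x :: 'a::comm_ring_1)"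
  by (induction n) (simp_all add: add_pow_def nat_pow_def algebra_simps)

lemma type_ring_nat_pow [simp]: "x [^]\<^bsub>ring_of_type_algebra\<^esub> (n::nat) = (x :: 'a::comm_ring_1) ^ n"
  by (induction n) (simp_all add: nat_pow_def mult.commute)

lemma type_ring_PIdl [simp]: "PIdl\<^bsub>ring_of_type_algebra\<^esub> x = {z :: 'a::comm_ring_1. x dvd z}"
  by (auto simp: cgenideal_def dvd_def mult.commute)

lemma (in ring) coset_cases:
  assumes "ideal I R" "r \<in> carrier R" "u \<in> I +> r"
  shows "u \<in> carrier R" "I +> u = I +> r"
proof -
  interpret ideal I R by fact
  show "u \<in> carrier R" using assms by (blast intro: a_elemrcos_carrier)
  show "I +> u = I +> r" using assms by (blast dest: a_repr_independence')
qed

lemma (in ring_hom_cring) hom_add_pow: "x \<in> carrier R \<Longrightarrow> h (add_pow R (n::nat) x) = add_pow S n (h x)"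
  by (induction n) simp_all

lemma (in ring) add_pow_one_closed: "add_pow R (n::nat) \<one> \<in> carrier R"
  by (induction n) simp_all

section \<open>The quotients of \<open>R[x,y]\<close> by the curve equation and
  \<open>p^n\<close>\<close>

locale curve_tower =
  fixes p :: nat and a b :: "'r::idom"
begin

abbreviation "PP \<equiv> (ring_of_type_algebra :: 'r poly poly ring)"
abbreviation "C \<equiv> curve_ring a b"
abbreviation "Q n \<equiv> padic_quot C p n"

definition E :: "'r poly poly" where "E = [:0, 1:]\<^sup>2 - [:[:b, a, 0, 1:]:]"

text \<open>The ideal \<open>(p^n, E)\<close>, which turns out to be the kernel of
  \<open>\<pi> n\<close>. Statements about nested cosets become membership of polynomials in
  it.\<close>

definition J :: "nat \<Rightarrow> 'r poly poly set" where
  "J n = {g. \<exists>k l. g = of_nat p ^ n * k + E * l}"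

definition \<pi> :: "nat \<Rightarrow> 'r poly poly \<Rightarrow> 'r poly poly set set" where
  "\<pi> n g = padic_class C p n (curve_class a b g)"

sublocale PP: cring PP by (rule cring_from_type_algebra)

lemma curve_ideal_eq: "curve_ideal a b = {g. E dvd g}"
  by (simp add: curve_ideal_def E_def)

lemma ideal_curve_ideal: "ideal (curve_ideal a b) PP"
  unfolding curve_ideal_def by (rule PP.cgenideal_ideal) simp

sublocale C: cring C
  unfolding curve_ring_def by (rule ideal.quotient_is_cring[OF ideal_curve_ideal PP.is_cring])

lemma curve_class_eq_iff: "curve_class a b g = curve_class a b h \<longleftrightarrow> E dvd g - h"
  unfolding curve_class_def
  by (subst PP.quotient_eq_iff_same_a_r_cos[OF ideal_curve_ideal, symmetric]) (simp_all add: curve_ideal_eq)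

lemma curve_class_hom: "curve_class a b \<in> ring_hom PP C"
  using ideal.rcos_ring_hom[OF ideal_curve_ideal] by (simp add: curve_ring_def curve_class_def[abs_def])

sublocale kl: ring_hom_cring PP C "curve_class a b"
  by (intro ring_hom_cring.intro ring_hom_cring_axioms.intro curve_class_hom PP.is_cring C.is_cring)

lemma carrier_C: "carrier C = range (curve_class a b)"
  by (auto simp: curve_ring_def FactRing_def A_RCOSETS_def' curve_class_def)

lemma ideal_padic_ideal: "ideal (padic_ideal C p n) C"
  unfolding padic_ideal_def by (rule C.cgenideal_ideal) (rule C.add_pow_one_closed)

sublocale Q: cring "Q n" for n
  unfolding padic_quot_def by (rule ideal.quotient_is_cring[OF ideal_padic_ideal C.is_cring])

lemma add_pow_C: "add_pow C (n::nat) \<one>\<^bsub>C\<^esub> = curve_class a b (of_nat n)"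
  using kl.hom_add_pow[of 1 n] by (simp add: kl.hom_one[simplified])

lemma mem_padic_ideal: "curve_class a b g \<in> padic_ideal C p n \<longleftrightarrow> g \<in> J n"
proof -
  have "curve_class a b g \<in> padic_ideal C p n \<longleftrightarrow>
      (\<exists>k. curve_class a b g = curve_class a b k \<otimes>\<^bsub>C\<^esub> curve_class a b (of_nat (p ^ n)))"
    unfolding padic_ideal_def cgenideal_def add_pow_C carrier_C by auto
  also have "\<dots> \<longleftrightarrow> (\<exists>k. curve_class a b g = curve_class a b (k * of_nat p ^ n))"
    using kl.hom_mult by simp
  also have "\<dots> \<longleftrightarrow> (\<exists>k l. g - k * of_nat p ^ n = E * l)"
    unfolding curve_class_eq_iff dvd_def by blast
  also have "\<dots> \<longleftrightarrow> g \<in> J n"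
    unfolding J_def by (auto simp: algebra_simps)
  finally show ?thesis .
qed

lemma \<pi>_hom: "\<pi> n \<in> ring_hom PP (Q n)"
proof -
  have "(+>\<^bsub>C\<^esub>) (padic_ideal C p n) \<circ> curve_class a b \<in> ring_hom PP (C Quot padic_ideal C p n)"
    by (rule ring_hom_trans[OF curve_class_hom ideal.rcos_ring_hom[OF ideal_padic_ideal]])
  moreover have "(+>\<^bsub>C\<^esub>) (padic_ideal C p n) \<circ> curve_class a b = \<pi> n"
    by (simp add: \<pi>_def[abs_def] padic_class_def o_def)
  ultimately show ?thesis by (simp add: padic_quot_def)
qed

sublocale \<pi>: ring_hom_cring PP "Q n" "\<pi> n" for n
  by (intro ring_hom_cring.intro ring_hom_cring_axioms.intro \<pi>_hom PP.is_cring Q.is_cring)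

lemma \<pi>_closed [simp]: "\<pi> n g \<in> carrier (Q n)"
  using \<pi>.hom_closed by simp

lemma \<pi>_add: "\<pi> n g \<oplus>\<^bsub>Q n\<^esub> \<pi> n h = \<pi> n (g + h)"
  and \<pi>_mult: "\<pi> n g \<otimes>\<^bsub>Q n\<^esub> \<pi> n h = \<pi> n (g * h)"
  and \<pi>_uminus: "\<ominus>\<^bsub>Q n\<^esub> \<pi> n h = \<pi> n (- h)"
  and \<pi>_one: "\<one>\<^bsub>Q n\<^esub> = \<pi> n 1"
  and \<pi>_zero: "\<zero>\<^bsub>Q n\<^esub> = \<pi> n 0"
  using \<pi>.hom_add[of g h n] \<pi>.hom_mult[of g h n] \<pi>.hom_one[of n] \<pi>.hom_zero[of n]
    \<pi>.hom_a_inv[of h n]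
  by (simp_all add: a_minus_def)

lemma carrier_Q: "carrier (Q n) = range (\<pi> n)"
  by (auto simp: padic_quot_def FactRing_def A_RCOSETS_def' carrier_C \<pi>_def padic_class_def)

lemma \<pi>_eq_iff: "\<pi> n g = \<pi> n h \<longleftrightarrow> g - h \<in> J n"
proof -
  have "\<pi> n g = \<pi> n h \<longleftrightarrow> curve_class a b g \<ominus>\<^bsub>C\<^esub> curve_class a b h \<in> padic_ideal C p n"
    unfolding \<pi>_def padic_class_def
    by (rule C.quotient_eq_iff_same_a_r_cos[OF ideal_padic_ideal, symmetric])
      (use kl.hom_closed in simp_all)
  also have "curve_class a b g \<ominus>\<^bsub>C\<^esub> curve_class a b h = curve_class a b (g - h)"
    using kl.hom_add[of g "- h"] kl.hom_a_inv[of h] by (simp add: a_minus_def)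
  finally show ?thesis by (simp add: mem_padic_ideal)
qed

text \<open>\<open>\<pi> n g\<close> is a coset of cosets: its elements are classes modulo
  \<open>E\<close>, each again represented by a polynomial.\<close>

lemma mem_\<pi>:
  assumes "u \<in> \<pi> n g"
  obtains h where "u = curve_class a b h" "\<pi> n h = \<pi> n g"
proof -
  have c: "curve_class a b g \<in> carrier C" using kl.hom_closed by simp
  have "u \<in> carrier C" "padic_class C p n u = \<pi> n g"
    using C.coset_cases[OF ideal_padic_ideal c, of u n] assms by (simp_all add: \<pi>_def padic_class_def)
  then show thesis using that unfolding carrier_C \<pi>_def by blast
qed

lemma \<pi>_nonempty: "\<pi> n g \<noteq> {}"
proof -
  interpret ideal "padic_ideal C p n" C by (rule ideal_padic_ideal)
  have "curve_class a b g \<in> \<pi> n g"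
    unfolding \<pi>_def padic_class_def by (rule a_rcos_self) (use kl.hom_closed in simp)
  then show ?thesis by blast
qed

lemma induced_\<pi>:
  assumes "\<And>h. \<pi> n h = \<pi> n g \<Longrightarrow> G (curve_class a b h) = v"
  shows "induced G (\<pi> n g) = v"
  using assms \<pi>_nonempty by (intro induced_eqI) (auto elim: mem_\<pi>)

lemma J_Suc: "g \<in> J (Suc n) \<Longrightarrow> g \<in> J n"
proof -
  assume "g \<in> J (Suc n)"
  then obtain k l where "g = of_nat p ^ Suc n * k + E * l" by (auto simp: J_def)
  then have "g = of_nat p ^ n * (of_nat p * k) + E * l" by (simp add: mult.assoc mult.left_commute)
  then show "g \<in> J n" by (auto simp: J_def)
qed

lemma J_add: "g \<in> J n \<Longrightarrow> h \<in> J n \<Longrightarrow> g + h \<in> J n"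
  and J_minus: "g \<in> J n \<Longrightarrow> - g \<in> J n"
  and J_mult: "g \<in> J n \<Longrightarrow> k * g \<in> J n"
proof -
  show "g + h \<in> J n" if g: "g \<in> J n" and h: "h \<in> J n"
  proof -
    obtain r s where "g = of_nat p ^ n * r + E * s" using g by (auto simp: J_def)
    moreover obtain r' s' where "h = of_nat p ^ n * r' + E * s'" using h by (auto simp: J_def)
    ultimately have "g + h = of_nat p ^ n * (r + r') + E * (s + s')" by (simp add: algebra_simps)
    then show ?thesis by (auto simp: J_def)
  qed
  show "k * g \<in> J n" if "g \<in> J n" for k g
  proof -
    from that obtain r s where "g = of_nat p ^ n * r + E * s" by (auto simp: J_def)
    then have "k * g = of_nat p ^ n * (k * r) + E * (k * s)" by (simp add: algebra_simps)
    then show ?thesis by (auto simp: J_def)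
  qed
  from this[of g "-1"] show "g \<in> J n \<Longrightarrow> - g \<in> J n" by simp
qed

lemma J_diff: "g \<in> J n \<Longrightarrow> h \<in> J n \<Longrightarrow> g - h \<in> J n"
  using J_add[of g n "- h"] J_minus by simp

lemma J_E: "E * l \<in> J n" and J_p: "of_nat p ^ n * l \<in> J n"
  unfolding J_def by (auto intro: exI[of _ 0] exI[of _ l])

lemma induced_transition: "induced (padic_class C p n) (\<pi> (Suc n) g) = \<pi> n g"
  by (rule induced_\<pi>) (auto simp: \<pi>_eq_iff J_Suc simp flip: \<pi>_def)

section \<open>Coherent sequences of polynomials and the completion\<close>

definition coherent :: "(nat \<Rightarrow> 'r poly poly) \<Rightarrow> bool" where
  "coherent g \<longleftrightarrow> (\<forall>n. g (Suc n) - g n \<in> J n)"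

lemma coherentD: "coherent g \<Longrightarrow> \<pi> n (g (Suc n)) = \<pi> n (g n)"
  by (simp add: coherent_def \<pi>_eq_iff)

text \<open>A polynomial representative is chosen at each level; compatibility of the levels amounts
  to agreement of consecutive choices modulo \<open>J n\<close>.\<close>

lemma carrier_completion:
  "carrier (curve_hat p a b) = {s. \<exists>g. coherent g \<and> s = (\<lambda>n. \<pi> n (g n))}"
proof (intro equalityI subsetI)
  fix s assume "s \<in> carrier (curve_hat p a b)"
  then have s: "s n \<in> range (\<pi> n)" "induced (padic_class C p n) (s (Suc n)) = s n" for n
    by (simp_all add: curve_hat_def padic_completion_def flip: carrier_Q)
  then have "\<forall>n. \<exists>g. s n = \<pi> n g" by blast
  then obtain g where g: "\<And>n. s n = \<pi> n (g n)" by metis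
  then have "coherent g" using s(2) by (simp add: coherent_def induced_transition \<pi>_eq_iff)
  then show "s \<in> {s. \<exists>g. coherent g \<and> s = (\<lambda>n. \<pi> n (g n))}" using g by auto
next
  fix s assume "s \<in> {s. \<exists>g. coherent g \<and> s = (\<lambda>n. \<pi> n (g n))}"
  then show "s \<in> carrier (curve_hat p a b)"
    by (auto simp: curve_hat_def padic_completion_def induced_transition coherentD)
qed

lemma coherent_const: "coherent (\<lambda>n. g)"
  using J_E[of 0] by (simp add: coherent_def)

lemma coherent_add: "coherent g \<Longrightarrow> coherent h \<Longrightarrow> coherent (\<lambda>n. g n + h n)"
  unfolding coherent_def add_diff_add using J_add by blast

lemma coherent_minus: "coherent g \<Longrightarrow> coherent h \<Longrightarrow> coherent (\<lambda>n. g n - h n)"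
proof -
  assume "coherent g" "coherent h"
  moreover have "g (Suc n) - h (Suc n) - (g n - h n) = (g (Suc n) - g n) - (h (Suc n) - h n)" for n
    by simp
  ultimately show ?thesis unfolding coherent_def using J_diff by metis
qed

lemma coherent_mult:
  assumes "coherent g" "coherent h" shows "coherent (\<lambda>n. g n * h n)"
proof -
  have "g (Suc n) * h (Suc n) - g n * h n = h (Suc n) * (g (Suc n) - g n) + g n * (h (Suc n) - h n)" for n
    by (simp add: algebra_simps)
  then show ?thesis using assms by (auto simp: coherent_def intro!: J_add J_mult)
qed

lemma coherent_power: "coherent g \<Longrightarrow> coherent (\<lambda>n. g n ^ k)"
  by (induction k) (simp_all add: coherent_const coherent_mult)

lemma to_completion_\<pi>: "to_completion C p (curve_class a b g) = (\<lambda>n. \<pi> n g)"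
  by (simp add: to_completion_def \<pi>_def)

lemma completion_add: "s \<oplus>\<^bsub>curve_hat p a b\<^esub> t = (\<lambda>n. s n \<oplus>\<^bsub>Q n\<^esub> t n)"
  and completion_mult: "s \<otimes>\<^bsub>curve_hat p a b\<^esub> t = (\<lambda>n. s n \<otimes>\<^bsub>Q n\<^esub> t n)"
  and completion_one: "\<one>\<^bsub>curve_hat p a b\<^esub> = (\<lambda>n. \<pi> n 1)"
  and completion_zero: "\<zero>\<^bsub>curve_hat p a b\<^esub> = (\<lambda>n. \<pi> n 0)"
  by (simp_all add: curve_hat_def padic_completion_def \<pi>_one \<pi>_zero)

text \<open>Negation in a ring record is the inverse in its additive group, so the group laws are
  needed before differences can be computed levelwise.\<close>

lemma cring_completion: "cring (curve_hat p a b)"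
proof (rule cringI)
  show "abelian_group (curve_hat p a b)"
  proof (rule abelian_groupI)
    fix s assume "s \<in> carrier (curve_hat p a b)"
    then obtain g where g: "coherent g" "s = (\<lambda>n. \<pi> n (g n))" by (auto simp: carrier_completion)
    then have "(\<lambda>n. \<pi> n (0 - g n)) \<in> carrier (curve_hat p a b)"
      using coherent_minus[OF coherent_const[of 0] g(1)] by (auto simp: carrier_completion)
    moreover have "(\<lambda>n. \<pi> n (0 - g n)) \<oplus>\<^bsub>curve_hat p a b\<^esub> s = \<zero>\<^bsub>curve_hat p a b\<^esub>"
      by (simp add: g completion_add completion_zero \<pi>_add)
    ultimately show "\<exists>t\<in>carrier (curve_hat p a b). t \<oplus>\<^bsub>curve_hat p a b\<^esub> s = \<zero>\<^bsub>curve_hat p a b\<^esub>" by blast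
  next
    fix s t assume "s \<in> carrier (curve_hat p a b)" "t \<in> carrier (curve_hat p a b)"
    then obtain g h where "coherent g" "s = (\<lambda>n. \<pi> n (g n))" "coherent h" "t = (\<lambda>n. \<pi> n (h n))"
      by (auto simp: carrier_completion)
    then show "s \<oplus>\<^bsub>curve_hat p a b\<^esub> t \<in> carrier (curve_hat p a b)"
      using coherent_add[of g h] by (auto simp: carrier_completion completion_add \<pi>_add)
  next
    show "\<zero>\<^bsub>curve_hat p a b\<^esub> \<in> carrier (curve_hat p a b)"
      using coherent_const[of 0] by (auto simp: carrier_completion completion_zero)
  qed (auto simp: carrier_completion completion_add completion_zero \<pi>_add add_ac)
  show "comm_monoid (curve_hat p a b)"
  proof (rule comm_monoidI)
    fix s t assume "s \<in> carrier (curve_hat p a b)" "t \<in> carrier (curve_hat p a b)"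
    then obtain g h where "coherent g" "s = (\<lambda>n. \<pi> n (g n))" "coherent h" "t = (\<lambda>n. \<pi> n (h n))"
      by (auto simp: carrier_completion)
    then show "s \<otimes>\<^bsub>curve_hat p a b\<^esub> t \<in> carrier (curve_hat p a b)"
      using coherent_mult[of g h] by (auto simp: carrier_completion completion_mult \<pi>_mult)
  next
    show "\<one>\<^bsub>curve_hat p a b\<^esub> \<in> carrier (curve_hat p a b)"
      using coherent_const[of 1] by (auto simp: carrier_completion completion_one)
  qed (auto simp: carrier_completion completion_mult completion_one \<pi>_mult mult_ac)
qed (auto simp: carrier_completion completion_mult completion_add \<pi>_mult \<pi>_add distrib_right)

end

section \<open>Rules for differentials of sums, products and constants\<close>

context differentials
begin

text \<open>Together with the next two lemmas this reduces the relation
  \<open>db = \<beta> w\<close> to generators of the ring.\<close>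

lemma d_eq_add:
  assumes "b \<in> carrier R" "c \<in> carrier R" "\<beta> \<in> carrier R" "\<gamma> \<in> carrier R" "w \<in> carrier F"
    and "e b \<ominus>\<^bsub>F\<^esub> \<beta> \<odot>\<^bsub>F\<^esub> w \<in> N" "e c \<ominus>\<^bsub>F\<^esub> \<gamma> \<odot>\<^bsub>F\<^esub> w \<in> N"
  shows "e (b \<oplus> c) \<ominus>\<^bsub>F\<^esub> (\<beta> \<oplus> \<gamma>) \<odot>\<^bsub>F\<^esub> w \<in> N"
proof -
  have [simp]: "e b \<in> carrier F" "e c \<in> carrier F" "e (b \<oplus> c) \<in> carrier F"
    using assms by (simp_all add: free_basis_closed)
  have "(e (b \<oplus> c) \<ominus>\<^bsub>F\<^esub> (e b \<oplus>\<^bsub>F\<^esub> e c)) \<oplus>\<^bsub>F\<^esub> ((e b \<ominus>\<^bsub>F\<^esub> \<beta> \<odot>\<^bsub>F\<^esub> w) \<oplus>\<^bsub>F\<^esub> (e c \<ominus>\<^bsub>F\<^esub> \<gamma> \<odot>\<^bsub>F\<^esub> w)) =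
      (e (b \<oplus> c) \<ominus>\<^bsub>F\<^esub> (\<beta> \<oplus> \<gamma>) \<odot>\<^bsub>F\<^esub> w) \<oplus>\<^bsub>F\<^esub> ((e b \<ominus>\<^bsub>F\<^esub> e b) \<oplus>\<^bsub>F\<^esub> (e c \<ominus>\<^bsub>F\<^esub> e c))"
    using assms(1-5) by (simp add: F.minus_eq F.minus_add F.smult_l_distr F.a_ac)
  also have "\<dots> = e (b \<oplus> c) \<ominus>\<^bsub>F\<^esub> (\<beta> \<oplus> \<gamma>) \<odot>\<^bsub>F\<^esub> w"
    using assms(1-5) by (simp add: F.minus_eq F.r_neg)
  finally show ?thesis using d_add_mem[OF assms(1,2)] assms(6,7) by (metis N.a_closed)
qed

lemma d_eq_mult:
  assumes "b \<in> carrier R" "c \<in> carrier R" "\<beta> \<in> carrier R" "\<gamma> \<in> carrier R" "w \<in> carrier F"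
    and "e b \<ominus>\<^bsub>F\<^esub> \<beta> \<odot>\<^bsub>F\<^esub> w \<in> N" "e c \<ominus>\<^bsub>F\<^esub> \<gamma> \<odot>\<^bsub>F\<^esub> w \<in> N"
  shows "e (b \<otimes> c) \<ominus>\<^bsub>F\<^esub> (b \<otimes> \<gamma> \<oplus> c \<otimes> \<beta>) \<odot>\<^bsub>F\<^esub> w \<in> N"
proof -
  have [simp]: "e b \<in> carrier F" "e c \<in> carrier F" "e (b \<otimes> c) \<in> carrier F"
    using assms by (simp_all add: free_basis_closed)
  have 1: "b \<odot>\<^bsub>F\<^esub> (e c \<ominus>\<^bsub>F\<^esub> \<gamma> \<odot>\<^bsub>F\<^esub> w) = b \<odot>\<^bsub>F\<^esub> e c \<ominus>\<^bsub>F\<^esub> (b \<otimes> \<gamma>) \<odot>\<^bsub>F\<^esub> w"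
    "c \<odot>\<^bsub>F\<^esub> (e b \<ominus>\<^bsub>F\<^esub> \<beta> \<odot>\<^bsub>F\<^esub> w) = c \<odot>\<^bsub>F\<^esub> e b \<ominus>\<^bsub>F\<^esub> (c \<otimes> \<beta>) \<odot>\<^bsub>F\<^esub> w"
    using assms(1-5) by (simp_all add: F.minus_eq F.smult_r_distr F.smult_r_minus F.smult_assoc1)
  have "(e (b \<otimes> c) \<ominus>\<^bsub>F\<^esub> (b \<odot>\<^bsub>F\<^esub> e c \<oplus>\<^bsub>F\<^esub> c \<odot>\<^bsub>F\<^esub> e b)) \<oplus>\<^bsub>F\<^esub>
        (b \<odot>\<^bsub>F\<^esub> (e c \<ominus>\<^bsub>F\<^esub> \<gamma> \<odot>\<^bsub>F\<^esub> w) \<oplus>\<^bsub>F\<^esub> c \<odot>\<^bsub>F\<^esub> (e b \<ominus>\<^bsub>F\<^esub> \<beta> \<odot>\<^bsub>F\<^esub> w)) =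
      (e (b \<otimes> c) \<ominus>\<^bsub>F\<^esub> (b \<otimes> \<gamma> \<oplus> c \<otimes> \<beta>) \<odot>\<^bsub>F\<^esub> w) \<oplus>\<^bsub>F\<^esub>
        ((b \<odot>\<^bsub>F\<^esub> e c \<ominus>\<^bsub>F\<^esub> b \<odot>\<^bsub>F\<^esub> e c) \<oplus>\<^bsub>F\<^esub> (c \<odot>\<^bsub>F\<^esub> e b \<ominus>\<^bsub>F\<^esub> c \<odot>\<^bsub>F\<^esub> e b))"
    unfolding 1 using assms(1-5) by (simp add: F.minus_eq F.minus_add F.smult_l_distr F.a_ac)
  also have "\<dots> = e (b \<otimes> c) \<ominus>\<^bsub>F\<^esub> (b \<otimes> \<gamma> \<oplus> c \<otimes> \<beta>) \<odot>\<^bsub>F\<^esub> w"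
    using assms(1-5) by (simp add: F.minus_eq F.r_neg)
  finally show ?thesis using d_mult_mem[OF assms(1,2)] assms by (metis N.a_closed N.smult_closed)
qed

lemma d_eq_const:
  assumes "a \<in> carrier A" "w \<in> carrier F" shows "e (i a) \<ominus>\<^bsub>F\<^esub> \<zero> \<odot>\<^bsub>F\<^esub> w \<in> N"
  using d_const_mem[OF assms(1)] assms i_closed by (simp add: F.minus_eq free_basis_closed)

end

section \<open>The invariant derivation and the differentials of the curve\<close>

lemma map_poly_pderiv_add: "map_poly pderiv (g + h) = map_poly pderiv g + map_poly pderiv (h :: 'a::idom poly poly)"
  by (intro poly_eqI) (simp add: coeff_map_poly pderiv_add)

lemma map_poly_pderiv_smult:
  "map_poly pderiv (smult c h) = smult (pderiv c) h + smult c (map_poly pderiv (h :: 'a::idom poly poly))"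
  by (intro poly_eqI) (simp add: coeff_map_poly pderiv_mult mult.commute)

lemma map_poly_pderiv_mult:
  "map_poly pderiv (g * h) = g * map_poly pderiv h + map_poly pderiv g * (h :: 'a::idom poly poly)"
  by (induction g) (simp_all add: map_poly_pderiv_add map_poly_pderiv_smult map_poly_pCons algebra_simps)

context ordinary_curve
begin

sublocale curve_tower p a b .

lemma E_eq: "E = [:- f, 0, 1:]"
  by (simp add: E_def f_def power2_eq_square)

text \<open>On \<open>R[x][y]\<close>, \<open>map_poly pderiv\<close> is the partial derivative in
  \<open>x\<close> and \<open>pderiv\<close> the one in \<open>y\<close>. This is the derivation
  dual to \<open>dx/y\<close>.\<close>

definition der :: "'r poly poly \<Rightarrow> 'r poly poly" where
  "der g = [:0, 1:] * map_poly pderiv g + [:smult half (pderiv f):] * pderiv g"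

lemma der_add: "der (g + h) = der g + der h"
  unfolding der_def by (simp only: map_poly_pderiv_add pderiv_add distrib_left add_ac)

lemma der_mult: "der (g * h) = g * der h + h * der g"
  unfolding der_def by (simp only: map_poly_pderiv_mult pderiv_mult algebra_simps)

lemma der_const: "der [:[:r:]:] = 0"
  by (simp add: der_def map_poly_pCons)

lemma der_of_nat: "der (of_nat k) = 0"
  using der_const by (simp add: of_nat_poly)

text \<open>The two parts contribute \<open>- y f'\<close> and \<open>(f'/2) 2 y\<close>. Hence
  \<open>der\<close> descends to the curve.\<close>

lemma der_E: "der E = 0"
proof -
  have "smult half (pderiv f) * 2 = pderiv f"
    using half by (simp add: numeral_poly mult.commute)
  then show ?thesis
    by (simp add: der_def E_eq map_poly_pCons pderiv_pCons pderiv_minus mult.commute)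
qed

lemma der_0 [simp]: "der 0 = 0"
  by (simp add: der_def)

lemma der_x: "der [:h:] = [:0, pderiv h:]"
  by (simp add: der_def map_poly_pCons pderiv_pCons)

lemma der_var_x: "der [:[:0, 1:]:] = [:0, 1:]"
  by (simp add: der_x pderiv_pCons one_pCons)

lemma der_y: "der [:0, h:] = [:smult half (pderiv f) * h, 0, pderiv h:]"
  by (simp add: der_def map_poly_pCons pderiv_pCons mult.commute)

lemma der_J:
  assumes "g \<in> J n" shows "der g \<in> J n"
proof -
  obtain k l where "g = of_nat (p ^ n) * k + E * l" using assms by (auto simp: J_def)
  then have "der g = of_nat p ^ n * der k + E * der l"
    by (simp add: der_add der_mult[of "of_nat (p ^ n)", unfolded der_of_nat, simplified] der_mult[of E] der_E)
  then show ?thesis by (auto simp: J_def)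
qed

lemma der_diff: "der (g - h) = der g - der h"
  using der_add[of "g - h" h] by (simp add: algebra_simps)

lemma \<pi>_der_cong: "\<pi> n g = \<pi> n h \<Longrightarrow> \<pi> n (der g) = \<pi> n (der h)"
  using der_J[of "g - h" n] by (simp add: \<pi>_eq_iff der_diff)

text \<open>Any representative may be chosen, because \<open>der\<close> preserves
  \<open>J n\<close>.\<close>

definition dq :: "nat \<Rightarrow> 'r poly poly set set \<Rightarrow> 'r poly poly set set" where
  "dq n u = \<pi> n (der (SOME g. \<pi> n g = u))"

lemma dq_\<pi> [simp]: "dq n (\<pi> n g) = \<pi> n (der g)"
  unfolding dq_def by (rule \<pi>_der_cong) (rule someI, rule refl)

abbreviation "RQ n \<equiv> padic_quot (ring_of_type_algebra :: 'r ring) p n"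
abbreviation "str n \<equiv> padic_structure C (curve_const a b) p n"

lemma carrier_RQ: "carrier (RQ n) = range (padic_class ring_of_type_algebra p n)"
  by (auto simp: padic_quot_def FactRing_def A_RCOSETS_def' padic_class_def)

lemma ideal_padic_R: "ideal (padic_ideal (ring_of_type_algebra :: 'r ring) p n) ring_of_type_algebra"
proof -
  interpret R: cring "ring_of_type_algebra :: 'r ring" by (rule cring_from_type_algebra)
  show ?thesis unfolding padic_ideal_def by (rule R.cgenideal_ideal) simp
qed

lemma padic_class_R_eq_iff:
  "padic_class ring_of_type_algebra p n r = padic_class ring_of_type_algebra p n s \<longleftrightarrow> of_nat p ^ n dvd r - (s::'r)"
proof -
  interpret R: cring "ring_of_type_algebra :: 'r ring" by (rule cring_from_type_algebra)
  show ?thesis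
    unfolding padic_class_def
    by (subst R.quotient_eq_iff_same_a_r_cos[OF ideal_padic_R, symmetric]) (simp_all add: padic_ideal_def)
qed

lemma \<pi>_const_cong: "of_nat p ^ n dvd r - s \<Longrightarrow> \<pi> n [:[:r:]:] = \<pi> n [:[:s:]:]"
proof -
  assume "of_nat p ^ n dvd r - s"
  then obtain k where "r - s = of_nat (p ^ n) * k" by auto
  then have "[:[:r:]:] - [:[:s:]:] = of_nat (p ^ n) * [:[:k:]:]" by (simp only: of_nat_poly) simp
  then show ?thesis using J_p[of n "[:[:k:]:]"] by (simp only: \<pi>_eq_iff of_nat_power)
qed

lemma str_class: "str n (padic_class ring_of_type_algebra p n r) = \<pi> n [:[:r:]:]"
  unfolding padic_structure_def
proof (rule induced_eqI)
  interpret R: cring "ring_of_type_algebra :: 'r ring" by (rule cring_from_type_algebra)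
  interpret I: ideal "padic_ideal (ring_of_type_algebra :: 'r ring) p n" ring_of_type_algebra
    by (rule ideal_padic_R)
  show "padic_class ring_of_type_algebra p n r \<noteq> {}"
    unfolding padic_class_def using I.a_rcos_self[of r] by auto
  fix u assume "u \<in> padic_class ring_of_type_algebra p n r"
  then have "padic_class ring_of_type_algebra p n u = padic_class ring_of_type_algebra p n r"
    unfolding padic_class_def by (rule R.coset_cases(2)[OF ideal_padic_R, rotated]) simp
  then show "padic_class C p n (curve_const a b u) = \<pi> n [:[:r:]:]"
    using \<pi>_const_cong by (simp add: padic_class_R_eq_iff curve_const_def flip: \<pi>_def)
qed

sublocale diff: differentials "Q n" "RQ n" "str n" for n
  by unfold_locales (auto simp: carrier_RQ str_class)

text \<open>The form \<open>g dx + h dy\<close>, taken in the free module before the relations are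
  divided out.\<close>

definition lc :: "nat \<Rightarrow> 'r poly poly \<Rightarrow> 'r poly poly \<Rightarrow> 'r poly poly set set \<Rightarrow> 'r poly poly set set" where
  "lc n g h = \<pi> n g \<odot>\<^bsub>free_module (Q n)\<^esub> free_basis (Q n) (\<pi> n [:[:0, 1:]:])
     \<oplus>\<^bsub>free_module (Q n)\<^esub> \<pi> n h \<odot>\<^bsub>free_module (Q n)\<^esub> free_basis (Q n) (\<pi> n [:0, 1:])"

lemma lc_closed [simp]: "lc n g h \<in> carrier (free_module (Q n))"
  unfolding lc_def by (simp add: Q.free_basis_closed)

lemma lc_smult: "\<pi> n k \<odot>\<^bsub>free_module (Q n)\<^esub> lc n g h = lc n (k * g) (k * h)"
  unfolding lc_def by (simp add: Q.free_basis_closed diff.F.smult_r_distr flip: diff.F.smult_assoc1 \<pi>_mult)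

lemma lc_minus: "lc n g h \<ominus>\<^bsub>free_module (Q n)\<^esub> lc n g' h' = lc n (g - g') (h - h')"
proof -
  have "lc n (g - g') (h - h') = lc n g h \<oplus>\<^bsub>free_module (Q n)\<^esub> lc n (- g') (- h')"
  proof -
    have "\<pi> n (g - g') = \<pi> n g \<oplus>\<^bsub>Q n\<^esub> \<pi> n (- g')" "\<pi> n (h - h') = \<pi> n h \<oplus>\<^bsub>Q n\<^esub> \<pi> n (- h')"
      by (simp_all add: \<pi>_add)
    then show ?thesis
      unfolding lc_def by (simp add: Q.free_basis_closed diff.F.smult_l_distr diff.F.M.a_ac)
  qed
  also have "lc n (- g') (- h') = \<ominus>\<^bsub>free_module (Q n)\<^esub> lc n g' h'"
    unfolding lc_def
    by (simp add: Q.free_basis_closed diff.F.smult_l_minus diff.F.M.minus_add flip: \<pi>_uminus)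
  finally show ?thesis by (simp add: a_minus_def)
qed

lemma lc_cong: "\<pi> n g = \<pi> n g' \<Longrightarrow> \<pi> n h = \<pi> n h' \<Longrightarrow> lc n g h = lc n g' h'"
  by (simp add: lc_def)

lemma lc_x: "free_basis (Q n) (\<pi> n [:[:0, 1:]:]) = lc n 1 0"
  and lc_y: "free_basis (Q n) (\<pi> n [:0, 1:]) = lc n 0 1"
  unfolding lc_def by (simp_all add: Q.free_basis_closed flip: \<pi>_one \<pi>_zero)

text \<open>Horner induction: the differential of \<open>c + x h\<close> is
  \<open>x dh + h dx\<close>.\<close>

lemma d_poly_x:
  "free_basis (Q n) (\<pi> n [:h:]) \<ominus>\<^bsub>free_module (Q n)\<^esub> lc n [:pderiv h:] 0
     \<in> kaehler_submodule (RQ n) (Q n) (str n)"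
proof (induction h)
  case 0
  have "free_basis (Q n) (\<pi> n [:[:0:]:]) \<in> kaehler_submodule (RQ n) (Q n) (str n)"
    using diff.d_const_mem[of _ n] by (metis str_class carrier_RQ rangeI)
  moreover have "lc n 0 0 = \<zero>\<^bsub>free_module (Q n)\<^esub>"
    unfolding lc_def by (simp add: Q.free_basis_closed flip: \<pi>_zero)
  ultimately show ?case by (simp add: diff.F.M.minus_eq Q.free_basis_closed)
next
  case (pCons c h)
  let ?w = "free_basis (Q n) (\<pi> n [:[:0, 1:]:])"
  let ?F = "free_module (Q n)" and ?N = "kaehler_submodule (RQ n) (Q n) (str n)"
  have w: "?w \<in> carrier ?F" by (simp add: Q.free_basis_closed)
  have lc_w: "lc n g 0 = \<pi> n g \<odot>\<^bsub>?F\<^esub> ?w" for g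
    unfolding lc_def by (simp add: Q.free_basis_closed flip: \<pi>_zero)
  have 1: "free_basis (Q n) (\<pi> n [:[:c:]:]) \<ominus>\<^bsub>?F\<^esub> \<pi> n 0 \<odot>\<^bsub>?F\<^esub> ?w \<in> ?N"
    using diff.d_eq_const[OF _ w, of "padic_class ring_of_type_algebra p n c"]
    by (simp add: str_class carrier_RQ \<pi>_zero)
  have 2: "?w \<ominus>\<^bsub>?F\<^esub> \<pi> n 1 \<odot>\<^bsub>?F\<^esub> ?w \<in> ?N"
    using w diff.N.zero_closed[of n] by (simp add: diff.F.M.minus_eq diff.F.M.r_neg flip: \<pi>_one)
  have 3: "free_basis (Q n) (\<pi> n ([:[:0, 1:]:] * [:h:])) \<ominus>\<^bsub>?F\<^esub>
      \<pi> n ([:[:0, 1:]:] * [:pderiv h:] + [:h:] * 1) \<odot>\<^bsub>?F\<^esub> ?w \<in> ?N"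
    using diff.d_eq_mult[OF _ _ _ _ w 2 pCons.IH[unfolded lc_w]] by (simp add: \<pi>_mult \<pi>_add)
  have "free_basis (Q n) (\<pi> n ([:[:c:]:] + [:[:0, 1:]:] * [:h:])) \<ominus>\<^bsub>?F\<^esub>
      \<pi> n (0 + ([:[:0, 1:]:] * [:pderiv h:] + [:h:] * 1)) \<odot>\<^bsub>?F\<^esub> ?w \<in> ?N"
    using diff.d_eq_add[OF _ _ _ _ w 1 3] by (simp add: \<pi>_add)
  then show ?case by (simp add: lc_w pderiv_pCons add.commute)
qed

text \<open>\<open>y^2\<close> and \<open>f\<close> are the same element of the quotient, whose
  differential is \<open>2 y dy\<close> by the Leibniz rule and \<open>f' dx\<close> by
  \<open>d_poly_x\<close>.\<close>

lemma d_curve: "lc n [:- pderiv f:] [:0, 2:] \<in> kaehler_submodule (RQ n) (Q n) (str n)"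
proof -
  let ?w = "free_basis (Q n) (\<pi> n [:0, 1:])"
  let ?F = "free_module (Q n)" and ?N = "kaehler_submodule (RQ n) (Q n) (str n)"
  have w: "?w \<in> carrier ?F" by (simp add: Q.free_basis_closed)
  have lc_w: "lc n 0 g = \<pi> n g \<odot>\<^bsub>?F\<^esub> ?w" for g
    unfolding lc_def by (simp add: Q.free_basis_closed flip: \<pi>_zero)
  have 1: "?w \<ominus>\<^bsub>?F\<^esub> \<pi> n 1 \<odot>\<^bsub>?F\<^esub> ?w \<in> ?N"
    using w diff.N.zero_closed[of n] by (simp add: diff.F.M.minus_eq diff.F.M.r_neg flip: \<pi>_one)
  have "free_basis (Q n) (\<pi> n ([:0, 1:] * [:0, 1:])) \<ominus>\<^bsub>?F\<^esub>
      \<pi> n ([:0, 1:] * 1 + [:0, 1:] * 1) \<odot>\<^bsub>?F\<^esub> ?w \<in> ?N"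
    using diff.d_eq_mult[OF _ _ _ _ w 1 1] by (simp add: \<pi>_mult \<pi>_add)
  moreover have "\<pi> n ([:0, 1:] * [:0, 1:]) = \<pi> n [:f:]"
    using J_E[of 1 n] by (simp add: \<pi>_eq_iff E_eq)
  ultimately have 2: "free_basis (Q n) (\<pi> n [:f:]) \<ominus>\<^bsub>?F\<^esub> lc n 0 [:0, 2:] \<in> ?N"
    by (simp add: lc_w)
  let ?e = "free_basis (Q n) (\<pi> n [:f:])"
  have e: "?e \<in> carrier ?F" by (simp add: Q.free_basis_closed)
  have "(?e \<ominus>\<^bsub>?F\<^esub> lc n [:pderiv f:] 0) \<ominus>\<^bsub>?F\<^esub> (?e \<ominus>\<^bsub>?F\<^esub> lc n 0 [:0, 2:]) \<in> ?N"
    using d_poly_x[of n f] 2 by (simp add: diff.F.M.minus_eq)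
  moreover have "(?e \<ominus>\<^bsub>?F\<^esub> lc n [:pderiv f:] 0) \<ominus>\<^bsub>?F\<^esub> (?e \<ominus>\<^bsub>?F\<^esub> lc n 0 [:0, 2:]) =
      (?e \<ominus>\<^bsub>?F\<^esub> ?e) \<oplus>\<^bsub>?F\<^esub> (lc n 0 [:0, 2:] \<ominus>\<^bsub>?F\<^esub> lc n [:pderiv f:] 0)"
    using e by (simp add: diff.F.M.minus_eq diff.F.M.minus_add diff.F.M.a_ac)
  moreover have "?e \<ominus>\<^bsub>?F\<^esub> ?e = \<zero>\<^bsub>?F\<^esub>" using e by (simp add: diff.F.M.minus_eq diff.F.M.r_neg)
  ultimately show ?thesis by (simp add: lc_minus)
qed

definition s0 :: "'r poly" where "s0 = (SOME s. \<exists>t. s * f + t * pderiv f = 1)"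
definition t0 :: "'r poly" where "t0 = (SOME t. s0 * f + t * pderiv f = 1)"

lemma s0_t0: "s0 * f + t0 * pderiv f = 1"
proof -
  have "\<exists>t. s0 * f + t * pderiv f = 1" unfolding s0_def by (rule someI_ex) (rule f_bezout)
  then show ?thesis unfolding t0_def by (rule someI_ex)
qed

text \<open>As \<open>2 y dy = f' dx\<close>, the element \<open>s y dx + 2 t dy\<close> with \<open>s f + t f' = 1\<close> satisfies \<open>y \<omega> = dx\<close>.\<close>

definition om :: "nat \<Rightarrow> 'r poly poly set set \<Rightarrow> 'r poly poly set set" where
  "om n = lc n [:0, s0:] [:2 * t0:]"

lemma smult_half: "smult half (2 * g) = g"
  using half by (simp add: numeral_poly mult.commute)

text \<open>On generators the claim is \<open>dx = y \<omega>\<close> and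
  \<open>dy = (f'/2) \<omega>\<close>; both follow from the curve relation and the Bezout identity
  of \<open>f\<close> and \<open>f'\<close>. Induction over polynomials extends it to all
  elements.\<close>

lemma rank_one: "rank_one_differentials (Q n) (RQ n) (str n) (dq n) (om n)"
proof -
  let ?F = "free_module (Q n)" and ?N = "kaehler_submodule (RQ n) (Q n) (str n)"
  have om_closed: "om n \<in> carrier ?F" by (simp add: om_def)
  have dq_closed: "dq n u \<in> carrier (Q n)" for u by (simp add: dq_def)
  have E1: "\<pi> n g = \<pi> n h" if "g - h = E * k" for g h k
    using that J_E by (simp add: \<pi>_eq_iff)
  \<comment> \<open>The difference is \<open>- t0\<close> times the curve relation, because
    \<open>1 - s0 y^2 = t0 f'\<close> modulo \<open>E\<close>.\<close>
  have dx: "lc n 1 0 \<ominus>\<^bsub>?F\<^esub> \<pi> n [:0, 1:] \<odot>\<^bsub>?F\<^esub> om n \<in> ?N"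
  proof -
    have "lc n 1 0 \<ominus>\<^bsub>?F\<^esub> \<pi> n [:0, 1:] \<odot>\<^bsub>?F\<^esub> om n = \<pi> n [:- t0:] \<odot>\<^bsub>?F\<^esub> lc n [:- pderiv f:] [:0, 2:]"
      unfolding om_def lc_smult lc_minus
    proof (rule lc_cong)
      have "[:1 - t0 * pderiv f:] = [:s0 * f:]" using s0_t0 by (simp add: algebra_simps)
      then show "\<pi> n (1 - [:0, 1:] * [:0, s0:]) = \<pi> n ([:- t0:] * [:- pderiv f:])"
        by (intro E1[of _ _ "[:- s0:]"]) (simp add: E_eq one_pCons mult.commute)
    qed (simp add: algebra_simps)
    then show ?thesis using d_curve[of n] by (simp add: diff.N.smult_closed)
  qed
  \<comment> \<open>Here the difference is \<open>s0 y / 2\<close> times the curve relation.\<close>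
  have dy: "lc n 0 1 \<ominus>\<^bsub>?F\<^esub> \<pi> n [:smult half (pderiv f):] \<odot>\<^bsub>?F\<^esub> om n \<in> ?N"
  proof -
    have "lc n 0 1 \<ominus>\<^bsub>?F\<^esub> \<pi> n [:smult half (pderiv f):] \<odot>\<^bsub>?F\<^esub> om n =
        \<pi> n [:0, smult half s0:] \<odot>\<^bsub>?F\<^esub> lc n [:- pderiv f:] [:0, 2:]"
      unfolding om_def lc_smult lc_minus
    proof (rule lc_cong)
      have "[:1 - t0 * pderiv f:] = [:s0 * f:]" using s0_t0 by (simp add: algebra_simps)
      moreover have "smult half (pderiv f) * (2 * t0) = t0 * pderiv f"
        using smult_half[of "pderiv f * t0"] by (simp add: mult_ac)
      moreover have "smult half s0 * 2 = s0" using smult_half[of s0] by (simp add: mult_ac)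
      ultimately show "\<pi> n (1 - [:smult half (pderiv f):] * [:2 * t0:]) = \<pi> n ([:0, smult half s0:] * [:0, 2:])"
        by (intro E1[of _ _ "[:- s0:]"]) (simp add: E_eq one_pCons mult.commute)
    qed (simp add: mult.commute)
    then show ?thesis using d_curve[of n] by (simp add: diff.N.smult_closed)
  qed
  have d_x: "free_basis (Q n) (\<pi> n [:h:]) \<ominus>\<^bsub>?F\<^esub> \<pi> n (der [:h:]) \<odot>\<^bsub>?F\<^esub> om n \<in> ?N" for h
  proof (induction h)
    case 0
    show ?case using diff.d_eq_const[OF _ om_closed, of "padic_class ring_of_type_algebra p n 0"]
      by (simp add: str_class carrier_RQ \<pi>_zero der_x)
  next
    case (pCons c h)
    have 1: "free_basis (Q n) (\<pi> n [:[:c:]:]) \<ominus>\<^bsub>?F\<^esub> \<pi> n (der [:[:c:]:]) \<odot>\<^bsub>?F\<^esub> om n \<in> ?N"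
      using diff.d_eq_const[OF _ om_closed, of "padic_class ring_of_type_algebra p n c"]
      by (simp add: str_class carrier_RQ \<pi>_zero der_const)
    have 2: "free_basis (Q n) (\<pi> n [:[:0, 1:]:]) \<ominus>\<^bsub>?F\<^esub> \<pi> n (der [:[:0, 1:]:]) \<odot>\<^bsub>?F\<^esub> om n \<in> ?N"
      using dx unfolding lc_x der_var_x .
    have 3: "free_basis (Q n) (\<pi> n ([:[:0, 1:]:] * [:h:])) \<ominus>\<^bsub>?F\<^esub>
        \<pi> n (der ([:[:0, 1:]:] * [:h:])) \<odot>\<^bsub>?F\<^esub> om n \<in> ?N"
      using diff.d_eq_mult[OF _ _ _ _ om_closed 2 pCons.IH] by (simp only: der_mult \<pi>_mult \<pi>_add \<pi>_closed)
    have "free_basis (Q n) (\<pi> n ([:[:c:]:] + [:[:0, 1:]:] * [:h:])) \<ominus>\<^bsub>?F\<^esub>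
        \<pi> n (der ([:[:c:]:] + [:[:0, 1:]:] * [:h:])) \<odot>\<^bsub>?F\<^esub> om n \<in> ?N"
      using diff.d_eq_add[OF _ _ _ _ om_closed 1 3] by (simp only: der_add \<pi>_add \<pi>_closed)
    then show ?case by simp
  qed
  have d_all: "free_basis (Q n) (\<pi> n g) \<ominus>\<^bsub>?F\<^esub> \<pi> n (der g) \<odot>\<^bsub>?F\<^esub> om n \<in> ?N" for g
  proof (induction g)
    case 0
    show ?case using d_x[of 0] by simp
  next
    case (pCons h g)
    have 2: "free_basis (Q n) (\<pi> n [:0, 1:]) \<ominus>\<^bsub>?F\<^esub> \<pi> n (der [:0, 1:]) \<odot>\<^bsub>?F\<^esub> om n \<in> ?N"
      using dy by (simp add: lc_y der_y)
    have 3: "free_basis (Q n) (\<pi> n ([:0, 1:] * g)) \<ominus>\<^bsub>?F\<^esub> \<pi> n (der ([:0, 1:] * g)) \<odot>\<^bsub>?F\<^esub> om n \<in> ?N"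
      using diff.d_eq_mult[OF _ _ _ _ om_closed 2 pCons.IH] by (simp only: der_mult \<pi>_mult \<pi>_add \<pi>_closed)
    have "free_basis (Q n) (\<pi> n ([:h:] + [:0, 1:] * g)) \<ominus>\<^bsub>?F\<^esub>
        \<pi> n (der ([:h:] + [:0, 1:] * g)) \<odot>\<^bsub>?F\<^esub> om n \<in> ?N"
      using diff.d_eq_add[OF _ _ _ _ om_closed d_x[of h] 3] by (simp only: der_add \<pi>_add \<pi>_closed)
    then show ?case by simp
  qed
  show ?thesis
  proof (unfold_locales)
    show "om n \<in> carrier (free_module (Q n))" by (rule om_closed)
    have bas: "free_basis (Q n) (\<pi> n g) \<in> carrier ?F" for g by (simp add: Q.free_basis_closed)
    \<comment> \<open>The coordinate of \<open>om n\<close> is \<open>s0 y^2 + t0 f'\<close>, which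
      is 1 modulo \<open>E\<close>.\<close>
    have "Q.lin_ext n (dq n) (om n) = \<pi> n ([:0, s0:] * [:0, 1:] + [:2 * t0:] * [:smult half (pderiv f):])"
      unfolding om_def lc_def
      by (simp add: bas dq_closed Q.lin_ext_add Q.lin_ext_smult Q.lin_ext_basis der_var_x der_y
          diff.F.smult_closed \<pi>_mult \<pi>_add)
    also have "\<dots> = \<one>\<^bsub>Q n\<^esub>"
    proof -
      have "[:s0 * f:] = [:1 - t0 * pderiv f:]" using s0_t0 by (simp add: algebra_simps)
      moreover have "2 * t0 * smult half (pderiv f) = t0 * pderiv f"
        using smult_half[of "pderiv f * t0"] by (simp add: mult_ac)
      ultimately show ?thesis unfolding \<pi>_one
        by (intro E1[of _ _ "[:s0:]"]) (simp add: E_eq one_pCons mult.commute)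
    qed
    finally show "Q.lin_ext n (dq n) (om n) = \<one>\<^bsub>Q n\<^esub>" .
  next
    fix u assume "u \<in> carrier (Q n)"
    then obtain g where "u = \<pi> n g" by (auto simp: carrier_Q)
    then show "free_basis (Q n) u \<ominus>\<^bsub>?F\<^esub> dq n u \<odot>\<^bsub>?F\<^esub> om n \<in> ?N"
      using d_all by simp
  qed (auto simp: carrier_Q carrier_RQ str_class \<pi>_add \<pi>_mult der_add der_mult der_const \<pi>_zero)
qed

sublocale R1: rank_one_differentials "Q n" "RQ n" "str n" "dq n" "om n" for n
  by (rule rank_one)

end

section \<open>Completed differentials\<close>

context ordinary_curve
begin

abbreviation "M \<equiv> curve_hat_differentials p a b"

text \<open>The differential \<open>g \<omega>\<close> modulo \<open>p^n\<close>, with its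
  coordinate given by a polynomial.\<close>

definition Cl :: "nat \<Rightarrow> 'r poly poly \<Rightarrow> ('r poly poly set set \<Rightarrow> 'r poly poly set set) set" where
  "Cl n g = R1.cl n (\<pi> n g)"

lemma Cl_eq_iff: "Cl n g = Cl n h \<longleftrightarrow> g - h \<in> J n"
  by (simp add: Cl_def R1.cl_eq_iff \<pi>_eq_iff)

lemma padic_kaehler_eq:
  "padic_kaehler ring_of_type_algebra C (curve_const a b) p n = kaehler (RQ n) (Q n) (str n)"
  by (simp add: padic_kaehler_def)

lemma carrier_level: "carrier (kaehler (RQ n) (Q n) (str n)) = range (Cl n)"
  unfolding R1.carrier_kaehler carrier_Q by (auto simp: Cl_def)

lemma add_level: "Cl n g \<oplus>\<^bsub>kaehler (RQ n) (Q n) (str n)\<^esub> Cl n h = Cl n (g + h)"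
  by (simp add: Cl_def R1.add_kaehler \<pi>_add)

lemma smult_level: "\<pi> n g \<odot>\<^bsub>kaehler (RQ n) (Q n) (str n)\<^esub> Cl n h = Cl n (g * h)"
  by (simp add: Cl_def R1.smult_kaehler \<pi>_mult)

lemma zero_level: "\<zero>\<^bsub>kaehler (RQ n) (Q n) (str n)\<^esub> = Cl n 0"
  by (simp add: Cl_def R1.zero_kaehler \<pi>_zero)

lemma d_level: "kaehler_d (RQ n) (Q n) (str n) (\<pi> n g) = Cl n (der g)"
  by (simp add: Cl_def R1.kaehler_d_eq)

text \<open>\<open>E'\<close> lifts the ring map \<open>G\<close> to polynomials and
  \<open>k\<close> is the factor by which the induced map scales \<open>\<omega>\<close>;
  compatibility with \<open>der\<close> is asked only modulo \<open>J n\<close>.\<close>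

lemma kaehler_map_level:
  assumes G: "\<And>g. G (\<pi> j g) = \<pi> n (E' g)"
    and E'_1: "E' 1 = 1"
    and E'_add: "\<And>g h. E' (g + h) = E' g + E' h"
    and E'_mult: "\<And>g h. E' (g * h) = E' g * E' h"
    and E'_der: "\<And>g. der (E' g) - k * E' (der g) \<in> J n"
  shows "padic_kaehler_map ring_of_type_algebra C (curve_const a b) p j n G (Cl j g) = Cl n (k * E' g)"
proof -
  have "G \<in> ring_hom (Q j) (Q n)"
    by (rule ring_hom_memI) (auto simp: carrier_Q G \<pi>_add \<pi>_mult E'_add E'_mult \<pi>_one E'_1)
  moreover have "dq n (G u) = \<pi> n k \<otimes>\<^bsub>Q n\<^esub> G (dq j u)" if u: "u \<in> carrier (Q j)" for u
  proof -
    obtain g where "u = \<pi> j g" using u by (auto simp: carrier_Q)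
    then show ?thesis using E'_der[of g] by (simp add: G \<pi>_mult \<pi>_eq_iff)
  qed
  ultimately show ?thesis
    unfolding padic_kaehler_map_def Cl_def
    by (subst kaehler_map_rank_one[OF rank_one rank_one, where \<kappa>="\<pi> n k"]) (simp_all add: G \<pi>_mult)
qed

lemma transition_level:
  "padic_kaehler_map ring_of_type_algebra C (curve_const a b) p (Suc n) n (induced (padic_class C p n))
     (Cl (Suc n) g) = Cl n g"
  using kaehler_map_level[of "induced (padic_class C p n)" "Suc n" n "\<lambda>g. g" 1 g] coherent_const[of 0]
  by (simp add: induced_transition coherent_def)

text \<open>The transition maps preserve the coordinate with respect to \<open>\<omega>\<close>, so
  compatible families of differentials are coherent families of coordinates.\<close>

lemma carrier_M: "carrier M = {w. \<exists>g. coherent g \<and> w = (\<lambda>n. Cl n (g n))}"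
proof (intro equalityI subsetI)
  fix w assume "w \<in> carrier M"
  then have w: "w n \<in> range (Cl n)"
    "padic_kaehler_map ring_of_type_algebra C (curve_const a b) p (Suc n) n (induced (padic_class C p n))
      (w (Suc n)) = w n" for n
    by (simp_all add: curve_hat_differentials_def complete_kaehler_def padic_kaehler_eq flip: carrier_level)
  then have "\<forall>n. \<exists>g. w n = Cl n g" by blast
  then obtain g where g: "\<And>n. w n = Cl n (g n)" by metis
  then have "coherent g" using w(2) by (simp add: coherent_def transition_level Cl_eq_iff)
  then show "w \<in> {w. \<exists>g. coherent g \<and> w = (\<lambda>n. Cl n (g n))}" using g by auto
next
  fix w assume "w \<in> {w. \<exists>g. coherent g \<and> w = (\<lambda>n. Cl n (g n))}"
  then obtain g where g: "coherent g" "w = (\<lambda>n. Cl n (g n))" by blast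
  then have "Cl n (g (Suc n)) = Cl n (g n)" for n by (simp add: Cl_eq_iff coherent_def)
  then show "w \<in> carrier M"
    by (simp add: g curve_hat_differentials_def complete_kaehler_def padic_kaehler_eq carrier_level
        transition_level)
qed

lemma M_add: "(\<lambda>n. Cl n (g n)) \<oplus>\<^bsub>M\<^esub> (\<lambda>n. Cl n (h n)) = (\<lambda>n. Cl n (g n + h n))"
  and M_zero: "\<zero>\<^bsub>M\<^esub> = (\<lambda>n. Cl n 0)"
  and M_smult: "(\<lambda>n. \<pi> n (g n)) \<odot>\<^bsub>M\<^esub> (\<lambda>n. Cl n (h n)) = (\<lambda>n. Cl n (g n * h n))"
  by (simp_all add: curve_hat_differentials_def complete_kaehler_def padic_kaehler_eq
      add_level smult_level zero_level)

lemma M_add_pow: "add_pow M (k::nat) (\<lambda>n. Cl n (g n)) = (\<lambda>n. Cl n (of_nat k * g n))"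
proof (induction k)
  case (Suc k)
  have "add_pow M (Suc k) (\<lambda>n. Cl n (g n)) = add_pow M k (\<lambda>n. Cl n (g n)) \<oplus>\<^bsub>M\<^esub> (\<lambda>n. Cl n (g n))"
    by (simp add: add_pow_def nat_pow_def)
  then show ?case by (simp add: Suc M_add algebra_simps)
qed (simp add: add_pow_def nat_pow_def M_zero)

lemma abelian_group_M: "abelian_group M"
proof (rule abelian_groupI)
  fix v w assume "v \<in> carrier M" "w \<in> carrier M"
  then obtain g h where "coherent g" "v = (\<lambda>n. Cl n (g n))" "coherent h" "w = (\<lambda>n. Cl n (h n))"
    by (auto simp: carrier_M)
  then show "v \<oplus>\<^bsub>M\<^esub> w \<in> carrier M"
    using coherent_add[of g h] by (auto simp: carrier_M M_add)
next
  show "\<zero>\<^bsub>M\<^esub> \<in> carrier M" using coherent_const[of 0] by (auto simp: carrier_M M_zero)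
next
  fix v assume "v \<in> carrier M"
  then obtain g where g: "coherent g" "v = (\<lambda>n. Cl n (g n))" by (auto simp: carrier_M)
  then have "(\<lambda>n. Cl n (0 - g n)) \<in> carrier M" "(\<lambda>n. Cl n (0 - g n)) \<oplus>\<^bsub>M\<^esub> v = \<zero>\<^bsub>M\<^esub>"
    using coherent_minus[OF coherent_const[of 0] g(1)] by (auto simp: carrier_M M_add M_zero)
  then show "\<exists>w\<in>carrier M. w \<oplus>\<^bsub>M\<^esub> v = \<zero>\<^bsub>M\<^esub>" by blast
qed (auto simp: carrier_M M_add M_zero add_ac)

lemma M_minus:
  assumes "coherent g" "coherent h"
  shows "(\<lambda>n. Cl n (g n)) \<ominus>\<^bsub>M\<^esub> (\<lambda>n. Cl n (h n)) = (\<lambda>n. Cl n (g n - h n))"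
proof -
  interpret M: abelian_group M by (rule abelian_group_M)
  have "(\<lambda>n. Cl n (0 - h n)) \<in> carrier M" "(\<lambda>n. Cl n (h n)) \<in> carrier M"
    using coherent_minus[OF coherent_const[of 0] assms(2)] assms(2) by (auto simp: carrier_M)
  then have "\<ominus>\<^bsub>M\<^esub> (\<lambda>n. Cl n (h n)) = (\<lambda>n. Cl n (0 - h n))"
    by (intro M.minus_equality) (simp_all add: M_add M_zero)
  then show ?thesis by (simp add: a_minus_def M_add)
qed

lemma completion_minus:
  assumes "coherent g" "coherent h"
  shows "(\<lambda>n. \<pi> n (g n)) \<ominus>\<^bsub>curve_hat p a b\<^esub> (\<lambda>n. \<pi> n (h n)) = (\<lambda>n. \<pi> n (g n - h n))"
proof -
  interpret H: cring "curve_hat p a b" by (rule cring_completion)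
  have "(\<lambda>n. \<pi> n (0 - h n)) \<in> carrier (curve_hat p a b)" "(\<lambda>n. \<pi> n (h n)) \<in> carrier (curve_hat p a b)"
    using coherent_minus[OF coherent_const[of 0] assms(2)] assms(2) by (auto simp: carrier_completion)
  then have "\<ominus>\<^bsub>curve_hat p a b\<^esub> (\<lambda>n. \<pi> n (h n)) = (\<lambda>n. \<pi> n (0 - h n))"
    by (intro H.minus_equality) (simp_all add: completion_add completion_zero \<pi>_add)
  then show ?thesis by (simp add: a_minus_def completion_add \<pi>_add)
qed

lemma completion_pow:
  "(\<lambda>n. \<pi> n (g n)) [^]\<^bsub>curve_hat p a b\<^esub> (k::nat) = (\<lambda>n. \<pi> n (g n ^ k))"
proof (induction k)
  case (Suc k)
  then show ?case by (simp add: nat_pow_def completion_mult \<pi>_mult mult.commute)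
qed (simp add: nat_pow_def completion_one)

lemma completion_add_pow: "add_pow (curve_hat p a b) (k::nat) \<one>\<^bsub>curve_hat p a b\<^esub> = (\<lambda>n. \<pi> n (of_nat k))"
proof (induction k)
  case (Suc k)
  have "add_pow (curve_hat p a b) (Suc k) \<one>\<^bsub>curve_hat p a b\<^esub> =
      add_pow (curve_hat p a b) k \<one>\<^bsub>curve_hat p a b\<^esub> \<oplus>\<^bsub>curve_hat p a b\<^esub> \<one>\<^bsub>curve_hat p a b\<^esub>"
    by (simp add: add_pow_def nat_pow_def)
  then show ?case unfolding Suc by (simp add: completion_add completion_one \<pi>_add add.commute)
qed (simp add: add_pow_def nat_pow_def completion_zero)

section \<open>Cancelling \<open>y\<close> and \<open>p\<close> on the curve\<close>

lemma reduce_mod_E: "\<exists>h0 h1 l. h = [:h0, h1:] + E * l"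
proof (induction h)
  case 0
  show ?case by (rule exI[of _ 0], rule exI[of _ 0], rule exI[of _ 0]) simp
next
  case (pCons c h)
  then obtain h0 h1 l where h: "h = [:h0, h1:] + E * l" by blast
  have "pCons c h = [:c:] + [:0, 1:] * h" by simp
  also have "\<dots> = [:c, h0, h1:] + E * ([:0, 1:] * l)"
    unfolding h by (simp only: distrib_left mult.left_commute) simp
  \<comment> \<open>\<open>y^2\<close> is replaced by \<open>f\<close>, which keeps the degree in
    \<open>y\<close> below two.\<close>
  also have "[:c, h0, h1:] = [:c + h1 * f, h0:] + E * [:h1:]" by (simp add: E_eq)
  finally have "pCons c h = [:c + h1 * f, h0:] + E * ([:h1:] + [:0, 1:] * l)"
    by (simp only: distrib_left add.assoc)
  then show ?case by blast
qed

lemma linear_dvd_E: "[:h0, h1:] = E * k \<Longrightarrow> h0 = 0 \<and> h1 = 0"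
proof -
  assume h: "[:h0, h1:] = E * k"
  have "k = 0"
  proof (rule ccontr)
    assume "k \<noteq> 0"
    moreover have "Polynomial.degree E = 2" "E \<noteq> 0" by (simp_all add: E_eq)
    ultimately have "Polynomial.degree (E * k) \<ge> 2" by (simp add: degree_mult_eq)
    then show False unfolding h[symmetric] by (simp split: if_splits)
  qed
  then show ?thesis using h by simp
qed

lemma prime_power_cancel:
  fixes q g h :: "'b::idom"
  assumes "prime_elem q" "\<not> q dvd g" "q ^ n dvd g * h"
  shows "q ^ n dvd h"
  using assms(3)
proof (induction n arbitrary: h)
  case (Suc n)
  then have "q dvd g * h" by (metis dvd_mult_left power_Suc)
  then have "q dvd h" using assms prime_elem_dvd_mult_iff by blast
  then obtain k where k: "h = q * k" by blast
  have "q * q ^ n dvd q * (g * k)" using Suc.prems by (simp add: k mult_ac)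
  then have "q ^ n dvd g * k" using assms(1) by (simp add: prime_elem_def)
  then show ?case using Suc.IH[of k] by (simp add: k mult_dvd_mono)
qed simp

text \<open>On the basis \<open>1, y\<close> multiplication by \<open>y\<close> sends
  \<open>h0 + h1 y\<close> to \<open>h1 f + h0 y\<close>, and the power \<open>p^n\<close> can be
  taken off \<open>h1 f\<close> because \<open>p\<close> is prime and does not divide the monic
  \<open>f\<close>. This gives uniqueness of \<open>dx/y\<close>.\<close>

lemma y_cancel:
  assumes "[:0, 1:] * h \<in> J n" shows "h \<in> J n"
proof -
  let ?P = "of_nat p ^ n :: 'r poly"
  have PP: "(of_nat p ^ n :: 'r poly poly) = [:?P:]" by (simp add: of_nat_poly poly_const_pow)
  obtain k l where kl: "[:0, 1:] * h = [:?P:] * k + E * l" using assms unfolding J_def PP by blast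
  obtain h0 h1 hl where h: "h = [:h0, h1:] + E * hl" using reduce_mod_E by blast
  obtain k0 k1 k' where k: "k = [:k0, k1:] + E * k'" using reduce_mod_E by blast
  have "[:0, 1:] * [:h0, h1:] = [:h1 * f, h0:] + E * [:h1:]" by (simp add: E_eq)
  then have "[:h1 * f, h0:] - [:?P:] * [:k0, k1:] = E * (l + [:?P:] * k' - [:h1:] - [:0, 1:] * hl)"
    using kl unfolding h k by (simp only: algebra_simps)
  then have "[:h1 * f - ?P * k0, h0 - ?P * k1:] = E * (l + [:?P:] * k' - [:h1:] - [:0, 1:] * hl)"
    by (simp add: mult.commute)
  then have "h1 * f = ?P * k0" "h0 = ?P * k1" by (auto dest: linear_dvd_E)
  moreover have "?P dvd h1"
  proof (rule prime_power_cancel[OF prime_elem_p_poly])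
    show "\<not> of_nat p dvd f" using p_poly_not_dvd_monic[of f] by (simp add: f_def)
    show "?P dvd f * h1" using \<open>h1 * f = ?P * k0\<close> by (simp add: mult.commute)
  qed
  ultimately obtain z where "h1 = ?P * z" "h0 = ?P * k1" by blast
  then have "h = of_nat p ^ n * [:k1, z:] + E * hl" unfolding h PP by simp
  then show ?thesis unfolding J_def by blast
qed

text \<open>The curve ring has no \<open>p\<close>-torsion: \<open>p\<close> is prime in
  \<open>R[x,y]\<close> and does not divide \<open>E\<close>, which is monic in
  \<open>y\<close>.\<close>

lemma p_cancel:
  assumes "of_nat p * h \<in> J (Suc n)" shows "h \<in> J n"
proof -
  obtain k l where "of_nat p * h = of_nat p ^ Suc n * k + E * l" using assms by (auto simp: J_def)
  then have l: "of_nat p * (h - of_nat p ^ n * k) = E * l" by (simp add: algebra_simps)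
  have "\<not> (of_nat p :: 'r poly poly) dvd E"
  proof
    assume "(of_nat p :: 'r poly poly) dvd E"
    then have "of_nat p dvd Polynomial.coeff E 2" by (simp add: of_nat_poly[of p] const_poly_dvd_iff)
    then show False using prime_elem_p_poly by (simp add: E_eq numeral_2_eq_2 prime_elem_def)
  qed
  then have "of_nat p dvd l"
    using l prime_elem_p_poly2 by (metis dvd_triv_left prime_elem_dvd_mult_iff)
  then obtain l' where "l = of_nat p * l'" by blast
  then have "of_nat p * (h - of_nat p ^ n * k) = of_nat p * (E * l')" using l by (simp add: mult_ac)
  then have "h - of_nat p ^ n * k = E * l'"
    using prime_elem_p_poly2 by (simp add: prime_elem_def del: right_diff_distrib)
  then have "h = of_nat p ^ n * k + E * l'" by (simp add: algebra_simps)
  then show ?thesis unfolding J_def by blast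
qed

text \<open>Dividing by \<open>p\<close> costs one power of \<open>p\<close>, so the quotient at level \<open>n\<close> is read off from level \<open>n + 1\<close>.\<close>

lemma coherent_divide:
  assumes "coherent z" "\<And>n. z n \<in> J 1"
  obtains k where "coherent k" "\<And>n. z n - of_nat p * k n \<in> J n"
proof -
  have "\<exists>k l. z (Suc n) = of_nat p * k + E * l" for n
    using assms(2)[of "Suc n"] by (auto simp: J_def)
  then obtain k l where k: "\<And>n. z (Suc n) = of_nat p * k n + E * l n" by metis
  have "of_nat p * (k (Suc n) - k n) \<in> J (Suc n)" for n
  proof -
    have "of_nat p * (k (Suc n) - k n) = (z (Suc (Suc n)) - z (Suc n)) - E * (l (Suc n) - l n)"
      unfolding k by (simp add: algebra_simps)
    then show ?thesis using assms(1) J_E by (simp add: coherent_def J_diff)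
  qed
  then have "coherent k" unfolding coherent_def using p_cancel by blast
  moreover have "z n - of_nat p * k n \<in> J n" for n
  proof -
    have "z n - of_nat p * k n = E * l n - (z (Suc n) - z n)" unfolding k by simp
    then show ?thesis using assms(1) J_E J_diff unfolding coherent_def by metis
  qed
  ultimately show thesis by (rule that)
qed

text \<open>The coordinate of \<open>dx\<close> is \<open>der x = y\<close>, so
  \<open>y w = dx\<close> holds for the coordinate 1, and by \<open>y_cancel\<close> for no
  other.\<close>

lemma omega_eq: "curve_omega p a b = (\<lambda>n. Cl n 1)"
proof -
  have y: "curve_hat_class p a b [:0, 1:] = (\<lambda>n. \<pi> n [:0, 1:])"
    by (simp add: curve_hat_class_def to_completion_\<pi>)
  have dx: "complete_d ring_of_type_algebra C (curve_const a b) p (curve_hat_class p a b [:[:0, 1:]:]) =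
      (\<lambda>n. Cl n [:0, 1:])"
    by (simp add: complete_d_def curve_hat_class_def to_completion_\<pi> d_level der_var_x)
  show ?thesis unfolding curve_omega_def y dx
  proof (rule the_equality)
    show "(\<lambda>n. Cl n 1) \<in> carrier M \<and> (\<lambda>n. \<pi> n [:0, 1:]) \<odot>\<^bsub>M\<^esub> (\<lambda>n. Cl n 1) = (\<lambda>n. Cl n [:0, 1:])"
      using coherent_const[of 1] by (auto simp: carrier_M M_smult)
  next
    fix w assume w: "w \<in> carrier M \<and> (\<lambda>n. \<pi> n [:0, 1:]) \<odot>\<^bsub>M\<^esub> w = (\<lambda>n. Cl n [:0, 1:])"
    then obtain g where g: "w = (\<lambda>n. Cl n (g n))" by (auto simp: carrier_M)
    have "Cl n ([:0, 1:] * g n) = Cl n [:0, 1:]" for n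
      using w unfolding g M_smult by meson
    then have "[:0, 1:] * (g n - 1) \<in> J n" for n
      unfolding Cl_eq_iff by (simp add: right_diff_distrib)
    then have "g n - 1 \<in> J n" for n by (rule y_cancel)
    then show "w = (\<lambda>n. Cl n 1)" unfolding g Cl_eq_iff[symmetric] by blast
  qed
qed

end

section \<open>The Frobenius lift\<close>

lemma map_poly_ring_hom:
  fixes \<sigma> :: "'a::comm_ring_1 \<Rightarrow> 'b::comm_ring_1"
  assumes add: "\<And>x y. \<sigma> (x + y) = \<sigma> x + \<sigma> y" and mult: "\<And>x y. \<sigma> (x * y) = \<sigma> x * \<sigma> y"
  shows "map_poly \<sigma> (g + h) = map_poly \<sigma> g + map_poly \<sigma> h"
    and "map_poly \<sigma> (g * h) = map_poly \<sigma> g * map_poly \<sigma> h"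
proof -
  have 0: "\<sigma> 0 = 0" using add[of 0 0] by (metis add.right_neutral add_left_cancel)
  show add': "map_poly \<sigma> (g + h) = map_poly \<sigma> g + map_poly \<sigma> h" for g h
    by (intro poly_eqI) (simp add: coeff_map_poly 0 add)
  have smult: "map_poly \<sigma> (smult c h) = smult (\<sigma> c) (map_poly \<sigma> h)" for c h
    by (intro poly_eqI) (simp add: coeff_map_poly 0 mult)
  show "map_poly \<sigma> (g * h) = map_poly \<sigma> g * map_poly \<sigma> h"
    by (induction g) (simp_all add: add' smult map_poly_pCons 0)
qed

lemma dvd_pcompose_diff:
  fixes u v :: "'a::comm_ring_1 poly"
  assumes "c dvd u - v" shows "c dvd g \<circ>\<^sub>p u - g \<circ>\<^sub>p v"
proof (induction g)
  case (pCons d g)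
  have "pCons d g \<circ>\<^sub>p u - pCons d g \<circ>\<^sub>p v = (u - v) * (g \<circ>\<^sub>p u) + v * (g \<circ>\<^sub>p u - g \<circ>\<^sub>p v)"
    by (simp add: pcompose_pCons algebra_simps)
  then show ?case using assms pCons.IH by (simp add: dvd_add)
qed simp

text \<open>Modulo \<open>p\<^sup>n\<close> the lift is \<open>x \<mapsto> U n\<close>, \<open>y \<mapsto> y W n\<close>, and \<open>c n\<close> is the coordinate of
  \<open>(1/p) \<Phi>\<^sup>*\<omega>\<close> with respect to \<open>\<omega>\<close>.\<close>

locale frobenius_data = ordinary_curve p \<phi> a b l \<delta> half
  for p and \<phi> :: "'a::idom \<Rightarrow> 'a" and a b l \<delta> half +
  fixes U W c :: "nat \<Rightarrow> 'a poly"
  assumes U_step: "\<And>n. of_nat p ^ n dvd U (Suc n) - U n"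
    and W_step: "\<And>n. of_nat p ^ n dvd W (Suc n) - W n"
    and c_step: "\<And>n. of_nat p ^ n dvd c (Suc n) - c n"
    and U_mod_p: "\<And>n. of_nat p dvd U n - xp" and W_mod_p: "\<And>n. of_nat p dvd W n - f ^ m"
    and c_mod_p: "\<And>n. of_nat p dvd c n - [:l:]"
    and lift_eq: "\<And>n. of_nat p ^ n dvd f * W n ^ 2 - cubic A B (U n)"
    and dU: "\<And>n. of_nat p ^ n dvd of_nat p * c n * W n - pderiv (U n)"
    and dW: "\<And>n. of_nat p ^ n dvd of_nat p * c n * dcubic A (U n) - (W n * pderiv f + 2 * f * pderiv (W n))"
begin

section \<open>The \<open>\<phi>\<close>-semilinear substitution on polynomials\<close>

definition sub :: "nat \<Rightarrow> 'a poly \<Rightarrow> 'a poly" where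
  "sub n h = map_poly \<phi> h \<circ>\<^sub>p U n"

lemma sub_add: "sub n (g + h) = sub n g + sub n h"
  and sub_mult: "sub n (g * h) = sub n g * sub n h"
  by (simp_all add: sub_def map_poly_ring_hom[OF \<phi>_add \<phi>_mult] pcompose_add pcompose_mult)

lemma sub_const: "sub n [:r:] = [:\<phi> r:]"
  by (simp add: sub_def map_poly_pCons)

lemma sub_1 [simp]: "sub n 1 = 1"
  by (simp add: sub_def \<phi>_1 map_poly_pCons one_pCons)

lemma sub_0 [simp]: "sub n 0 = 0"
  by (simp add: sub_def)

text \<open>Coefficients in \<open>x\<close> are moved by \<open>sub n\<close> and then made
  constant in \<open>y\<close>; the outer variable is evaluated at \<open>[:0, W n:]\<close>, that
  is \<open>y W\<close>.\<close>

definition ev :: "nat \<Rightarrow> 'a poly poly \<Rightarrow> 'a poly poly" where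
  "ev n g = poly (map_poly (\<lambda>h. [:sub n h:]) g) [:0, W n:]"

lemma ev_add: "ev n (g + h) = ev n g + ev n h"
  and ev_mult: "ev n (g * h) = ev n g * ev n h"
proof -
  have *: "[:sub n (x + y):] = [:sub n x:] + [:sub n y:]" "[:sub n (x * y):] = [:sub n x:] * [:sub n y:]" for x y
    by (simp_all add: sub_add sub_mult)
  show "ev n (g + h) = ev n g + ev n h" "ev n (g * h) = ev n g * ev n h"
    unfolding ev_def map_poly_ring_hom[of "\<lambda>h. [:sub n h:]", OF *] by simp_all
qed

lemma ev_pCons: "ev n (pCons h g) = [:sub n h:] + [:0, W n:] * ev n g"
  by (simp add: ev_def map_poly_pCons)

lemma ev_0 [simp]: "ev n 0 = 0"
  by (simp add: ev_def)

lemma ev_const: "ev n [:[:r:]:] = [:[:\<phi> r:]:]"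
  by (simp add: ev_pCons sub_const)

lemma ev_1: "ev n 1 = 1"
  using ev_const[of n 1] by (simp add: \<phi>_1 flip: one_pCons)

lemma ev_of_nat: "ev n (of_nat k) = of_nat k"
  by (induction k) (simp_all add: ev_add ev_1)

lemma ev_diff: "ev n (g - h) = ev n g - ev n h"
  using ev_add[of n "g - h" h] by (simp add: algebra_simps)

lemma dvd_J: "of_nat p ^ n dvd g \<Longrightarrow> g \<in> J n"
  using J_p by (auto simp: dvd_def)

lemma dvd_const_poly: "of_nat p ^ n dvd (g :: 'a poly) \<Longrightarrow> of_nat p ^ n dvd [:g:]"
proof -
  have "(of_nat p ^ n :: 'a poly poly) = [:of_nat p ^ n:]" by (simp add: of_nat_poly poly_const_pow)
  then show "of_nat p ^ n dvd g \<Longrightarrow> of_nat p ^ n dvd [:g:]" by (simp only: const_poly_dvd_const_poly_iff)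
qed

text \<open>The image \<open>y^2 W^2 - f^\<phi>(U)\<close> is \<open>W^2 E\<close> plus the error of
  the constraint, so the substitution descends to the curve modulo \<open>p^n\<close>.\<close>

lemma ev_E: "ev n E \<in> J n"
proof -
  have "sub n (- f) + cubic A B (U n) = 0"
    using sub_add[of n "- f" f] phi_f_pcompose[of "U n"] by (simp add: sub_def)
  then have "sub n (- f) = - cubic A B (U n)" by (simp add: eq_neg_iff_add_eq_0)
  then have "ev n E = [:- cubic A B (U n):] + [:0, W n:] * ([:0, W n:] * [:1:])"
    by (simp add: E_eq ev_pCons)
  also have "\<dots> = E * [:W n ^ 2:] + [:f * W n ^ 2 - cubic A B (U n):]"
    by (simp add: E_eq power2_eq_square mult.commute)
  finally show ?thesis using J_E dvd_J[OF dvd_const_poly[OF lift_eq]] by (simp only: J_add)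
qed

lemma ev_J: "g \<in> J n \<Longrightarrow> ev n g \<in> J n"
proof -
  assume "g \<in> J n"
  then obtain k z where "g = of_nat (p ^ n) * k + E * z" unfolding J_def of_nat_power by blast
  then have "ev n g = of_nat p ^ n * ev n k + ev n z * ev n E"
    by (simp only: ev_add ev_mult ev_of_nat mult.commute[of "ev n E"]) (simp only: of_nat_power)
  then show ?thesis using J_p ev_E by (simp only: J_add J_mult)
qed

text \<open>For \<open>y\<close> this is \<open>y W = y f^m = y (y^2)^m = y^p\<close> modulo
  \<open>p\<close> and \<open>E\<close>, using \<open>p = 2 m + 1\<close>; for polynomials in
  \<open>x\<close> it is \<open>frobenius_poly\<close>.\<close>

lemma ev_frobenius: "ev n g - g ^ p \<in> J 1"
proof (induction g)
  case 0
  then show ?case using coherent_const[of 0] p_ge_5 by (simp add: coherent_def power_0_left)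
next
  case (pCons h g)
  have e: "pCons h g = [:h:] + [:0, 1:] * g" by simp
  have 1: "(pCons h g) ^ p - ([:h:] ^ p + ([:0, 1:] * g) ^ p) \<in> J 1"
    unfolding e using freshmans_dream_dvd[OF prime_p, of "[:h:]" "[:0, 1:] * g"]
    by (intro dvd_J) (simp only: power_one_right)
  have "of_nat p dvd (map_poly \<phi> h \<circ>\<^sub>p U n - map_poly \<phi> h \<circ>\<^sub>p xp) + (map_poly \<phi> h \<circ>\<^sub>p xp - h ^ p)"
    by (rule dvd_add[OF dvd_pcompose_diff[OF U_mod_p] frobenius_poly])
  then have "of_nat p ^ 1 dvd sub n h - h ^ p" by (simp add: sub_def)
  then have 2: "[:sub n h:] - [:h:] ^ p \<in> J 1" using dvd_J[OF dvd_const_poly] by (simp add: poly_const_pow)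
  have "of_nat p ^ 1 dvd W n - f ^ m" using W_mod_p by simp
  then have "[:0, 1:] * [:W n - f ^ m:] \<in> J 1" using dvd_J[OF dvd_const_poly] by (intro J_mult)
  moreover have "([:0, 1:] ^ 2) ^ m - [:f:] ^ m \<in> J 1"
  proof -
    have "E dvd ([:0, 1:] ^ 2) ^ m - [:f:] ^ m"
      by (rule dvd_diff_power) (simp add: E_eq power2_eq_square)
    then show ?thesis using J_E by (auto simp: dvd_def)
  qed
  moreover have "[:0, W n:] - [:0, 1:] ^ p =
      [:0, 1:] * [:W n - f ^ m:] - [:0, 1:] * (([:0, 1:] ^ 2) ^ m - [:f:] ^ m)"
  proof -
    have "([:0, 1:] :: 'a poly poly) ^ p = [:0, 1:] * ([:0, 1:] ^ 2) ^ m"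
      by (subst p_eq_m) (simp only: power_add power_mult power_one_right, rule mult.commute)
    moreover have "[:0, W n:] = [:0, 1:] * [:W n - f ^ m:] + [:0, 1:] * [:f:] ^ m"
      by (simp add: poly_const_pow)
    ultimately show ?thesis by (simp only: algebra_simps)
  qed
  ultimately have 3: "[:0, W n:] - [:0, 1:] ^ p \<in> J 1" by (simp only: J_diff J_mult)
  have "ev n (pCons h g) - pCons h g ^ p =
      ([:sub n h:] - [:h:] ^ p) + (ev n g * ([:0, W n:] - [:0, 1:] ^ p) + [:0, 1:] ^ p * (ev n g - g ^ p))
      - ((pCons h g) ^ p - ([:h:] ^ p + ([:0, 1:] * g) ^ p))"
    unfolding ev_pCons power_mult_distrib by (simp only: algebra_simps)
  then show ?case using 1 2 3 pCons.IH by (simp only: J_diff J_add J_mult)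
qed

lemma ev_step: "ev (Suc n) g - ev n g \<in> J n"
proof -
  have "of_nat p ^ n dvd ev (Suc n) g - ev n g"
  proof (induction g)
    case (pCons h g)
    have 1: "of_nat p ^ n dvd [:sub (Suc n) h - sub n h:]"
      unfolding sub_def by (intro dvd_const_poly dvd_pcompose_diff U_step)
    have "[:0, 1:] * [:W (Suc n) - W n:] = [:0, W (Suc n):] - [:0, W n:]" by simp
    then have 2: "of_nat p ^ n dvd [:0, W (Suc n):] - [:0, W n:]"
      using dvd_const_poly[OF W_step] by (metis dvd_mult)
    have "[:sub (Suc n) h - sub n h:] = [:sub (Suc n) h:] - [:sub n h:]" by simp
    then have "ev (Suc n) (pCons h g) - ev n (pCons h g) = [:sub (Suc n) h - sub n h:] +
        (([:0, W (Suc n):] - [:0, W n:]) * ev (Suc n) g + [:0, W n:] * (ev (Suc n) g - ev n g))"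
      unfolding ev_pCons by (simp only:) (simp only: algebra_simps)
    then show ?case using 1 2 pCons.IH by (simp only: dvd_add dvd_mult dvd_mult2)
  qed simp
  then show ?thesis by (rule dvd_J)
qed

lemma coherent_ev:
  assumes "coherent g" shows "coherent (\<lambda>n. ev n (g n))"
proof -
  have "ev (Suc n) (g (Suc n)) - ev n (g n) =
      (ev (Suc n) (g (Suc n)) - ev n (g (Suc n))) + ev n (g (Suc n) - g n)" for n
    by (simp add: ev_diff)
  then show ?thesis using assms ev_step ev_J unfolding coherent_def by (metis J_add)
qed

lemma phi_half: "\<phi> half = half"
proof -
  have "2 * \<phi> half = 1" using half \<phi>_mult[of 2 half] by (simp add: \<phi>_numeral \<phi>_1)
  then have "half * (2 * \<phi> half) = half" by simp
  moreover have "half * (2 * \<phi> half) = (2 * half) * \<phi> half" by (simp only: ac_simps)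
  ultimately show ?thesis unfolding half by simp
qed

text \<open>The polynomials satisfying the relation are closed under sums and products, as both
  terms are derivations along \<open>ev n\<close>. It remains to treat \<open>x\<close> and
  \<open>y\<close>, where it is \<open>dU\<close> and \<open>dW\<close>.\<close>

lemma der_ev: "der (ev n g) - [:of_nat p * c n:] * ev n (der g) \<in> J n"
proof -
  let ?K = "[:of_nat p * c n:]"
  let ?ok = "\<lambda>g. der (ev n g) - ?K * ev n (der g) \<in> J n"
  have J0: "0 \<in> J n" using coherent_const[of 0] by (simp add: coherent_def)
  have ok_add: "?ok (g + h)" if "?ok g" "?ok h" for g h
  proof -
    have "der (ev n (g + h)) - ?K * ev n (der (g + h)) =
        (der (ev n g) - ?K * ev n (der g)) + (der (ev n h) - ?K * ev n (der h))"
      unfolding ev_add der_add by (simp only: algebra_simps)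
    then show ?thesis using that by (simp only: J_add)
  qed
  have ok_mult: "?ok (g * h)" if "?ok g" "?ok h" for g h
  proof -
    have "der (ev n (g * h)) - ?K * ev n (der (g * h)) =
        ev n h * (der (ev n g) - ?K * ev n (der g)) + ev n g * (der (ev n h) - ?K * ev n (der h))"
      unfolding ev_mult ev_add der_mult by (simp only: algebra_simps)
    then show ?thesis using that by (simp only: J_add J_mult)
  qed
  have ok_const: "?ok [:[:r:]:]" for r by (simp add: ev_const der_const J0)
  have sub_x: "sub n [:0, 1:] = U n"
    by (simp add: sub_def map_poly_pCons \<phi>_1 pcompose_pCons)
  have ev_y: "ev n [:0, 1:] = [:0, W n:]"
    by (simp add: ev_pCons)
  have ok_x: "?ok [:[:0, 1:]:]"
  proof -
    have "der (ev n [:[:0, 1:]:]) - ?K * ev n (der [:[:0, 1:]:]) =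
        - ([:0, 1:] * [:of_nat p * c n * W n - pderiv (U n):])"
      unfolding der_var_x ev_y by (simp add: ev_pCons sub_x der_x)
    then show ?thesis using dvd_J[OF dvd_const_poly[OF dU]] by (simp only: J_minus J_mult)
  qed
  have ok_y: "?ok [:0, 1:]"
  proof -
    have 1: "sub n (smult half (pderiv f)) = smult half (dcubic A (U n))"
    proof -
      have "sub n ([:half:] * pderiv f) = [:half:] * dcubic A (U n)"
        unfolding sub_mult sub_const phi_half using phi_df_pcompose[of "U n"] by (simp add: sub_def)
      then show ?thesis by simp
    qed
    have 2: "smult half (pderiv f) * W n + f * pderiv (W n) =
        smult half (W n * pderiv f + 2 * f * pderiv (W n))"
      using smult_half[of "f * pderiv (W n)"] by (simp add: smult_add_right algebra_simps)
    have "der (ev n [:0, 1:]) - ?K * ev n (der [:0, 1:]) =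
        [:smult half (pderiv f) * W n, 0, pderiv (W n):] - ?K * [:smult half (dcubic A (U n)):]"
      unfolding ev_y der_y by (simp add: ev_pCons 1 der_y)
    \<comment> \<open>The \<open>y^2\<close> term is removed with \<open>E\<close>, which turns
      \<open>W' y^2\<close> into \<open>f W'\<close>.\<close>
    also have "[:smult half (pderiv f) * W n, 0, pderiv (W n):] =
        E * [:pderiv (W n):] + [:smult half (W n * pderiv f + 2 * f * pderiv (W n)):]"
      unfolding 2[symmetric] by (simp add: E_eq)
    also have "E * [:pderiv (W n):] + [:smult half (W n * pderiv f + 2 * f * pderiv (W n)):]
        - ?K * [:smult half (dcubic A (U n)):] =
        E * [:pderiv (W n):] - [:[:half:]:] *
          [:of_nat p * c n * dcubic A (U n) - (W n * pderiv f + 2 * f * pderiv (W n)):]"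
      by (simp add: smult_diff_right smult_add_right mult.commute)
    finally show ?thesis using dvd_J[OF dvd_const_poly[OF dW]] J_E by (simp only: J_diff J_mult)
  qed
  have ok_h: "?ok [:h:]" for h
  proof (induction h)
    case 0
    show ?case using J0 by simp
  next
    case (pCons r h)
    have "?ok ([:[:r:]:] + [:[:0, 1:]:] * [:h:])"
      by (intro ok_add ok_mult ok_const ok_x pCons.IH)
    then show ?case by simp
  qed
  show ?thesis
  proof (induction g)
    case 0
    show ?case using J0 by simp
  next
    case (pCons h g)
    have "?ok ([:h:] + [:0, 1:] * g)" by (intro ok_add ok_mult ok_h ok_y pCons.IH)
    then show ?case by simp
  qed
qed

text \<open>The choice of representative is harmless because \<open>ev n\<close> preserves
  \<open>J n\<close>.\<close>

definition \<Phi> :: "(nat \<Rightarrow> 'a poly poly set set) \<Rightarrow> nat \<Rightarrow> 'a poly poly set set" where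
  "\<Phi> s n = \<pi> n (ev n (SOME g. \<pi> n g = s n))"

lemma \<Phi>_\<pi>: "\<Phi> (\<lambda>n. \<pi> n (g n)) = (\<lambda>n. \<pi> n (ev n (g n)))"
proof
  fix n
  have "\<pi> n (SOME h. \<pi> n h = \<pi> n (g n)) = \<pi> n (g n)" by (rule someI) (rule refl)
  then have "\<pi> n (ev n (SOME h. \<pi> n h = \<pi> n (g n))) = \<pi> n (ev n (g n))"
    unfolding \<pi>_eq_iff using ev_J by (simp flip: ev_diff)
  then show "\<Phi> (\<lambda>n. \<pi> n (g n)) n = \<pi> n (ev n (g n))" by (simp add: \<Phi>_def)
qed

lemma \<Phi>_ring_hom: "\<Phi> \<in> ring_hom (curve_hat p a b) (curve_hat p a b)"
proof (rule ring_hom_memI)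
  fix s assume "s \<in> carrier (curve_hat p a b)"
  then obtain g where "coherent g" "s = (\<lambda>n. \<pi> n (g n))" by (auto simp: carrier_completion)
  then show "\<Phi> s \<in> carrier (curve_hat p a b)"
    using coherent_ev by (auto simp: carrier_completion \<Phi>_\<pi>)
qed (auto simp: carrier_completion completion_add completion_mult completion_one \<pi>_add \<pi>_mult \<Phi>_\<pi>
    ev_add ev_mult ev_1)

lemma \<Phi>_frobenius_lift: "curve_frobenius_lift p \<phi> a b \<Phi>"
proof -
  have "\<Phi> s \<ominus>\<^bsub>curve_hat p a b\<^esub> s [^]\<^bsub>curve_hat p a b\<^esub> p \<in> padic_ideal (curve_hat p a b) p 1"
    if s: "s \<in> carrier (curve_hat p a b)" for s
  proof -
    obtain g where g: "coherent g" "s = (\<lambda>n. \<pi> n (g n))" using s by (auto simp: carrier_completion)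
    have co: "coherent (\<lambda>n. ev n (g n))" "coherent (\<lambda>n. g n ^ p)"
      using g(1) by (simp_all add: coherent_ev coherent_power)
    \<comment> \<open>The ideal is generated by \<open>p\<close> in the completion itself, so
      divisibility at each level has to be turned into one coherent quotient.\<close>
    obtain k where k: "coherent k" "\<And>n. ev n (g n) - g n ^ p - of_nat p * k n \<in> J n"
      by (rule coherent_divide[OF coherent_minus[OF co] ev_frobenius]) blast
    have "\<pi> n (ev n (g n) - g n ^ p) = \<pi> n (k n * of_nat p)" for n
      using k(2)[of n] by (simp add: \<pi>_eq_iff mult.commute)
    then have "\<Phi> s \<ominus>\<^bsub>curve_hat p a b\<^esub> s [^]\<^bsub>curve_hat p a b\<^esub> p =
        (\<lambda>n. \<pi> n (k n)) \<otimes>\<^bsub>curve_hat p a b\<^esub> add_pow (curve_hat p a b) (p ^ 1) \<one>\<^bsub>curve_hat p a b\<^esub>"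
      using co by (simp add: g \<Phi>_\<pi> completion_pow completion_minus completion_add_pow completion_mult \<pi>_mult)
    moreover have "(\<lambda>n. \<pi> n (k n)) \<in> carrier (curve_hat p a b)" using k(1) by (auto simp: carrier_completion)
    ultimately show ?thesis unfolding padic_ideal_def cgenideal_def by blast
  qed
  moreover have "\<Phi> (curve_hat_const p a b r) = curve_hat_const p a b (\<phi> r)" for r
    by (simp add: curve_hat_const_def curve_const_def to_completion_\<pi> \<Phi>_\<pi> ev_const)
  ultimately show ?thesis
    using \<Phi>_ring_hom by (simp add: curve_frobenius_lift_def lifts_frobenius_def)
qed

lemma reduce_\<Phi>: "reduce_endo C p \<Phi> n (\<pi> n g) = \<pi> n (ev n g)"
  unfolding reduce_endo_def
proof (rule induced_\<pi>)
  fix h assume "\<pi> n h = \<pi> n g"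
  then show "\<Phi> (to_completion C p (curve_class a b h)) n = \<pi> n (ev n g)"
    unfolding \<pi>_eq_iff to_completion_\<pi> \<Phi>_\<pi> using ev_J by (simp flip: ev_diff)
qed

lemma pullback_omega:
  "complete_pullback ring_of_type_algebra C (curve_const a b) p \<Phi> (curve_omega p a b) =
     (\<lambda>n. Cl n (of_nat p * [:c n:]))"
proof
  fix n
  have "padic_kaehler_map ring_of_type_algebra C (curve_const a b) p n n (reduce_endo C p \<Phi> n) (Cl n 1) =
      Cl n ([:of_nat p * c n:] * ev n 1)"
    using reduce_\<Phi> ev_1 ev_add ev_mult der_ev by (rule kaehler_map_level)
  then show "complete_pullback ring_of_type_algebra C (curve_const a b) p \<Phi> (curve_omega p a b) n =
     Cl n (of_nat p * [:c n:])"
    by (simp add: complete_pullback_def omega_eq ev_1 of_nat_poly[of p])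
qed

text \<open>\<open>\<eta>\<close> has coordinate \<open>c n\<close>, which is the coordinate of the
  pullback with its factor \<open>p\<close> dropped; \<open>\<theta>\<close> comes from the coherent
  division of \<open>c n - l\<close> by \<open>p\<close>.\<close>

lemma \<Phi>_lie_invariant: "lie_invariant_mod p a b \<Phi> 1 l"
proof -
  have co: "coherent (\<lambda>n. [:c n:])"
    unfolding coherent_def using dvd_J[OF dvd_const_poly[OF c_step]] by simp
  have "[:c n:] - [:[:l:]:] \<in> J 1" for n
    using dvd_J[OF dvd_const_poly[of 1 "c n - [:l:]"]] c_mod_p[of n] by simp
  then obtain k where k: "coherent k" "\<And>n. [:c n:] - [:[:l:]:] - of_nat p * k n \<in> J n"
    by (rule coherent_divide[OF coherent_minus[OF co coherent_const]]) blast
  have "curve_hat_const p a b l \<odot>\<^bsub>M\<^esub> curve_omega p a b = (\<lambda>n. Cl n [:[:l:]:])"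
    unfolding omega_eq curve_hat_const_def curve_const_def to_completion_\<pi> M_smult by simp
  moreover have "Cl n ([:c n:] - [:[:l:]:]) = Cl n (of_nat p * k n)" for n
    using k(2)[of n] by (simp only: Cl_eq_iff)
  ultimately have "(\<lambda>n. Cl n [:c n:]) \<ominus>\<^bsub>M\<^esub> (curve_hat_const p a b l \<odot>\<^bsub>M\<^esub> curve_omega p a b) =
      add_pow M (p ^ 1) (\<lambda>n. Cl n (k n))"
    using M_minus[OF co coherent_const[of "[:[:l:]:]"]] by (simp add: M_add_pow)
  moreover have "(\<lambda>n. Cl n [:c n:]) \<in> carrier M" "(\<lambda>n. Cl n (k n)) \<in> carrier M"
    using co k(1) by (auto simp: carrier_M)
  moreover have "add_pow M p (\<lambda>n. Cl n [:c n:]) =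
      complete_pullback ring_of_type_algebra C (curve_const a b) p \<Phi> (curve_omega p a b)"
    unfolding pullback_omega M_add_pow ..
  ultimately show ?thesis unfolding lie_invariant_mod_def Let_def by blast
qed

end

section \<open>Discrete valuation rings with uniformizer \<open>p\<close>\<close>

lemma type_ring_padic_ideal: "padic_ideal ring_of_type_algebra p 1 = {z :: 'r::comm_ring_1. of_nat p dvd z}"
  by (simp add: padic_ideal_def)

text \<open>A maximal ideal is prime. If \<open>p\<close> were zero, the zero ideal would be maximal
  and the ring a field, which the definition of a discrete valuation ring excludes.\<close>

lemma prime_elem_if_maximalideal:
  assumes "discrete_valuation_ring (ring_of_type_algebra :: 'r::idom ring)"
    and max: "maximalideal (padic_ideal (ring_of_type_algebra :: 'r ring) p 1) ring_of_type_algebra"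
  shows "prime_elem (of_nat p :: 'r)"
proof -
  let ?R = "ring_of_type_algebra :: 'r ring"
  interpret R: cring ?R by (rule cring_from_type_algebra)
  have max': "maximalideal {z :: 'r. of_nat p dvd z} ?R" using max by (simp only: type_ring_padic_ideal)
  interpret I: primeideal "{z :: 'r. of_nat p dvd z}" ?R by (rule R.maximalideal_prime[OF max'])
  show ?thesis
  proof (rule prime_elemI)
    show "(of_nat p :: 'r) \<noteq> 0"
    proof
      assume "(of_nat p :: 'r) = 0"
      then have "{z :: 'r. of_nat p dvd z} = {\<zero>\<^bsub>?R\<^esub>}" by auto
      then show False
        using max' R.zeromaximalideal_eq_field assms(1) by (simp add: discrete_valuation_ring_def)
    qed
    show "\<not> (of_nat p :: 'r) dvd 1"
    proof
      assume "(of_nat p :: 'r) dvd 1"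
      then have "carrier ?R = {z :: 'r. of_nat p dvd z}" by (auto intro: dvd_trans)
      then show False using I.I_notcarr by simp
    qed
    show "of_nat p dvd x \<or> of_nat p dvd y" if "of_nat p dvd x * y" for x y :: 'r
      using I.I_prime[of x y] that by simp
  qed
qed

text \<open>A nonzero non-unit has an irreducible divisor, which generates a maximal ideal in a
  principal domain; the only maximal ideal is the one generated by \<open>p\<close>.\<close>

lemma unit_if_not_dvd_uniformizer:
  fixes r :: "'r::idom"
  assumes dvr: "discrete_valuation_ring (ring_of_type_algebra :: 'r ring)"
    and max: "maximalideal (padic_ideal (ring_of_type_algebra :: 'r ring) p 1) ring_of_type_algebra"
    and "\<not> of_nat p dvd r"
  shows "r dvd 1"
proof (rule ccontr)
  assume r: "\<not> r dvd 1"
  let ?R = "ring_of_type_algebra :: 'r ring"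
  interpret R: principal_domain ?R using dvr by (simp add: discrete_valuation_ring_def)
  have "r \<notin> Units ?R" using r by (auto simp: Units_def dvd_def mult.commute)
  moreover have "r \<in> carrier ?R - {\<zero>\<^bsub>?R\<^esub>}" using assms(3) by auto
  ultimately obtain q where q: "q \<in> carrier ?R" "ring_irreducible\<^bsub>?R\<^esub> q" "q divides\<^bsub>?R\<^esub> r"
    using R.exists_irreducible_divisor by blast
  have "maximalideal (PIdl\<^bsub>?R\<^esub> q) ?R" using q(1,2) by (rule R.irreducible_imp_maximalideal)
  then have "PIdl\<^bsub>?R\<^esub> q = padic_ideal ?R p 1"
    using dvr max unfolding discrete_valuation_ring_def by blast
  then have eq: "{z. q dvd z} = {z. of_nat p dvd z}" by (simp only: type_ring_padic_ideal type_ring_PIdl)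
  have "q \<in> {z. of_nat p dvd z}" unfolding eq[symmetric] by simp
  then have "of_nat p dvd q" by simp
  moreover have "q dvd r" using q(3) by (auto simp: factor_def)
  ultimately show False using assms(3) dvd_trans by blast
qed

text \<open>The polynomial is reduced modulo \<open>p\<close>, a root is taken in the residue field
  and lifted back along the surjection \<open>\<rho>\<close>.\<close>

lemma ex_root_if_algebraically_closed:
  fixes g :: "'r::idom poly"
  assumes "algebraically_closed (padic_quot (ring_of_type_algebra :: 'r ring) p 1)"
    and "lead_coeff g = 1" "Polynomial.degree g > 0"
  shows "\<exists>r. of_nat p dvd poly g r"
proof -
  let ?R = "ring_of_type_algebra :: 'r ring"
  define I where "I = padic_ideal ?R p 1"
  define \<rho> where "\<rho> = padic_class ?R p 1"
  define K where "K = padic_quot ?R p 1"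
  interpret R: cring ?R by (rule cring_from_type_algebra)
  interpret K: algebraically_closed K unfolding K_def by (rule assms(1))
  have I: "ideal I ?R" unfolding I_def padic_ideal_def by (rule R.cgenideal_ideal) simp
  have "\<rho> \<in> ring_hom ?R K"
    using ideal.rcos_ring_hom[OF I] by (simp add: \<rho>_def padic_class_def[abs_def] padic_quot_def I_def K_def)
  then interpret \<rho>: ring_hom_cring ?R K \<rho>
    by (intro ring_hom_cring.intro ring_hom_cring_axioms.intro R.is_cring K.is_cring)
  have \<rho>_closed [simp]: "\<rho> r \<in> carrier K" for r using \<rho>.hom_closed by simp
  have \<rho>_surj: "carrier K = range \<rho>"
    by (auto simp: K_def padic_quot_def FactRing_def A_RCOSETS_def' \<rho>_def padic_class_def)
  \<comment> \<open>List polynomials begin with the leading coefficient, hence the reversal;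
    evaluation then follows Horner's rule.\<close>
  have eval: "K.eval (map \<rho> (rev (coeffs h))) (\<rho> r) = \<rho> (poly h r)" for h r
  proof (induction h)
    case 0
    show ?case using \<rho>.hom_zero by simp
  next
    case (pCons c h)
    have "coeffs (pCons c h) = c # coeffs h" using pCons.hyps by (auto simp: cCons_def)
    then have "K.eval (map \<rho> (rev (coeffs (pCons c h)))) (\<rho> r) =
        K.eval (map \<rho> (rev (coeffs h))) (\<rho> r) \<otimes>\<^bsub>K\<^esub> \<rho> r \<oplus>\<^bsub>K\<^esub> \<rho> c"
      by (simp add: K.eval_append_aux image_subset_iff)
    also have "\<dots> = \<rho> (poly (pCons c h) r)"
      unfolding pCons.IH using \<rho>.hom_mult[of "poly h r" r] \<rho>.hom_add[of "poly h r * r" c]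
      by (simp add: add.commute mult.commute)
    finally show ?case .
  qed
  define P where "P = map \<rho> (rev (coeffs g))"
  have g0: "g \<noteq> 0" using assms(2) by auto
  \<comment> \<open>Since \<open>g\<close> is monic, the reduced list has head one and is a valid
    polynomial of the same degree.\<close>
  have "hd P = \<rho> (last (coeffs g))" using g0 by (simp add: P_def hd_map hd_rev)
  also have "\<dots> = \<one>\<^bsub>K\<^esub>" using g0 assms(2) \<rho>.hom_one by (simp add: last_coeffs_eq_coeff_degree)
  finally have "polynomial\<^bsub>K\<^esub> (carrier K) P"
    by (auto simp: polynomial_def P_def)
  then have P: "P \<in> carrier (poly_ring K)" by (simp only: univ_poly_carrier)
  have "length P - 1 > 0" using assms(3) by (simp add: P_def length_coeffs_degree g0)
  then have "size (K.roots P) \<noteq> 0"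
    using K.roots_over_carrier[OF P] by (simp add: K.splitted_def)
  then obtain x where "x \<in># K.roots P" by (metis multiset_nonemptyE size_empty)
  then have "x \<in> carrier K" "K.eval P x = \<zero>\<^bsub>K\<^esub>"
    using K.roots_mem_iff_is_root[OF P] by (auto simp: K.is_root_def)
  then obtain r where "\<rho> (poly g r) = \<rho> 0" using \<rho>.hom_zero by (auto simp: \<rho>_surj P_def eval)
  then have "poly g r \<ominus>\<^bsub>?R\<^esub> 0 \<in> I"
    unfolding \<rho>_def padic_class_def I_def[symmetric]
    by (subst R.quotient_eq_iff_same_a_r_cos[OF I]) simp_all
  then show ?thesis by (auto simp: I_def padic_ideal_def)
qed

theorem theorem1p1:
  fixes p :: nat and a b :: "'r::idom" and \<phi> :: "'r \<Rightarrow> 'r"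
  defines "R \<equiv> (ring_of_type_algebra :: 'r ring)"
  assumes "Factorial_Ring.prime p" and "p \<noteq> 2" and "p \<noteq> 3"
    and "discrete_valuation_ring R"
    and "maximalideal (padic_ideal R p 1) R"
    and "padically_complete R p"
    and "algebraically_closed (padic_quot R p 1)"
    and "lifts_frobenius R p \<phi>"
    and "ordinary_pair p a b"
  shows "\<exists>\<Phi>. curve_frobenius_lift p \<phi> a b \<Phi> \<and>
             lie_invariant_mod p a b \<Phi> 1 (inv\<^bsub>R\<^esub> (hasse p a b))"
proof -
  note hyps = assms(2-)[unfolded R_def]
  interpret frobenius_dvr p \<phi>
  proof
    show "prime_elem (of_nat p :: 'r)" using hyps(4,5) by (rule prime_elem_if_maximalideal)
    show "r dvd 1" if "\<not> of_nat p dvd r" for r :: 'r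
      using hyps(4,5) that by (rule unit_if_not_dvd_uniformizer)
    have hom: "\<phi> \<in> ring_hom R R" and frob: "\<And>s. \<phi> s \<ominus>\<^bsub>R\<^esub> s [^]\<^bsub>R\<^esub> p \<in> padic_ideal R p 1"
      using hyps(8) by (simp_all add: lifts_frobenius_def R_def)
    show "\<phi> (r + s) = \<phi> r + \<phi> s" "\<phi> (r * s) = \<phi> r * \<phi> s" for r s
      using ring_hom_add[OF hom, of r s] ring_hom_mult[OF hom, of r s] by (simp_all add: R_def)
    show "\<phi> 1 = 1" using ring_hom_one[OF hom] by (simp add: R_def)
    show "of_nat p dvd \<phi> r - r ^ p" for r
      using frob[of r] by (simp add: R_def padic_ideal_def)
    show "\<exists>r. of_nat p dvd poly g r" if "lead_coeff g = 1" "Polynomial.degree g > 0" for g :: "'r poly"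
      using hyps(7) that by (rule ex_root_if_algebraically_closed)
  qed (use hyps in simp_all)
  obtain l where l: "hasse p a b * l = 1" using hyps(9) by (metis ordinary_pair_def dvdE)
  obtain d where d: "discriminant a b * d = 1"
    using hyps(9) by (metis ordinary_pair_def nonsingular_pair_def dvdE)
  have "\<not> p dvd 2" using p_ge_5 by (auto dest: dvd_imp_le)
  then obtain h where h: "2 * h = (1 :: 'r)" using of_nat_unit[of 2] by (metis dvdE of_nat_numeral)
  interpret ordinary_curve p \<phi> a b l d h
    by unfold_locales (fact l d h)+
  obtain U W c where UWc: "frobenius_data p \<phi> a b l d h U W c"
  proof (rule ex_frobenius_data)
    fix U W c
    assume *: "\<And>n. of_nat p ^ n dvd U (Suc n) - U n" "\<And>n. of_nat p ^ n dvd W (Suc n) - W n"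
      "\<And>n. of_nat p ^ n dvd c (Suc n) - c n"
      "\<And>n. of_nat p dvd U n - xp" "\<And>n. of_nat p dvd W n - f ^ m" "\<And>n. of_nat p dvd c n - [:l:]"
      "\<And>n. of_nat p ^ n dvd f * W n ^ 2 - cubic A B (U n)"
      "\<And>n. of_nat p ^ n dvd of_nat p * c n * W n - pderiv (U n)"
      "\<And>n. of_nat p ^ n dvd of_nat p * c n * dcubic A (U n) - (W n * pderiv f + 2 * f * pderiv (W n))"
    have "frobenius_data p \<phi> a b l d h U W c" by unfold_locales (fact *)+
    then show thesis by (rule that)
  qed
  interpret frobenius_data p \<phi> a b l d h U W c by (fact UWc)
  interpret R: cring R unfolding R_def by (rule cring_from_type_algebra)
  have "inv\<^bsub>R\<^esub> (hasse p a b) = l"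
    by (rule R.comm_inv_char) (use l in \<open>simp_all add: R_def\<close>)
  then show ?thesis using \<Phi>_frobenius_lift \<Phi>_lie_invariant by auto
qed

end
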